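(* Let $m,n\ge 1$, $\mathfrak g=\mathfrak{gl}(m|n)$ over $\mathbb C$, $1\le s\le m$, $1\le t\le n$, and $\beta=\delta_s-\epsilon_t$. Let $\lambda=(a_m,a_{m-1},\ldots,a_1\,|\,b_1,b_2,\ldots,b_n)\in\mathfrak h^*$ be a $\beta$-atypical weight, i.e. $(\lambda+\rho,\beta)=0$, equivalently $a_s+b_t+s-t=0$. Let $v_\lambda^+$ be the highest weight vector of the Verma module $M(\lambda)$ and let $S_{-\beta}=\sum_{J\in\mathcal A}d_JE_J\in U(\mathfrak n^-)$. Then $S_{-\beta}v_\lambda^+$ is the unique (up to a nonzero scalar multiple) singular vector in $M(\lambda)$ of weight $\lambda-\beta$. In particular, $$\mathrm{Hom}_{\mathfrak g}\big(M(\lambda-\beta),M(\lambda)\big)=\mathbb C .$$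
   Context: Let $I=\{\overline m,\overline{m-1},\ldots,\overline 1,1,2,\ldots,n\}$ with total order $\overline m<\overline{m-1}<\cdots<\overline 1<1<2<\cdots<n$. The Lie superalgebra $\mathfrak g=\mathfrak{gl}(m|n)$ has standard basis of matrix units $E_{i,j}$ $(i,j\in I)$; $E_{i,j}$ is even if $i,j$ are both barred or both unbarred, and odd otherwise. $\mathfrak h$ is the Cartan subalgebra of diagonal matrices, and $\mathfrak n^-$ (resp. $\mathfrak n^+$) is the subalgebra of strictly lower (resp. strictly upper) triangular matrices with respect to the order on $I$. $\{\delta_m,\ldots,\delta_1,\epsilon_1,\ldots,\epsilon_n\}\subset\mathfrak h^*$ is the basis dual to $\{E_{\overline m,\overline m},\ldots,E_{\overline 1,\overline 1},E_{1,1},\ldots,E_{n,n}\}$. The symmetric form on $\mathfrak h^*$ is given by $(\delta_i,\epsilon_k)=0$, $(\delta_i,\delta_j)=-(\epsilon_i,\epsilon_j)=1$ if $i=j$ and $0$ if $i\ne j$. A weight $\lambda=\sum_i a_i\delta_i+\sum_j b_j\epsilon_j$ is written $(a_m,\ldots,a_1\,|\,b_1,\ldots,b_n)$. The Weyl vector is $\rho=\sum_{i=1}^m i\delta_i-\sum_{j=1}^n j\epsilon_j-\frac{m+n+1}{2}\big(\sum_{i=1}^m\delta_i-\sum_{j=1}^n\epsilon_j\big)$. The Verma module is $M(\lambda)=\mathrm{Ind}_{\mathfrak h\oplus\mathfrak n^+}^{\mathfrak g}\mathbb C 1_\lambda$, where $h\cdot 1_\lambda=\lambda(h)1_\lambda$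 for $h\in\mathfrak h$ and $\mathfrak n^+\cdot 1_\lambda=0$; its highest weight vector is $v_\lambda^+=1\otimes 1_\lambda$. A nonzero vector $v$ in a $\mathfrak g$-module is singular if $\mathfrak n^+\cdot v=0$. $\mathrm{Hom}_{\mathfrak g}$ denotes the space of $U(\mathfrak g)$-linear maps. Given $\beta=\delta_s-\epsilon_t$ and $\lambda$, define scalars $c_k$ for $k\in I$ with $\overline s<k<t$ by $c_{\overline{k}}=a_s-a_k+s-1-k$ for $1\le k\le s-1$ (so $c_{\overline{s-1}}=a_s-a_{s-1}$, ..., $c_{\overline 1}=a_s-a_1+s-2$), and $c_k=b_t-b_k-(t-k)$ for $1\le k\le t-1$ (so $c_{t-1}=b_t-b_{t-1}-1$, ..., $c_1=b_t-b_1-t+1$). Let $\mathcal A$ be the set of all subsets $J=\{j_1<j_2<\cdots<j_p\}$ (including $J=\emptyset$) of $\{k\in I:\overline s<k<t\}$. For $J\in\mathcal A$ put $E_J=E_{t,j_p}E_{j_p,j_{p-1}}\cdots E_{j_1,\overline s}\in U(\mathfrak n^-)$, with $E_\emptyset=E_{t,\overline s}$, and $d_J=\prod_{\overline s<k<t,\;k\notin J}c_k$ (empty product $=1$). *)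

theory Defs
  imports
    Complex_Main
    "HOL-Algebra.QuotRing"
    "HOL-Algebra.Module"
    "HOL-Library.Poly_Mapping"
begin

section \<open>The Lie superalgebra \<open>gl(m|n)\<close>\<close>

text \<open>
  The barred index \<open>k\<close> is encoded as the negative integer \<open>-k\<close>. The prescribed total order on
  the index set is then the usual order on the integers.
\<close>

definition idx :: "nat \<Rightarrow> nat \<Rightarrow> int set"
  where "idx m n = {- int m .. int n} - {0}"

definition idx_parity :: "int \<Rightarrow> nat"
  where "idx_parity i = (if i < 0 then 0 else 1)"

type_synonym mat = "int \<Rightarrow> int \<Rightarrow> complex"

definition gl :: "nat \<Rightarrow> nat \<Rightarrow> mat set"
  where "gl m n = {x. \<forall>i j. x i j \<noteq> 0 \<longrightarrow> i \<in> idx m n \<and> j \<in> idx m n}"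

text \<open>Homogeneous elements of parity \<open>p \<in> {0, 1}\<close>.\<close>

definition gl_part :: "nat \<Rightarrow> nat \<Rightarrow> nat \<Rightarrow> mat set"
  where "gl_part m n p =
    {x \<in> gl m n. \<forall>i j. x i j \<noteq> 0 \<longrightarrow> (idx_parity i + idx_parity j) mod 2 = p}"

definition mat_mult :: "nat \<Rightarrow> nat \<Rightarrow> mat \<Rightarrow> mat \<Rightarrow> mat"
  where "mat_mult m n x y = (\<lambda>i j. \<Sum>k\<in>idx m n. x i k * y k j)"

text \<open>The superbracket of homogeneous elements \<open>x\<close>, \<open>y\<close> of parities \<open>p\<close>, \<open>q\<close>.\<close>

definition superbracket :: "nat \<Rightarrow> nat \<Rightarrow> nat \<Rightarrow> nat \<Rightarrow> mat \<Rightarrow> mat \<Rightarrow> mat"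
  where "superbracket m n p q x y =
    (\<lambda>i j. mat_mult m n x y i j - (- 1) ^ (p * q) * mat_mult m n y x i j)"

definition cartan :: "nat \<Rightarrow> nat \<Rightarrow> mat set"
  where "cartan m n = {x \<in> gl m n. \<forall>i j. x i j \<noteq> 0 \<longrightarrow> i = j}"

definition n_plus :: "nat \<Rightarrow> nat \<Rightarrow> mat set"
  where "n_plus m n = {x \<in> gl m n. \<forall>i j. x i j \<noteq> 0 \<longrightarrow> i < j}"

text \<open>\<open>h \<oplus> n\<^sup>+\<close>, the upper triangular matrices.\<close>

definition borel :: "nat \<Rightarrow> nat \<Rightarrow> mat set"
  where "borel m n = {\<lambda>i j. h i j + x i j | h x. h \<in> cartan m n \<and> x \<in> n_plus m n}"


section \<open>Weights\<close>

text \<open>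
  A weight is given by its coordinates in the basis dual to the diagonal matrix units: \<open>lam (-k)\<close>
  is the coefficient \<open>a\<^sub>k\<close> of \<open>\<delta>\<^sub>k\<close>, and \<open>lam k\<close> is the coefficient \<open>b\<^sub>k\<close> of \<open>\<epsilon>\<^sub>k\<close>.
  Only the values on the index set matter.
\<close>

type_synonym weight = "int \<Rightarrow> complex"

definition weight_eval :: "nat \<Rightarrow> nat \<Rightarrow> weight \<Rightarrow> mat \<Rightarrow> complex"
  where "weight_eval m n lam h = (\<Sum>i\<in>idx m n. lam i * h i i)"

definition weight_add :: "weight \<Rightarrow> weight \<Rightarrow> weight"
  where "weight_add lam mu = (\<lambda>i. lam i + mu i)"

definition weight_diff :: "weight \<Rightarrow> weight \<Rightarrow> weight"
  where "weight_diff lam mu = (\<lambda>i. lam i - mu i)"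

definition delta :: "nat \<Rightarrow> weight"
  where "delta k = (\<lambda>i. if i = - int k then 1 else 0)"

definition eps :: "nat \<Rightarrow> weight"
  where "eps k = (\<lambda>i. if i = int k then 1 else 0)"

definition weight_form :: "nat \<Rightarrow> nat \<Rightarrow> weight \<Rightarrow> weight \<Rightarrow> complex"
  where "weight_form m n lam mu =
    (\<Sum>k=1..m. lam (- int k) * mu (- int k)) - (\<Sum>k=1..n. lam (int k) * mu (int k))"

definition rho :: "nat \<Rightarrow> nat \<Rightarrow> weight"
  where "rho m n = (\<lambda>i.
    (\<Sum>k=1..m. of_nat k * delta k i) - (\<Sum>k=1..n. of_nat k * eps k i)
    - of_nat (m + n + 1) / 2 * ((\<Sum>k=1..m. delta k i) - (\<Sum>k=1..n. eps k i)))"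

definition atypical :: "nat \<Rightarrow> nat \<Rightarrow> weight \<Rightarrow> weight \<Rightarrow> bool"
  where "atypical m n beta lam \<longleftrightarrow> weight_form m n (weight_add lam (rho m n)) beta = 0"

lemma delta_simps:
  "delta k (- int l) = (if l = k then 1 else 0)" "l \<ge> 1 \<Longrightarrow> delta k (int l) = 0"
  by (auto simp: delta_def)

lemma eps_simps:
  "eps k (int l) = (if l = k then 1 else 0)" "l \<ge> 1 \<Longrightarrow> eps k (- int l) = 0"
  by (auto simp: eps_def)

lemma rho_barred:
  assumes "1 \<le> k" "k \<le> m"
  shows "rho m n (- int k) = of_nat k - of_nat (m + n + 1) / 2"
proof -
  have "(\<Sum>l=1..m. of_nat l * delta l (- int k)) = (\<Sum>l=1..m. if l = k then of_nat k else 0)"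
    "(\<Sum>l=1..m. delta l (- int k)) = (\<Sum>l=1..m. if l = k then 1 else 0)"
    by (rule sum.cong; simp add: delta_simps)+
  then show ?thesis using assms by (simp add: rho_def eps_simps)
qed

lemma rho_unbarred:
  assumes "1 \<le> k" "k \<le> n"
  shows "rho m n (int k) = - of_nat k + of_nat (m + n + 1) / 2"
proof -
  have "(\<Sum>l=1..n. of_nat l * eps l (int k)) = (\<Sum>l=1..n. if l = k then of_nat k else 0)"
    "(\<Sum>l=1..n. eps l (int k)) = (\<Sum>l=1..n. if l = k then 1 else 0)"
    by (rule sum.cong; simp add: eps_simps)+
  then show ?thesis using assms by (simp add: rho_def delta_simps field_simps)
qed

lemma atypical_iff:
  assumes "1 \<le> s" "s \<le> m" "1 \<le> t" "t \<le> n"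
  shows "atypical m n (weight_diff (delta s) (eps t)) lam \<longleftrightarrow>
    lam (- int s) + lam (int t) + of_nat s - of_nat t = 0"
proof -
  let ?f = "weight_add lam (rho m n)"
  let ?b = "weight_diff (delta s) (eps t)"
  have "(\<Sum>k=1..m. ?f (- int k) * ?b (- int k)) = (\<Sum>k=1..m. if k = s then ?f (- int s) else 0)"
    by (rule sum.cong) (simp_all add: weight_diff_def delta_simps eps_simps)
  moreover have "(\<Sum>k=1..n. ?f (int k) * ?b (int k)) = (\<Sum>k=1..n. if k = t then - ?f (int t) else 0)"
    by (rule sum.cong) (simp_all add: weight_diff_def delta_simps eps_simps)
  ultimately have "weight_form m n ?f ?b = ?f (- int s) + ?f (int t)"
    using assms by (simp add: weight_form_def)
  also have "\<dots> = lam (- int s) + lam (int t) + of_nat s - of_nat t"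
    using assms by (simp add: weight_add_def rho_barred rho_unbarred)
  finally show ?thesis by (simp add: atypical_def)
qed


section \<open>The universal enveloping algebra\<close>

text \<open>
  Words form a monoid under concatenation, so that \<open>'x list \<Rightarrow>\<^sub>0 complex\<close> with the convolution
  product is the free associative unital algebra on \<open>'x\<close>.
\<close>

instantiation list :: (type) monoid_add
begin

definition zero_list :: "'a list" where "zero_list = []"
definition plus_list :: "'a list \<Rightarrow> 'a list \<Rightarrow> 'a list" where "plus_list xs ys = xs @ ys"

instance by standard (simp_all add: zero_list_def plus_list_def)

end

type_synonym tens = "(int \<times> int) list \<Rightarrow>\<^sub>0 complex"

text \<open>
  The tensor algebra of \<open>gl(m|n)\<close>, realised as the free algebra on the basis of matrix units.
\<close>

definition tensor_alg :: "nat \<Rightarrow> nat \<Rightarrow> tens ring"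
  where "tensor_alg m n =
    \<lparr>carrier = {p. \<forall>w\<in>Poly_Mapping.keys p. set w \<subseteq> idx m n \<times> idx m n},
     mult = (*), one = 1, zero = 0, add = (+)\<rparr>"

definition E :: "int \<Rightarrow> int \<Rightarrow> tens"
  where "E i j = Poly_Mapping.single [(i, j)] 1"

definition tens_const :: "complex \<Rightarrow> tens"
  where "tens_const c = Poly_Mapping.single [] c"

definition emb :: "nat \<Rightarrow> nat \<Rightarrow> mat \<Rightarrow> tens"
  where "emb m n x = (\<Sum>i\<in>idx m n. \<Sum>j\<in>idx m n. tens_const (x i j) * E i j)"

definition env_rels :: "nat \<Rightarrow> nat \<Rightarrow> tens set"
  where "env_rels m n =
    {emb m n x * emb m n y - tens_const ((- 1) ^ (p * q)) * (emb m n y * emb m n x)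
       - emb m n (superbracket m n p q x y) | p q x y.
     p \<in> {0, 1} \<and> q \<in> {0, 1} \<and> x \<in> gl_part m n p \<and> y \<in> gl_part m n q}"

definition env_ideal :: "nat \<Rightarrow> nat \<Rightarrow> tens set"
  where "env_ideal m n = Idl\<^bsub>tensor_alg m n\<^esub> (env_rels m n)"

definition env :: "nat \<Rightarrow> nat \<Rightarrow> tens set ring"
  where "env m n = tensor_alg m n Quot env_ideal m n"

definition env_class :: "nat \<Rightarrow> nat \<Rightarrow> tens \<Rightarrow> tens set"
  where "env_class m n p = env_ideal m n +>\<^bsub>tensor_alg m n\<^esub> p"

definition env_mat :: "nat \<Rightarrow> nat \<Rightarrow> mat \<Rightarrow> tens set"
  where "env_mat m n x = env_class m n (emb m n x)"

definition env_const :: "nat \<Rightarrow> nat \<Rightarrow> complex \<Rightarrow> tens set"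
  where "env_const m n c = env_class m n (tens_const c)"

lemma ring_tensor_alg: "ring (tensor_alg m n)"
proof -
  let ?C = "{p :: tens. \<forall>w\<in>Poly_Mapping.keys p. set w \<subseteq> idx m n \<times> idx m n}"
  have add: "p + q \<in> ?C" if "p \<in> ?C" "q \<in> ?C" for p q
    using that Poly_Mapping.keys_add[of p q] by blast
  have mult: "p * q \<in> ?C" if "p \<in> ?C" "q \<in> ?C" for p q
  proof (clarify)
    fix w and i j :: int
    assume "w \<in> Poly_Mapping.keys (p * q)" and ij: "(i, j) \<in> set w"
    then obtain u v where "w = u + v" "u \<in> Poly_Mapping.keys p" "v \<in> Poly_Mapping.keys q"
      using Poly_Mapping.keys_mult[of p q] by blast
    then show "i \<in> idx m n \<and> j \<in> idx m n" using that ij by (force simp: plus_list_def)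
  qed
  have uminus: "- p \<in> ?C" if "p \<in> ?C" for p using that by simp
  have one: "1 \<in> ?C" by (simp add: zero_list_def)
  have car: "carrier (tensor_alg m n) = ?C" by (simp add: tensor_alg_def)
  have ops: "x \<otimes>\<^bsub>tensor_alg m n\<^esub> y = x * y" "x \<oplus>\<^bsub>tensor_alg m n\<^esub> y = x + y"
    "\<one>\<^bsub>tensor_alg m n\<^esub> = 1" "\<zero>\<^bsub>tensor_alg m n\<^esub> = 0" for x y
    by (simp_all add: tensor_alg_def)
  have zero: "0 \<in> ?C" by simp
  have "abelian_group (tensor_alg m n)"
  proof (rule abelian_groupI; unfold car ops)
    show "\<exists>q\<in>?C. q + p = 0" if "p \<in> ?C" for p
      using uminus[OF that] by (intro bexI[of _ "- p"]) (rule left_minus)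
  qed (rule add zero add.assoc add.commute add_0_left; assumption?)+
  moreover have "monoid (tensor_alg m n)"
    by (rule monoidI; unfold car ops) (rule mult one mult.assoc mult_1_left mult_1_right; assumption?)+
  ultimately show ?thesis
    by (rule ringI; unfold car ops) (rule distrib_right distrib_left)+
qed


section \<open>Induced modules and Verma modules\<close>

definition pm_scale :: "complex \<Rightarrow> ('x \<Rightarrow>\<^sub>0 complex) \<Rightarrow> ('x \<Rightarrow>\<^sub>0 complex)"
  where "pm_scale c = Poly_Mapping.map ((*) c)"

lemma lookup_pm_scale: "Poly_Mapping.lookup (pm_scale c p) x = c * Poly_Mapping.lookup p x"
  by (simp add: pm_scale_def Poly_Mapping.map.rep_eq when_def)

interpretation pm: vector_space pm_scale
  by standard
    (simp_all add: poly_mapping_eq_iff fun_eq_iff lookup_pm_scale lookup_add algebra_simps)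

text \<open>
  Let \<open>b\<close> be a subalgebra of \<open>gl(m|n)\<close> acting on the one-dimensional space \<open>C 1\<^sub>\<chi>\<close> by
  \<open>x 1\<^sub>\<chi> = \<chi>(x) 1\<^sub>\<chi>\<close>; the scalar \<open>z\<close> stands for the vector \<open>z 1\<^sub>\<chi>\<close>.
  The module induced from \<open>b\<close> is the tensor product of \<open>U(gl(m|n))\<close> with \<open>C 1\<^sub>\<chi>\<close> over \<open>U(b)\<close>.
  It is the quotient of the complex vector space freely spanned by the pairs \<open>(u, z)\<close>
  by the relations of bilinearity and \<open>u x \<otimes> z = u \<otimes> x z\<close>.
  As \<open>b\<close> generates the algebra \<open>U(b)\<close>, it suffices to impose the latter for \<open>x \<in> b\<close>.
\<close>

type_synonym pre_tensor = "tens set \<times> complex \<Rightarrow>\<^sub>0 complex"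

definition pre_ind :: "nat \<Rightarrow> nat \<Rightarrow> pre_tensor set"
  where "pre_ind m n = {p. Poly_Mapping.keys p \<subseteq> carrier (env m n) \<times> UNIV}"

definition pt :: "tens set \<Rightarrow> complex \<Rightarrow> pre_tensor"
  where "pt u z = Poly_Mapping.single (u, z) 1"

definition ind_rels :: "nat \<Rightarrow> nat \<Rightarrow> mat set \<Rightarrow> (mat \<Rightarrow> complex) \<Rightarrow> pre_tensor set"
  where "ind_rels m n b \<chi> = (let U = env m n in
      {pt (u \<oplus>\<^bsub>U\<^esub> v) z - pt u z - pt v z | u v z. u \<in> carrier U \<and> v \<in> carrier U}
    \<union> {pt u (y + z) - pt u y - pt u z | u y z. u \<in> carrier U}
    \<union> {pt (env_const m n c \<otimes>\<^bsub>U\<^esub> u) z - pm_scale c (pt u z) | c u z. u \<in> carrier U}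
    \<union> {pt u (c * z) - pm_scale c (pt u z) | c u z. u \<in> carrier U}
    \<union> {pt (u \<otimes>\<^bsub>U\<^esub> env_mat m n x) z - pt u (\<chi> x * z) | u x z. u \<in> carrier U \<and> x \<in> b})"

definition ind_equiv :: "nat \<Rightarrow> nat \<Rightarrow> mat set \<Rightarrow> (mat \<Rightarrow> complex) \<Rightarrow> (pre_tensor \<times> pre_tensor) set"
  where "ind_equiv m n b \<chi> =
    {(p, q). p \<in> pre_ind m n \<and> q \<in> pre_ind m n \<and> p - q \<in> pm.span (ind_rels m n b \<chi>)}"

definition pre_act :: "nat \<Rightarrow> nat \<Rightarrow> tens set \<Rightarrow> pre_tensor \<Rightarrow> pre_tensor"
  where "pre_act m n u p = (\<Sum>(v, z)\<in>Poly_Mapping.keys p.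
    pm_scale (Poly_Mapping.lookup p (v, z)) (pt (u \<otimes>\<^bsub>env m n\<^esub> v) z))"

text \<open>
  The record type \<open>module\<close> also has the fields \<open>mult\<close> and \<open>one\<close>, which play no role for modules.
\<close>

definition induced ::
    "nat \<Rightarrow> nat \<Rightarrow> mat set \<Rightarrow> (mat \<Rightarrow> complex) \<Rightarrow> (tens set, pre_tensor set) module"
  where "induced m n b \<chi> = (let r = ind_equiv m n b \<chi> in
    \<lparr>carrier = pre_ind m n // r, mult = undefined, one = undefined,
     zero = r `` {0},
     add = (\<lambda>X Y. \<Union>p\<in>X. \<Union>q\<in>Y. r `` {p + q}),
     smult = (\<lambda>u X. \<Union>p\<in>X. r `` {pre_act m n u p})\<rparr>)"

text \<open>
  On \<open>h \<oplus> n\<^sup>+\<close> the functional \<open>weight_eval m n lam\<close> is \<open>lam\<close> on \<open>h\<close> and vanishes on \<open>n\<^sup>+\<close>.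
\<close>

definition verma :: "nat \<Rightarrow> nat \<Rightarrow> weight \<Rightarrow> (tens set, pre_tensor set) module"
  where "verma m n lam = induced m n (borel m n) (weight_eval m n lam)"

definition verma_hw :: "nat \<Rightarrow> nat \<Rightarrow> weight \<Rightarrow> pre_tensor set"
  where "verma_hw m n lam =
    ind_equiv m n (borel m n) (weight_eval m n lam) `` {pt \<one>\<^bsub>env m n\<^esub> 1}"

definition singular :: "nat \<Rightarrow> nat \<Rightarrow> (tens set, 'v) module \<Rightarrow> 'v \<Rightarrow> bool"
  where "singular m n M v \<longleftrightarrow> v \<in> carrier M \<and> v \<noteq> \<zero>\<^bsub>M\<^esub> \<and>
    (\<forall>x\<in>n_plus m n. env_mat m n x \<odot>\<^bsub>M\<^esub> v = \<zero>\<^bsub>M\<^esub>)"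

definition has_weight :: "nat \<Rightarrow> nat \<Rightarrow> (tens set, 'v) module \<Rightarrow> weight \<Rightarrow> 'v \<Rightarrow> bool"
  where "has_weight m n M mu v \<longleftrightarrow> v \<in> carrier M \<and>
    (\<forall>h\<in>cartan m n. env_mat m n h \<odot>\<^bsub>M\<^esub> v = env_const m n (weight_eval m n mu h) \<odot>\<^bsub>M\<^esub> v)"

definition Hom_g :: "nat \<Rightarrow> nat \<Rightarrow> (tens set, 'v) module \<Rightarrow> (tens set, 'w) module \<Rightarrow> ('v \<Rightarrow> 'w) set"
  where "Hom_g m n M N = {f \<in> carrier M \<rightarrow>\<^sub>E carrier N.
    (\<forall>x\<in>carrier M. \<forall>y\<in>carrier M. f (x \<oplus>\<^bsub>M\<^esub> y) = f x \<oplus>\<^bsub>N\<^esub> f y) \<and>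
    (\<forall>u\<in>carrier (env m n). \<forall>x\<in>carrier M. f (u \<odot>\<^bsub>M\<^esub> x) = u \<odot>\<^bsub>N\<^esub> f x)}"


section \<open>The element \<open>S\<close>\<close>

definition between :: "nat \<Rightarrow> nat \<Rightarrow> nat \<Rightarrow> nat \<Rightarrow> int set"
  where "between m n s t = {k \<in> idx m n. - int s < k \<and> k < int t}"

definition c_coeff :: "nat \<Rightarrow> nat \<Rightarrow> weight \<Rightarrow> int \<Rightarrow> complex"
  where "c_coeff s t lam k =
    (if k < 0 then lam (- int s) - lam k + of_nat s - 1 - of_int (- k)
     else lam (int t) - lam k - (of_nat t - of_int k))"

definition d_coeff :: "nat \<Rightarrow> nat \<Rightarrow> nat \<Rightarrow> nat \<Rightarrow> weight \<Rightarrow> int set \<Rightarrow> complex"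
  where "d_coeff m n s t lam J = (\<Prod>k\<in>between m n s t - J. c_coeff s t lam k)"

definition E_set :: "nat \<Rightarrow> nat \<Rightarrow> int set \<Rightarrow> tens"
  where "E_set s t J = (let js = sorted_list_of_set J in
    prod_list (rev (map2 E (js @ [int t]) (- int s # js))))"

definition S_elem :: "nat \<Rightarrow> nat \<Rightarrow> nat \<Rightarrow> nat \<Rightarrow> weight \<Rightarrow> tens set"
  where "S_elem m n s t lam = env_class m n
    (\<Sum>J\<in>Pow (between m n s t). tens_const (d_coeff m n s t lam J) * E_set s t J)"

end

theory Submission
  imports Defs "HOL-Library.Function_Algebras"
begin

text \<open>
  Write \<open>F\<^sub>b\<close> for the vector \<open>S v\<close> attached to the interval from \<open>s\<close>-bar to \<open>b\<close>. Sorting the subsets by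
  their largest element gives \<open>F\<^sub>b = \<Sum>\<^sub>j (\<Prod>\<^sub>j\<^sub><\<^sub>k\<^sub><\<^sub>b c\<^sub>k) E\<^sub>b\<^sub>j F\<^sub>j\<close>, and by induction on \<open>b\<close> a simple
  raising operator kills \<open>F\<^sub>b\<close>, except that the one ending at \<open>b\<close> sends it to
  \<open>\<plusminus> c\<^sub>b F\<close> at the predecessor of \<open>b\<close>; here \<open>c\<^sub>t = 0\<close> is exactly atypicality.

  For uniqueness, lower words span the module, and moving the letter with the smallest column to the
  right shows that the vectors \<open>E\<^sub>J v\<close> span the weight space. If \<open>\<Sum>\<^sub>J x\<^sub>J E\<^sub>J v\<close> is killed by the simple
  raising operators, then \<open>x\<^sub>J\<close> is determined by the coefficients of subsets with fewer gaps, or equally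
  many gaps and an earlier first gap, hence by the coefficient of the full subset.

  The linear independence needed here comes not from the PBW theorem but from an explicit module with
  a highest weight vector of arbitrary weight. Let \<open>E\<^sub>i\<^sub>j = \<Sum>\<^sub>k x\<^sub>i\<^sub>k \<partial>\<^sub>j\<^sub>k\<close>, where \<open>x\<^sub>i\<^sub>k\<close> has the parity of \<open>i\<close>
  plus that of \<open>k\<close>, act on a vacuum which is annihilated by \<open>x\<^sub>i\<^sub>k\<close> for \<open>i < k\<close> and by \<open>\<partial>\<^sub>i\<^sub>k\<close> for \<open>i > k\<close>,
  and which carries a complex power of the even variable \<open>x\<^sub>k\<^sub>k\<close>. On states without excitations \<open>x\<^sub>i\<^sub>k\<close>,
  \<open>i > k\<close>, lowering operators act like derivations of a polynomial ring, and words with strictly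
  decreasing rows have distinct leading monomials.
\<close>

text \<open>The module \<open>verma\<close> consists of classes of formal sums over cosets.
  Computations are therefore made for any vector space with operators \<open>e i j\<close> that
  satisfy the superbracket relations of the matrix units, and two such spaces are used: the Verma
  module itself, realised by normal forms in the free algebra, and the oscillator module. The
  universal property of the former sends its highest weight vector to the vacuum, so that evaluation
  at a monomial becomes a linear functional on the Verma module. For k > 0 the given c_k refer to
  b_t, hence to the endpoint, whereas the recursion compares vectors with different endpoints.
  Atypicality replaces b_t by t - s - a_s, and then one formula serves all endpoints; its value at t
  itself is -(a_s + b_t + s - t). The vector is nonzero whatever the c_k are, because the full
  subset carries the empty product 1. For the same reason a multiple of it cancels the full
  coefficient of any other singular vector of that weight, which reduces uniqueness to the case of
  full coefficient zero.\<close>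

section \<open>Words in the matrix units and chains of indices\<close>

text \<open>The sign in the superbracket of \<open>E i j\<close> and \<open>E k l\<close>: it is -1
  exactly when both are odd.\<close>

definition sg :: "int \<Rightarrow> int \<Rightarrow> int \<Rightarrow> int \<Rightarrow> complex"
  where "sg i j k l = (if (i < 0) \<noteq> (j < 0) \<and> (k < 0) \<noteq> (l < 0) then - 1 else 1)"

lemma sg_nonzero [simp]: "sg i j k l \<noteq> 0"
  by (simp add: sg_def)

lemma sg_diag [simp]: "sg i i k l = 1" "sg i j k k = 1"
  by (simp_all add: sg_def)

text \<open>A path of indices becomes a product of matrix units, one letter (target, source) per
  link. Operators compose from the right, so the first link is the last letter.\<close>

fun edges :: "int list \<Rightarrow> (int \<times> int) list"
  where
    "edges (x # y # l) = edges (y # l) @ [(y, x)]"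
  | "edges _ = []"

lemma edges_append: "edges (xs @ x # ys) = edges (x # ys) @ edges (xs @ [x])"
  by (induction xs rule: edges.induct) auto

text \<open>The weight of a word: each letter \<open>(k, l)\<close> contributes +1 at
  \<open>k\<close> and -1 at \<open>l\<close>.\<close>

definition cnt :: "int \<Rightarrow> (int \<times> int) list \<Rightarrow> int"
  where "cnt i w = (\<Sum>(k, l)\<leftarrow>w. of_bool (k = i) - of_bool (l = i))"

lemma cnt_simps [simp]:
  "cnt i [] = 0" "cnt i ((k, l) # w) = of_bool (k = i) - of_bool (l = i) + cnt i w"
  "cnt i (u @ w) = cnt i u + cnt i w"
  by (simp_all add: cnt_def)

lemma cnt_edges: "cnt i (edges (x # xs)) = of_bool (last (x # xs) = i) - of_bool (x = i)"
  by (induction xs arbitrary: x) auto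

text \<open>The predecessor in the index set, which skips 0. The simple raising operators are
  \<open>e (pred_idx q) q\<close>; for the least index the value falls outside the index
  set.\<close>

definition pred_idx :: "int \<Rightarrow> int"
  where "pred_idx b = (if b = 1 then - 1 else b - 1)"

lemma finite_idx [simp]: "finite (idx m n)"
  by (simp add: idx_def)

lemma pred_idx_less: "pred_idx b < b"
  by (simp add: pred_idx_def)

lemma pred_idx_mem:
  assumes "b \<in> idx m n" "j \<in> idx m n" "j < b"
  shows "pred_idx b \<in> idx m n" "j \<le> pred_idx b"
  using assms by (auto simp: pred_idx_def idx_def)

definition ivl :: "nat \<Rightarrow> nat \<Rightarrow> int \<Rightarrow> int \<Rightarrow> int set"
  where "ivl m n a b = {k \<in> idx m n. a < k \<and> k < b}"

lemma finite_ivl [simp]: "finite (ivl m n a b)"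
  by (simp add: ivl_def)

lemma ivl_pred: "b \<in> idx m n \<Longrightarrow> ivl m n (pred_idx b) b = {}"
  by (auto simp: ivl_def pred_idx_def idx_def)

lemma ivl_insert_pred:
  assumes "b \<in> idx m n" "j \<in> idx m n" "j < pred_idx b"
  shows "ivl m n j b = insert (pred_idx b) (ivl m n j (pred_idx b))"
  using assms by (auto simp: ivl_def pred_idx_def idx_def)

definition chain :: "int \<Rightarrow> int set \<Rightarrow> int \<Rightarrow> (int \<times> int) list"
  where "chain a J b = edges (a # sorted_list_of_set J @ [b])"

lemma sorted_list_of_set_insert_greater:
  fixes j :: int
  assumes "finite J" "\<And>k. k \<in> J \<Longrightarrow> k < j"
  shows "sorted_list_of_set (insert j J) = sorted_list_of_set J @ [j]"
proof (rule sorted_distinct_set_unique)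
  show "sorted (sorted_list_of_set J @ [j])"
    using assms by (auto simp: sorted_append less_imp_le)
  show "distinct (sorted_list_of_set J @ [j])" using assms by auto
qed (use assms in \<open>simp_all del: sorted_list_of_set_insert_remove\<close>)

lemma sorted_list_of_set_insert_less:
  fixes j :: int
  assumes "finite J" "\<And>k. k \<in> J \<Longrightarrow> j < k"
  shows "sorted_list_of_set (insert j J) = j # sorted_list_of_set J"
proof (rule sorted_distinct_set_unique)
  show "sorted (j # sorted_list_of_set J)"
    using assms by (auto simp: less_imp_le)
  show "distinct (j # sorted_list_of_set J)" using assms by auto
qed (use assms in \<open>simp_all del: sorted_list_of_set_insert_remove\<close>)

lemma chain_snoc:
  assumes "finite J" "\<And>k. k \<in> J \<Longrightarrow> k < j"
  shows "chain a (insert j J) b = (b, j) # chain a J j"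
proof -
  have "chain a (insert j J) b = edges ((a # sorted_list_of_set J) @ j # [b])"
    using assms by (simp add: chain_def sorted_list_of_set_insert_greater del: edges.simps sorted_list_of_set_insert_remove)
  then show ?thesis
    by (subst (asm) edges_append) (simp add: chain_def)
qed

lemma chain_empty [simp]: "chain a {} b = [(b, a)]"
  by (simp add: chain_def)

lemma chain_insert_less:
  assumes "finite J" "\<And>k. k \<in> J \<Longrightarrow> j < k"
  shows "chain a (insert j J) b = chain j J b @ [(j, a)]"
  using assms by (simp add: chain_def sorted_list_of_set_insert_less del: sorted_list_of_set_insert_remove)

lemma cnt_chain: "cnt i (chain a J b) = of_bool (b = i) - of_bool (a = i)"
  using cnt_edges[of i a "sorted_list_of_set J @ [b]"] by (simp add: chain_def)

definition lower_word :: "nat \<Rightarrow> nat \<Rightarrow> (int \<times> int) list \<Rightarrow> bool"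
  where "lower_word m n w \<longleftrightarrow> (\<forall>(i, j)\<in>set w. i \<in> idx m n \<and> j \<in> idx m n \<and> j < i)"

lemma lower_word_simps [simp]:
  "lower_word m n []"
  "lower_word m n ((i, j) # w) \<longleftrightarrow> i \<in> idx m n \<and> j \<in> idx m n \<and> j < i \<and> lower_word m n w"
  "lower_word m n (u @ w) \<longleftrightarrow> lower_word m n u \<and> lower_word m n w"
  by (auto simp: lower_word_def)

section \<open>Representations given by matrix units\<close>

text \<open>The vector space carries no grading: the super structure sits entirely in the sign
  \<open>sg\<close> of the relation.\<close>

locale gl_rep = vector_space scale
  for scale :: "complex \<Rightarrow> 'v :: ab_group_add \<Rightarrow> 'v" (infixr "*s" 75) +
  fixes m n :: nat and e :: "int \<Rightarrow> int \<Rightarrow> 'v \<Rightarrow> 'v"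
  assumes e_add: "e i j (f + g) = e i j f + e i j g"
    and e_scale: "e i j (c *s f) = c *s e i j f"
    and e_rel: "\<lbrakk>i \<in> idx m n; j \<in> idx m n; k \<in> idx m n; l \<in> idx m n\<rbrakk> \<Longrightarrow>
      e i j (e k l f) = sg i j k l *s e k l (e i j f) + (if j = k then e i l f else 0)
        - (if i = l then sg i j k l *s e k j f else 0)"
begin

abbreviation I :: "int set" where "I \<equiv> idx m n"

lemma linear_e: "Vector_Spaces.linear scale scale (e i j)"
  by (simp add: Vector_Spaces.linear_iff vector_space_axioms e_add e_scale)

sublocale e: Vector_Spaces.linear scale scale "e i j" for i j
  by (rule linear_e)

definition wact :: "(int \<times> int) list \<Rightarrow> 'v \<Rightarrow> 'v"
  where "wact w f = foldr (\<lambda>(i, j). e i j) w f"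

lemma wact_simps [simp]:
  "wact [] f = f" "wact ((i, j) # w) f = e i j (wact w f)" "wact (u @ w) f = wact u (wact w f)"
  by (simp_all add: wact_def)

lemma linear_wact: "Vector_Spaces.linear scale scale (wact w)"
proof (induction w)
  case Nil
  have "wact [] = (\<lambda>f. f)" by (simp add: fun_eq_iff)
  then show ?case by (simp add: Vector_Spaces.linear_iff vector_space_axioms)
next
  case (Cons a w)
  then show ?case
    by (cases a) (simp add: Vector_Spaces.linear_iff e_add e_scale)
qed

sublocale wact: Vector_Spaces.linear scale scale "wact w" for w
  by (rule linear_wact)

end

section \<open>The singular vector in a highest weight module\<close>

text \<open>
  The coefficients \<open>c\<^sub>k\<close>, written so as to depend only on the start \<open>a\<close> (the index \<open>s\<close>-bar) of the
  interval. For positive \<open>k\<close> this agrees with the given formula only for atypical weights.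
\<close>

definition cf :: "weight \<Rightarrow> int \<Rightarrow> int \<Rightarrow> complex"
  where "cf lam a k =
    (if k < 0 then lam a - lam k + of_int (k - a - 1) else - (lam a + lam k - of_int (a + k)))"

locale gl_hw = gl_rep scale m n e
  for scale :: "complex \<Rightarrow> 'v :: ab_group_add \<Rightarrow> 'v" (infixr "*s" 75) and m n e +
  fixes lam :: weight and v :: 'v
  assumes raise_v: "\<lbrakk>i \<in> idx m n; j \<in> idx m n; i < j\<rbrakk> \<Longrightarrow> e i j v = 0"
    and weight_v: "i \<in> idx m n \<Longrightarrow> e i i v = lam i *s v"
begin

lemma weight_wact:
  assumes "set w \<subseteq> I \<times> I" "i \<in> I"
  shows "e i i (wact w v) = (lam i + of_int (cnt i w)) *s wact w v"
  using assms(1)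
proof (induction w)
  case Nil
  then show ?case using assms by (simp add: weight_v)
next
  case (Cons a w)
  obtain k l where a: "a = (k, l)" by (cases a)
  then have kl: "k \<in> I" "l \<in> I" using Cons.prems by auto
  have "e i i (e k l (wact w v)) = e k l (e i i (wact w v)) + (if i = k then e i l (wact w v) else 0)
      - (if i = l then e k i (wact w v) else 0)"
    using e_rel[of i i k l "wact w v"] kl assms by simp
  also have "\<dots> = (lam i + of_int (cnt i (a # w))) *s e k l (wact w v)"
    using Cons by (simp add: a e.scale e.add scale_left_distrib scale_left_diff_distrib)
  finally show ?case by (simp add: a)
qed

text \<open>The convention that the vector at \<open>b = a\<close> is \<open>v\<close> lets the
  empty subset enter the recursion as the term \<open>j = a\<close>.\<close>

definition sing :: "int \<Rightarrow> int \<Rightarrow> 'v"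
  where "sing a b = (if b = a then v else
    (\<Sum>J\<in>Pow (ivl m n a b). (\<Prod>k\<in>ivl m n a b - J. cf lam a k) *s wact (chain a J b) v))"

lemma sing_rec:
  assumes "a \<in> I" "b \<in> I" "a < b"
  shows "sing a b = (\<Sum>j | j \<in> I \<and> a \<le> j \<and> j < b. (\<Prod>k\<in>ivl m n j b. cf lam a k) *s e b j (sing a j))"
proof -
  let ?c = "\<lambda>b J. \<Prod>k\<in>ivl m n a b - J. cf lam a k"
  let ?g = "\<lambda>J. ?c b J *s wact (chain a J b) v"
  let ?S = "Sigma (ivl m n a b) (\<lambda>j. Pow (ivl m n a j))"
  have A: "{j. j \<in> I \<and> a \<le> j \<and> j < b} = insert a (ivl m n a b)"
    using assms by (auto simp: ivl_def)
  have P: "Pow (ivl m n a b) = insert {} (Pow (ivl m n a b) - {{}})" by auto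
  have fin: "finite J" if "J \<subseteq> ivl m n a j" for J j
    using that finite_ivl finite_subset by blast
  have split: "?g (insert j J) = (\<Prod>k\<in>ivl m n j b. cf lam a k) *s e b j (?c j J *s wact (chain a J j) v)"
    if j: "j \<in> ivl m n a b" and J: "J \<subseteq> ivl m n a j" for j J
  proof -
    have "ivl m n a b - insert j J = ivl m n j b \<union> (ivl m n a j - J)"
      using j J by (auto simp: ivl_def)
    moreover have "ivl m n j b \<inter> (ivl m n a j - J) = {}" by (auto simp: ivl_def)
    moreover have "chain a (insert j J) b = (b, j) # chain a J j"
      by (rule chain_snoc) (use J fin in \<open>auto simp: ivl_def\<close>)
    ultimately show ?thesis by (simp add: prod.union_disjoint e.scale)
  qed
  have "sum ?g (Pow (ivl m n a b) - {{}}) = (\<Sum>(j, J)\<in>?S. ?g (insert j J))"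
  proof (rule sum.reindex_bij_witness[where i = "\<lambda>(j, J). insert j J" and j = "\<lambda>J. (Max J, J - {Max J})"])
    fix J assume J: "J \<in> Pow (ivl m n a b) - {{}}"
    then have f: "finite J" "J \<noteq> {}" using fin by auto
    then have M: "Max J \<in> J" "\<And>k. k \<in> J \<Longrightarrow> k \<le> Max J" by auto
    show "(case (Max J, J - {Max J}) of (j, J) \<Rightarrow> insert j J) = J" using M by auto
    show "(Max J, J - {Max J}) \<in> ?S" using J M by (force simp: ivl_def)
    show "(case (Max J, J - {Max J}) of (j, J) \<Rightarrow> ?g (insert j J)) = ?g J"
      using M by (simp add: insert_absorb)
  next
    fix p assume "p \<in> ?S"
    then obtain j J where p: "p = (j, J)" "j \<in> ivl m n a b" "J \<subseteq> ivl m n a j" by auto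
    have "Max (insert j J) = j"
      by (rule Max_eqI) (use p fin in \<open>auto simp: ivl_def\<close>)
    moreover have "j \<notin> J" using p by (auto simp: ivl_def)
    ultimately show "(Max (case p of (j, J) \<Rightarrow> insert j J),
        (case p of (j, J) \<Rightarrow> insert j J) - {Max (case p of (j, J) \<Rightarrow> insert j J)}) = p"
      using p by simp
    show "(case p of (j, J) \<Rightarrow> insert j J) \<in> Pow (ivl m n a b) - {{}}"
      using p by (auto simp: ivl_def)
  qed
  also have "\<dots> = (\<Sum>j\<in>ivl m n a b. \<Sum>J\<in>Pow (ivl m n a j). ?g (insert j J))"
    by (rule sum.Sigma[symmetric]) auto
  also have "\<dots> = (\<Sum>j\<in>ivl m n a b. (\<Prod>k\<in>ivl m n j b. cf lam a k) *s e b j (sing a j))"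
  proof (rule sum.cong)
    fix j assume j: "j \<in> ivl m n a b"
    then have "j \<noteq> a" by (auto simp: ivl_def)
    then have s: "sing a j = (\<Sum>J\<in>Pow (ivl m n a j). ?c j J *s wact (chain a J j) v)"
      by (simp add: sing_def)
    show "(\<Sum>J\<in>Pow (ivl m n a j). ?g (insert j J))
      = (\<Prod>k\<in>ivl m n j b. cf lam a k) *s e b j (sing a j)"
      unfolding s e.sum scale_sum_right by (rule sum.cong) (use split[OF j] in auto)
  qed simp
  finally have *: "sum ?g (Pow (ivl m n a b) - {{}})
    = (\<Sum>j\<in>ivl m n a b. (\<Prod>k\<in>ivl m n j b. cf lam a k) *s e b j (sing a j))" .
  have "sing a b = ?g {} + sum ?g (Pow (ivl m n a b) - {{}})"
    using assms unfolding sing_def by (subst P, subst sum.insert) auto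
  also have "?g {} = (\<Prod>k\<in>ivl m n a b. cf lam a k) *s e b a (sing a a)"
    by (simp add: sing_def)
  finally show ?thesis
    unfolding * A by (subst sum.insert) (auto simp: ivl_def)
qed

lemma set_edges: "set L \<subseteq> I \<Longrightarrow> set (edges L) \<subseteq> I \<times> I"
  by (induction L rule: edges.induct) auto

lemma set_chain: "a \<in> I \<Longrightarrow> b \<in> I \<Longrightarrow> J \<subseteq> I \<Longrightarrow> set (chain a J b) \<subseteq> I \<times> I"
  unfolding chain_def
  by (rule set_edges) (use finite_subset[of J I] in auto)

lemma weight_sing:
  assumes "a \<in> I" "b \<in> I" "i \<in> I"
  shows "e i i (sing a b) = (lam i + of_bool (b = i) - of_bool (a = i)) *s sing a b"
proof (cases "b = a")
  case True
  then show ?thesis using assms by (simp add: sing_def weight_v)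
next
  case False
  have w: "e i i (wact (chain a J b) v)
      = (lam i + of_bool (b = i) - of_bool (a = i)) *s wact (chain a J b) v"
    if "J \<subseteq> ivl m n a b" for J
  proof -
    have "J \<subseteq> I" using that by (auto simp: ivl_def)
    then show ?thesis
      using weight_wact[OF set_chain[OF assms(1,2)] assms(3)] by (simp add: cnt_chain)
  qed
  show ?thesis
    unfolding sing_def using False
    by (simp add: e.sum e.scale scale_sum_right w) (simp add: mult.commute)
qed

lemma sum_below_pred:
  assumes "a \<in> I" "b \<in> I" "a < b"
  shows "(\<Sum>j | j \<in> I \<and> a \<le> j \<and> j < b. h j)
    = h (pred_idx b) + (\<Sum>j | j \<in> I \<and> a \<le> j \<and> j < pred_idx b. (h j :: 'v))"
proof -
  have "{j. j \<in> I \<and> a \<le> j \<and> j < b} = insert (pred_idx b) {j. j \<in> I \<and> a \<le> j \<and> j < pred_idx b}"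
    using pred_idx_mem[of b m n] pred_idx_less[of b] assms by (force simp: order_le_less)
  moreover have "finite {j. j \<in> I \<and> a \<le> j \<and> j < pred_idx b}" by simp
  ultimately show ?thesis by (simp add: sum.insert)
qed

text \<open>This identity is where the constants c come from. With \<open>p\<close> the predecessor
  of \<open>b\<close>, \<open>[E p b, E b p]\<close> acts on the vector at \<open>p\<close> by
  \<open>lam p + of_bool (a \<noteq> p) - sg p b b p * lam b\<close>; adding c at \<open>p\<close>
  must give c at \<open>b\<close> up to sign. The sign is -1 only in the step from -1 to 1, which is
  why the formula changes shape there.\<close>

lemma cf_step:
  assumes "a \<in> I" "a < 0" "b \<in> I" "a < b"
  shows "lam (pred_idx b) + of_bool (a \<noteq> pred_idx b) - sg (pred_idx b) b b (pred_idx b) * lam b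
      + (if a = pred_idx b then 0 else cf lam a (pred_idx b))
    = sg (pred_idx b) b b (pred_idx b) * cf lam a b"
  using assms by (auto simp: cf_def sg_def pred_idx_def idx_def)

text \<open>Expand by the recursion and move \<open>e p q\<close> past each \<open>e b j\<close>. If
  \<open>q = b\<close>, the terms with \<open>j < p\<close> add up to c at \<open>p\<close> times
  the vector at \<open>p\<close>, and \<open>j = p\<close> leaves a Cartan part. If \<open>q\<close>
  is not \<open>b\<close>, the only two contributions are the induction hypothesis at
  \<open>j = q\<close> and the commutator at \<open>j = p\<close>; both are multiples of
  \<open>e b q (sing a p)\<close> and they cancel.\<close>

proposition raise_sing:
  assumes a: "a \<in> I" "a < 0" and "b \<in> I" "a \<le> b" and q: "q \<in> I" "pred_idx q \<in> I"
  shows "e (pred_idx q) q (sing a b) =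
    (if q = b \<and> a < b then (sg (pred_idx b) b b (pred_idx b) * cf lam a b) *s sing a (pred_idx b) else 0)"
  using assms(3,4)
proof (induction "nat (b - a)" arbitrary: b rule: less_induct)
  case less
  define p where "p = pred_idx q"
  have p: "p \<in> I" "p < q" using q by (auto simp: p_def pred_idx_less)
  show ?case
  proof (cases "b = a")
    case True
    then show ?thesis using raise_v p q by (simp add: sing_def p_def)
  next
    case False
    with less.prems have ab: "a < b" by simp
    define A where "A = {j. j \<in> I \<and> a \<le> j \<and> j < b}"
    define C where "C = (\<lambda>j. \<Prod>k\<in>ivl m n j b. cf lam a k)"
    have IH: "e p q (sing a j) =
        (if q = j \<and> a < j then (sg p j j p * cf lam a j) *s sing a p else 0)" if "j \<in> A" for j
      using less.hyps[of j] that unfolding A_def p_def by (auto simp: ab)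
    have "e p q (sing a b) = (\<Sum>j\<in>A. C j *s e p q (e b j (sing a j)))"
      using sing_rec[OF a(1) less.prems(1) ab] by (simp add: A_def C_def e.sum e.scale)
    also have "\<dots> = (\<Sum>j\<in>A. C j *s (sg p q b j *s e b j (e p q (sing a j)))
        + (if q = b then C j *s e p j (sing a j) else 0)
        - (if p = j then (C p * sg p q b p) *s e b q (sing a p) else 0))"
    proof (rule sum.cong)
      fix j assume "j \<in> A"
      then have "j \<in> I" by (simp add: A_def)
      with e_rel[OF p(1) q(1) less.prems(1), of j "sing a j"]
      show "C j *s e p q (e b j (sing a j)) = C j *s (sg p q b j *s e b j (e p q (sing a j)))
        + (if q = b then C j *s e p j (sing a j) else 0)
        - (if p = j then (C p * sg p q b p) *s e b q (sing a p) else 0)"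
        by (simp add: scale_right_distrib scale_right_diff_distrib)
    qed simp
    finally have main: "e p q (sing a b) = (\<Sum>j\<in>A. C j *s (sg p q b j *s e b j (e p q (sing a j))))
        + (if q = b then \<Sum>j\<in>A. C j *s e p j (sing a j) else 0)
        - (if p \<in> A then (C p * sg p q b p) *s e b q (sing a p) else 0)"
      by (simp add: sum.distrib sum_subtractf A_def)
    show ?thesis
    proof (cases "q = b")
      case True
      have pb: "p = pred_idx b" by (simp add: p_def True)
      have pA: "p \<in> A" "a \<le> p" using pred_idx_mem[of b m n a] a ab less.prems p True
        by (auto simp: A_def pb)
      have "e p q (sing a j) = 0" if "j \<in> A" for j
        using IH[OF that] that True by (auto simp: A_def)
      then have z: "(\<Sum>j\<in>A. C j *s (sg p q b j *s e b j (e p q (sing a j)))) = 0"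
        by simp
      have Cp: "C p = 1" using less.prems by (simp add: C_def pb ivl_pred)
      \<comment> \<open>For \<open>j < p\<close> the product \<open>C j\<close> has the factor c at
        \<open>p\<close>, since \<open>p\<close> lies between \<open>j\<close> and \<open>b\<close>;
        what is left is the recursion for \<open>sing a p\<close>.\<close>
      have rest: "(\<Sum>j | j \<in> I \<and> a \<le> j \<and> j < p. C j *s e p j (sing a j))
        = (if a = p then 0 else cf lam a p) *s sing a p"
      proof (cases "a = p")
        case False
        then have ap: "a < p" using pA by simp
        have "C j = cf lam a p * (\<Prod>k\<in>ivl m n j p. cf lam a k)" if "j \<in> I" "j < p" for j
          unfolding C_def using that less.prems ivl_insert_pred[of b m n j]
          by (subst ivl_insert_pred) (auto simp: pb ivl_def)
        then have "(\<Sum>j | j \<in> I \<and> a \<le> j \<and> j < p. C j *s e p j (sing a j))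
          = cf lam a p *s (\<Sum>j | j \<in> I \<and> a \<le> j \<and> j < p. (\<Prod>k\<in>ivl m n j p. cf lam a k) *s e p j (sing a j))"
          by (auto simp: scale_sum_right intro!: sum.cong)
        then show ?thesis using False sing_rec[OF a(1) p(1) ap] by simp
      next
        case True
        then have "{j. j \<in> I \<and> a \<le> j \<and> j < p} = {}" by auto
        then show ?thesis using True by (simp only: sum.empty) simp
      qed
      have "e p q (sing a b) = e p p (sing a p) + (if a = p then 0 else cf lam a p) *s sing a p
          - sg p b b p *s e b b (sing a p)"
        using z pA Cp rest sum_below_pred[OF a(1) less.prems(1) ab, of "\<lambda>j. C j *s e p j (sing a j)"]
        unfolding main by (simp add: True A_def pb)
      also have "\<dots> = (lam p + of_bool (a \<noteq> p) - sg p b b p * lam b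
          + (if a = p then 0 else cf lam a p)) *s sing a p"
      proof -
        have "b \<noteq> a" "b \<noteq> p" using ab p True by auto
        then show ?thesis
          using weight_sing[of a p p] weight_sing[of a p b] a p less.prems
          by (cases "a = p") (simp_all add: scale_left_distrib scale_left_diff_distrib)
      qed
      also have "\<dots> = (sg p b b p * cf lam a b) *s sing a p"
        by (rule arg_cong[where f = "\<lambda>c. c *s sing a p", OF cf_step[OF a less.prems(1) ab, folded pb]])
      finally show ?thesis using True ab by (simp add: pb)
    next
      case qb: False
      have "(\<Sum>j\<in>A. C j *s (sg p q b j *s e b j (e p q (sing a j))))
          = (\<Sum>j\<in>A. if j = q then (if a < q then (C q * sg p q b q * sg p q q p * cf lam a q) *s
              e b q (sing a p) else 0) else 0)"
        by (rule sum.cong) (auto simp: IH e.scale mult.assoc)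
      also have "\<dots> = (if q \<in> A \<and> a < q then (C q * sg p q b q * sg p q q p * cf lam a q) *s
              e b q (sing a p) else 0)"
        by (simp add: A_def)
      finally have eq: "e p q (sing a b) =
          (if q \<in> A \<and> a < q then (C q * sg p q b q * sg p q q p * cf lam a q) *s e b q (sing a p) else 0)
        - (if p \<in> A then (C p * sg p q b p) *s e b q (sing a p) else 0)"
        using main qb by simp
      \<comment> \<open>As \<open>p\<close> and \<open>q\<close> are neighbours and \<open>q\<close>
        differs from \<open>b\<close>, the two contributions are present or absent together.\<close>
      have iff: "p \<in> A \<longleftrightarrow> q \<in> A \<and> a < q"
      proof
        assume "p \<in> A"
        then show "q \<in> A \<and> a < q"
          using pred_idx_mem[of b m n p] less.prems p q qb
          by (auto simp: A_def p_def pred_idx_def idx_def split: if_splits)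
      next
        assume "q \<in> A \<and> a < q"
        then show "p \<in> A" using pred_idx_mem[of q m n a] a p q by (auto simp: A_def p_def)
      qed
      have "C p = C q * cf lam a q" if "q \<in> A"
      proof -
        have "ivl m n p b = insert q (ivl m n q b)" "q \<notin> ivl m n q b"
          using that q by (auto simp: ivl_def A_def p_def pred_idx_def idx_def split: if_splits)
        then have "C p = cf lam a q * C q" unfolding C_def by (simp only: prod.insert[OF finite_ivl] simp_thms)
        then show ?thesis by (simp only: mult.commute)
      qed
      moreover have "sg p q b q * sg p q q p = sg p q b p"
        by (cases "p < 0"; cases "q < 0"; cases "b < 0"; simp add: sg_def)
      then have "C q * sg p q b q * sg p q q p * cf lam a q = C q * cf lam a q * sg p q b p"
        by (simp only: mult.assoc) (simp only: mult.commute mult.left_commute)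
      ultimately have "e p q (sing a b) = 0"
        unfolding eq iff by simp
      then show ?thesis using qb by (simp add: p_def)
    qed
  qed
qed

text \<open>The simple root vectors generate the nilradical: \<open>e i j\<close> is the bracket of
  \<open>e i p\<close> and \<open>e p j\<close> with \<open>p\<close> the predecessor of
  \<open>j\<close>.\<close>

lemma raise_all:
  assumes "\<And>q. q \<in> I \<Longrightarrow> pred_idx q \<in> I \<Longrightarrow> e (pred_idx q) q f = 0" "i \<in> I" "j \<in> I" "i < j"
  shows "e i j f = 0"
  using assms(3,4)
proof (induction "nat (j - i)" arbitrary: j rule: less_induct)
  case less
  have p: "pred_idx j \<in> I" "i \<le> pred_idx j" using pred_idx_mem[of j m n i] less.prems assms by auto
  show ?case
  proof (cases "i = pred_idx j")
    case True
    then show ?thesis using assms(1)[OF less.prems(1)] p by simp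
  next
    case False
    then have "e i (pred_idx j) f = 0"
      using less.hyps[of "pred_idx j"] p pred_idx_less[of j] by auto
    then show ?thesis
      using e_rel[of i "pred_idx j" "pred_idx j" j f] assms less.prems p by simp
  qed
qed

end

section \<open>Weight spaces of highest weight modules\<close>

text \<open>Every column lies strictly below its row, so the largest row of the word is never a
  column and is counted only positively. Dually, the smallest column is counted only
  negatively.\<close>

lemma lower_word_extremes:
  assumes "lower_word m n w" "(i, j) \<in> set w"
  shows "\<exists>b \<ge> i. cnt b w > 0" "\<exists>a \<le> j. cnt a w < 0"
proof -
  let ?R = "fst ` set w" and ?C = "snd ` set w"
  have ne: "?R \<noteq> {}" "?C \<noteq> {}" using assms by auto
  have low: "l < k" if "(k, l) \<in> set w" for k l
    using assms that by (auto simp: lower_word_def)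
  have R: "cnt (Max ?R) w > 0"
  proof -
    have "l < Max ?R" if "(k, l) \<in> set w" for k l
      proof -
      have "k \<in> ?R" using that by force
      then have "k \<le> Max ?R" by simp
      then show ?thesis using low[OF that] by simp
    qed
    then have ne': "l \<noteq> Max ?R" if "(k, l) \<in> set w" for k l using that by blast
    then have c: "cnt (Max ?R) w = (\<Sum>p\<leftarrow>w. of_bool (fst p = Max ?R))"
      unfolding cnt_def by (intro arg_cong[of _ _ sum_list] map_cong) (auto dest: ne')
    have "Max ?R \<in> ?R" using ne by (intro Max_in) auto
    then obtain p where p: "p \<in> set w" "fst p = Max ?R" by auto
    have "(0::int) < of_bool (fst p = Max ?R)" using p by simp
    also have "\<dots> \<le> cnt (Max ?R) w"
      unfolding c by (rule member_le_sum_list) (use p in auto)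
    finally show ?thesis .
  qed
  have C: "cnt (Min ?C) w < 0"
  proof -
    have "Min ?C < k" if "(k, l) \<in> set w" for k l
      proof -
      have "l \<in> ?C" using that by force
      then have "Min ?C \<le> l" by simp
      then show ?thesis using low[OF that] by simp
    qed
    then have ne': "k \<noteq> Min ?C" if "(k, l) \<in> set w" for k l using that by blast
    then have c: "cnt (Min ?C) w = (\<Sum>p\<leftarrow>w. - of_bool (snd p = Min ?C))"
      unfolding cnt_def by (intro arg_cong[of _ _ sum_list] map_cong) (auto dest: ne')
    have c': "cnt (Min ?C) w = - (\<Sum>p\<leftarrow>w. of_bool (snd p = Min ?C))"
      unfolding c by (simp add: uminus_sum_list_map o_def)
    have "Min ?C \<in> ?C" using ne by (intro Min_in) auto
    then obtain p where p: "p \<in> set w" "snd p = Min ?C" by auto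
    have "(0::int) < of_bool (snd p = Min ?C)" using p by simp
    also have "\<dots> \<le> (\<Sum>p\<leftarrow>w. of_bool (snd p = Min ?C))"
      by (rule member_le_sum_list) (use p in auto)
    finally show ?thesis using c' by simp
  qed
  have "i \<in> ?R" "j \<in> ?C" using assms(2) by force+
  then have "i \<le> Max ?R" "Min ?C \<le> j" by simp_all
  with R C show "\<exists>b \<ge> i. cnt b w > 0" "\<exists>a \<le> j. cnt a w < 0" by blast+
qed

lemma set_lower_word: "lower_word m n w \<Longrightarrow> set w \<subseteq> idx m n \<times> idx m n"
  by (auto simp: lower_word_def)

context gl_rep
begin

text \<open>Moving \<open>(i, a)\<close> past \<open>(k, l)\<close> costs a sign and, if
  \<open>i = l\<close>, the single letter \<open>(k, a)\<close> in place of the two: a shorter word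
  of the same weight. The other commutator term would need \<open>a = k\<close>, which is
  excluded.\<close>

lemma move_right:
  assumes "lower_word m n ((i, a) # u)" "a \<notin> fst ` set u"
  shows "wact ((i, a) # u) f \<in> span (insert (wact (u @ [(i, a)]) f)
    {wact w f | w. lower_word m n w \<and> length w \<le> length u \<and> (\<forall>x. cnt x w = cnt x ((i, a) # u))})"
  using assms
proof (induction u arbitrary: i)
  case Nil
  then show ?case by (simp add: span_base)
next
  case (Cons p u)
  obtain k l where p: "p = (k, l)" by (cases p)
  let ?X = "wact u f"
  let ?B = "{wact w f | w. lower_word m n w \<and> length w \<le> length (p # u)
    \<and> (\<forall>x. cnt x w = cnt x ((i, a) # p # u))}"
  let ?T = "insert (wact ((p # u) @ [(i, a)]) f) ?B"
  have I: "i \<in> I" "a \<in> I" "k \<in> I" "l \<in> I" "a < i" "l < k" "lower_word m n u" "a \<noteq> k"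
    using Cons.prems by (auto simp: p)
  have "wact ((i, a) # u) f \<in> span (insert (wact (u @ [(i, a)]) f)
    {wact w f | w. lower_word m n w \<and> length w \<le> length u \<and> (\<forall>x. cnt x w = cnt x ((i, a) # u))})"
    (is "_ \<in> span ?S")
    by (rule Cons.IH) (use Cons.prems p in auto)
  then have "e k l (wact ((i, a) # u) f) \<in> e k l ` span ?S" by blast
  also have "\<dots> = span (e k l ` ?S)" by (rule e.span_image[symmetric])
  also have "\<dots> \<subseteq> span ?T"
  proof (rule span_mono, rule image_subsetI)
    fix g assume g: "g \<in> ?S"
    show "e k l g \<in> ?T"
    proof (cases "g = wact (u @ [(i, a)]) f")
      case True
      then show ?thesis by (simp add: p)
    next
      case False
      then obtain w where w: "g = wact w f" "lower_word m n w" "length w \<le> length u"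
        "\<And>x. cnt x w = cnt x ((i, a) # u)" using g by auto
      then have "e k l g = wact ((k, l) # w) f" by simp
      moreover have "lower_word m n ((k, l) # w)" "length ((k, l) # w) \<le> length (p # u)"
        "\<forall>x. cnt x ((k, l) # w) = cnt x ((i, a) # p # u)"
        using w I by (auto simp: p)
      ultimately show ?thesis by blast
    qed
  qed
  finally have 1: "e k l (wact ((i, a) # u) f) \<in> span ?T" .
  have 2: "(if i = l then sg i a k l *s e k a ?X else 0) \<in> span ?T"
  proof (cases "i = l")
    case True
    have "wact ((k, a) # u) f \<in> ?B"
      using I True by (intro CollectI exI[of _ "(k, a) # u"]) (auto simp: p)
    then have "sg i a k l *s wact ((k, a) # u) f \<in> span ?T"
      by (intro span_scale span_base insertI2)
    then show ?thesis using True by simp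
  qed (simp add: span_zero)
  have "wact ((i, a) # p # u) f = sg i a k l *s e k l (wact ((i, a) # u) f)
      - (if i = l then sg i a k l *s e k a ?X else 0)"
    using e_rel[of i a k l ?X] I by (simp add: p)
  also have "\<dots> \<in> span ?T" by (intro span_diff span_scale 1 2)
  finally show ?case .
qed

text \<open>The weight forces a letter \<open>(i, a)\<close> with the smallest column, and
  \<open>a\<close> is no row. Moved to the right end, this letter is the first link of a chain; the
  rest of the word goes from \<open>i\<close> to \<open>b\<close> and acts on
  \<open>e i a f\<close>, whence the induction over arbitrary start vectors \<open>f\<close>. The
  correction terms are shorter words.\<close>

lemma chain_spanning:
  assumes "lower_word m n w" "\<And>x. cnt x w = of_bool (x = b) - of_bool (x = a)" "a \<noteq> b"
  shows "wact w f \<in> span ((\<lambda>J. wact (chain a J b) f) ` Pow (ivl m n a b))"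
  using assms
proof (induction "length w" arbitrary: w a f rule: less_induct)
  case less
  let ?T = "\<lambda>a f. (\<lambda>J. wact (chain a J b) f) ` Pow (ivl m n a b)"
  have rows: "i \<le> b" and cols: "a \<le> j" if "(i, j) \<in> set w" for i j
  proof -
    have "\<exists>b' \<ge> i. cnt b' w > 0" "\<exists>a' \<le> j. cnt a' w < 0"
      using lower_word_extremes[OF less.prems(1) that] by auto
    then show "i \<le> b" "a \<le> j" unfolding less.prems(2) by (auto simp: of_bool_def split: if_splits)
  qed
  have low: "i \<in> I" "j \<in> I" "j < i" if "(i, j) \<in> set w" for i j
    using less.prems(1) that by (auto simp: lower_word_def)
  have "a \<in> snd ` set w"
  proof (rule ccontr)
    assume "a \<notin> snd ` set w"
    then have "cnt a w \<ge> 0" unfolding cnt_def by (intro sum_list_nonneg) force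
    then show False using less.prems by simp
  qed
  then obtain i where "(i, a) \<in> set w" by auto
  then obtain u u' where w: "w = u @ (i, a) # u'" by (meson split_list)
  have "(i, a) \<in> set w" by (simp add: w)
  then have ia: "i \<in> I" "a \<in> I" "a < i" "i \<le> b" using low rows by blast+
  have "a \<notin> fst ` set w" using low cols by force
  then have m: "wact ((i, a) # u') f \<in> span (insert (wact (u' @ [(i, a)]) f)
    {wact w f | w. lower_word m n w \<and> length w \<le> length u' \<and> (\<forall>x. cnt x w = cnt x ((i, a) # u'))})"
    (is "_ \<in> span ?S")
    by (intro move_right) (use less.prems w in auto)
  have "wact w f \<in> wact u ` span ?S" using m by (auto simp: w simp del: wact_simps(2))
  also have "\<dots> = span (wact u ` ?S)" by (rule wact.span_image[symmetric])
  also have "\<dots> \<subseteq> span (?T a f)"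
  proof (rule span_minimal)
    show "wact u ` ?S \<subseteq> span (?T a f)"
    proof (clarify)
      fix g assume g: "g \<in> ?S"
      show "wact u g \<in> span (?T a f)"
      proof (cases "g = wact (u' @ [(i, a)]) f")
        case True
        then have eq: "wact u g = wact (u @ u') (e i a f)" by simp
        have lw: "lower_word m n (u @ u')" using less.prems w by simp
        have ct: "cnt x (u @ u') = of_bool (x = b) - of_bool (x = i)" for x
          using less.prems(2)[of x] w by (cases "x = a") auto
        show ?thesis
        proof (cases "i = b")
          case True
          \<comment> \<open>The remaining word has weight zero, but a nonempty lower word has a
            positive count somewhere.\<close>
          have "u @ u' = []"
          proof (rule ccontr)
            assume "u @ u' \<noteq> []"
            then obtain k l where "(k, l) \<in> set (u @ u')" by (metis list.set_intros(1) neq_Nil_conv surj_pair)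
            then show False using lower_word_extremes(1)[OF lw] ct True by auto
          qed
          then have "wact u g = wact (chain a {} b) f" using eq True by simp
          moreover have "wact (chain a {} b) f \<in> ?T a f" by (rule imageI) simp
          ultimately show ?thesis by (simp only: span_base)
        next
          case False
          then have "wact u g \<in> span (?T i (e i a f))"
            unfolding eq by (intro less.hyps lw ct) (simp_all add: w)
          also have "\<dots> \<subseteq> span (?T a f)"
          proof (rule span_mono, clarify)
            fix J assume J: "J \<subseteq> ivl m n i b"
            have "chain a (insert i J) b = chain i J b @ [(i, a)]"
              by (rule chain_insert_less) (use J finite_subset[OF J] in \<open>auto simp: ivl_def\<close>)
            then have "wact (chain i J b) (e i a f) = wact (chain a (insert i J) b) f" by simp
            moreover have "insert i J \<subseteq> ivl m n a b"
              using J ia False by (auto simp: ivl_def)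
            ultimately show "wact (chain i J b) (e i a f) \<in> ?T a f" by auto
          qed
          finally show ?thesis .
        qed
      next
        case False
        then obtain w' where w': "g = wact w' f" "lower_word m n w'" "length w' \<le> length u'"
          "\<And>x. cnt x w' = cnt x ((i, a) # u')" using g by auto
        have "wact (u @ w') f \<in> span (?T a f)"
        proof (rule less.hyps)
          show "cnt x (u @ w') = of_bool (x = b) - of_bool (x = a)" for x
            using less.prems(2)[of x] w'(4)[of x] w by simp
        qed (use less.prems w w' in auto)
        then show ?thesis using w' by simp
      qed
    qed
  qed (rule subspace_span)
  finally show ?case .
qed

end

context gl_hw
begin

definition lower_span :: "'v set"
  where "lower_span = span {wact w v | w. lower_word m n w}"

lemma lower_e_lower_span:
  assumes "f \<in> lower_span" "i \<in> I" "j \<in> I" "j < i"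
  shows "e i j f \<in> lower_span"
proof -
  have "e i j f \<in> e i j ` lower_span" using assms by blast
  also have "\<dots> = span (e i j ` {wact w v | w. lower_word m n w})"
    unfolding lower_span_def by (rule e.span_image[symmetric])
  also have "\<dots> \<subseteq> lower_span"
    unfolding lower_span_def
  proof (rule span_mono, clarify)
    fix w assume "lower_word m n w"
    then show "\<exists>u. e i j (wact w v) = wact u v \<and> lower_word m n u"
      using assms by (intro exI[of _ "(i, j) # w"]) simp
  qed
  finally show ?thesis .
qed

text \<open>The spanning half of the triangular decomposition: moving \<open>e i j\<close> past the
  first letter leaves matrix units acting on the shorter word, and at \<open>v\<close> itself
  raising operators vanish and diagonal ones are scalars.\<close>

lemma e_wact_lower_span:
  assumes "lower_word m n w" "i \<in> I" "j \<in> I"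
  shows "e i j (wact w v) \<in> lower_span"
  using assms
proof (induction w arbitrary: i j)
  case Nil
  have "v \<in> lower_span"
    unfolding lower_span_def by (rule span_base) (auto intro!: exI[of _ "[]"])
  with Nil show ?case
    using lower_e_lower_span[of v i j] raise_v[of i j] weight_v[of i]
    by (cases i j rule: linorder_cases) (auto simp: lower_span_def span_zero span_scale)
next
  case (Cons p w)
  obtain k l where p: "p = (k, l)" by (cases p)
  have kl: "k \<in> I" "l \<in> I" "l < k" "lower_word m n w" using Cons.prems by (auto simp: p)
  have *: "e x y (wact w v) \<in> lower_span" if "x \<in> I" "y \<in> I" for x y
    by (rule Cons.IH) (use that kl in auto)
  have "e k l (e i j (wact w v)) \<in> lower_span"
    by (rule lower_e_lower_span) (use * Cons.prems kl in auto)
  then have 1: "sg i j k l *s e k l (e i j (wact w v)) \<in> lower_span"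
    unfolding lower_span_def by (rule span_scale)
  have 2: "(if j = k then e i l (wact w v) else 0) \<in> lower_span"
    using * kl Cons.prems by (simp add: lower_span_def span_zero)
  have 3: "(if i = l then sg i j k l *s e k j (wact w v) else 0) \<in> lower_span"
    using * kl Cons.prems by (simp add: lower_span_def span_zero span_scale)
  show ?case
    using span_diff[OF span_add[OF 1[unfolded lower_span_def] 2[unfolded lower_span_def]]
        3[unfolded lower_span_def]] e_rel[of i j k l "wact w v"] kl Cons.prems
    by (simp add: p lower_span_def)
qed

lemma wact_in_lower_span:
  assumes "set w \<subseteq> I \<times> I"
  shows "wact w v \<in> lower_span"
  using assms
proof (induction w)
  case Nil
  show ?case
    unfolding lower_span_def by (rule span_base) (auto intro!: exI[of _ "[]"])
next
  case (Cons p w)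
  obtain i j where p: "p = (i, j)" by (cases p)
  have "e i j (wact w v) \<in> e i j ` lower_span" using Cons by simp
  also have "\<dots> = span (e i j ` {wact w v | w. lower_word m n w})"
    unfolding lower_span_def by (rule e.span_image[symmetric])
  also have "\<dots> \<subseteq> lower_span"
  proof (rule span_minimal)
    show "e i j ` {wact w v |w. lower_word m n w} \<subseteq> lower_span"
      using e_wact_lower_span Cons.prems p by auto
  qed (simp add: lower_span_def)
  finally show ?case by (simp add: p)
qed

text \<open>The vectors \<open>wact w v\<close> may be linearly dependent, so coefficients cannot be
  compared. Instead, for a word \<open>w0\<close> whose weight is wrong at \<open>i\<close>, the
  operator \<open>(e i i - lam i - cnt i w0) / (mu i - cnt i w0)\<close> fixes \<open>f\<close> and
  removes \<open>w0\<close> from the sum, while all other words are merely rescaled.\<close>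

lemma weight_filter:
  assumes "finite S" "\<And>w. w \<in> S \<Longrightarrow> lower_word m n w" "f = (\<Sum>w\<in>S. x w *s wact w v)"
    and wt: "\<And>i. i \<in> I \<Longrightarrow> e i i f = (lam i + of_int (mu i)) *s f"
  shows "f \<in> span {wact w v | w. lower_word m n w \<and> (\<forall>i\<in>I. cnt i w = mu i)}"
  using assms(1-3)
proof (induction "card {w \<in> S. \<exists>i\<in>I. cnt i w \<noteq> mu i}" arbitrary: S x rule: less_induct)
  case less
  show ?case
  proof (cases "\<exists>w\<in>S. \<exists>i\<in>I. cnt i w \<noteq> mu i")
    case False
    show ?thesis
      unfolding less.prems(3)
    proof (rule span_sum, rule span_scale, rule span_base)
      fix w assume "w \<in> S"
      then have "lower_word m n w \<and> (\<forall>i\<in>I. cnt i w = mu i)"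
        using False less.prems(2) by blast
      then show "wact w v \<in> {wact w v | w. lower_word m n w \<and> (\<forall>i\<in>I. cnt i w = mu i)}"
        by blast
    qed
  next
    case True
    then obtain w0 i where w0: "w0 \<in> S" "i \<in> I" "cnt i w0 \<noteq> mu i" by auto
    let ?y = "\<lambda>w. of_int (cnt i w - cnt i w0) / of_int (mu i - cnt i w0) * x w :: complex"
    have d: "of_int (mu i - cnt i w0) \<noteq> (0 :: complex)" using w0(3) unfolding of_int_eq_0_iff by linarith
    have "(lam i + of_int (mu i)) *s f = (\<Sum>w\<in>S. x w *s ((lam i + of_int (cnt i w)) *s wact w v))"
    proof -
      have "e i i (wact w v) = (lam i + of_int (cnt i w)) *s wact w v" if "w \<in> S" for w
        by (rule weight_wact[OF set_lower_word[OF less.prems(2)[OF that]] w0(2)])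
      then show ?thesis
        using wt[OF w0(2)] unfolding less.prems(3) by (simp add: e.sum e.scale)
    qed
    moreover have "(lam i + of_int (cnt i w0)) *s f = (\<Sum>w\<in>S. x w *s ((lam i + of_int (cnt i w0)) *s wact w v))"
      unfolding less.prems(3) by (simp add: scale_sum_right mult.commute)
    ultimately have "((lam i + of_int (mu i)) - (lam i + of_int (cnt i w0))) *s f
      = (\<Sum>w\<in>S. x w *s ((lam i + of_int (cnt i w)) *s wact w v) - x w *s ((lam i + of_int (cnt i w0)) *s wact w v))"
      unfolding scale_left_diff_distrib by (simp add: sum_subtractf)
    also have "\<dots> = (\<Sum>w\<in>S. (of_int (cnt i w - cnt i w0) * x w) *s wact w v)"
    proof (rule sum.cong)
      fix w
      have "x w * (lam i + of_int (cnt i w)) - x w * (lam i + of_int (cnt i w0))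
          = of_int (cnt i w - cnt i w0) * x w"
        by (simp add: algebra_simps)
      then show "x w *s ((lam i + of_int (cnt i w)) *s wact w v) - x w *s ((lam i + of_int (cnt i w0)) *s wact w v)
          = (of_int (cnt i w - cnt i w0) * x w) *s wact w v"
        by (simp only: scale_scale scale_left_diff_distrib[symmetric])
    qed simp
    finally have h: "of_int (mu i - cnt i w0) *s f = (\<Sum>w\<in>S. (of_int (cnt i w - cnt i w0) * x w) *s wact w v)"
      by simp
    have "f = (1 / of_int (mu i - cnt i w0)) *s (of_int (mu i - cnt i w0) *s f)"
      using d unfolding scale_scale by simp
    also have "\<dots> = (\<Sum>w\<in>S. ?y w *s wact w v)"
      unfolding h scale_sum_right scale_scale by (rule sum.cong) simp_all
    also have "\<dots> = ?y w0 *s wact w0 v + (\<Sum>w\<in>S - {w0}. ?y w *s wact w v)"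
      by (rule sum.remove[OF less.prems(1) w0(1)])
    finally have f': "f = (\<Sum>w\<in>S - {w0}. ?y w *s wact w v)"
      by simp
    have c: "card {w \<in> S - {w0}. \<exists>i\<in>I. cnt i w \<noteq> mu i} < card {w \<in> S. \<exists>i\<in>I. cnt i w \<noteq> mu i}"
      by (rule psubset_card_mono) (use less.prems(1) w0 in auto)
    show ?thesis
      by (rule less.hyps[OF c finite_Diff[OF less.prems(1)] _ f']) (rule less.prems(2), blast)
  qed
qed

proposition weight_space_chains:
  assumes f: "f \<in> lower_span" and ab: "a \<in> I" "b \<in> I" "a < b"
    and wt: "\<And>i. i \<in> I \<Longrightarrow> e i i f = (lam i + of_bool (i = b) - of_bool (i = a)) *s f"
  shows "\<exists>x. f = (\<Sum>J\<in>Pow (ivl m n a b). x J *s wact (chain a J b) v)"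
proof -
  define mu where "mu = (\<lambda>i. of_bool (i = b) - of_bool (i = a) :: int)"
  obtain T r where T: "finite T" "T \<subseteq> {wact w v | w. lower_word m n w}" "f = (\<Sum>g\<in>T. r g *s g)"
    using f unfolding lower_span_def span_explicit mem_Collect_eq by (elim exE conjE) (rule that)
  \<comment> \<open>One word is chosen for each vector, so the sum over vectors becomes a sum over
    distinct words.\<close>
  have "\<forall>g\<in>T. \<exists>w. lower_word m n w \<and> g = wact w v" using T(2) by auto
  then obtain h where h: "\<And>g. g \<in> T \<Longrightarrow> lower_word m n (h g) \<and> g = wact (h g) v"
    by (metis bchoice)
  have inj: "inj_on h T" using h by (metis inj_onI)
  have "f = (\<Sum>w\<in>h ` T. r (wact w v) *s wact w v)"
    unfolding T(3) sum.reindex[OF inj] by (rule sum.cong) (use h in auto)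
  then have "f \<in> span {wact w v | w. lower_word m n w \<and> (\<forall>i\<in>I. cnt i w = mu i)}"
    by (intro weight_filter[of "h ` T"]) (use T h wt in \<open>auto simp: mu_def\<close>)
  also have "\<dots> \<subseteq> span ((\<lambda>J. wact (chain a J b) v) ` Pow (ivl m n a b))"
  proof (rule span_minimal, clarify)
    fix w assume w: "lower_word m n w" "\<forall>i\<in>I. cnt i w = mu i"
    have "cnt i w = mu i" for i
    proof (cases "i \<in> I")
      case False
      then have "cnt i w = (\<Sum>p\<leftarrow>w. 0)"
        using set_lower_word[OF w(1)] unfolding cnt_def
        by (intro arg_cong[of _ _ sum_list] map_cong) auto
      then show ?thesis using False ab by (auto simp: mu_def)
    qed (use w in auto)
    then show "wact w v \<in> span ((\<lambda>J. wact (chain a J b) v) ` Pow (ivl m n a b))"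
      using w ab by (intro chain_spanning) (auto simp: mu_def)
  qed simp
  finally have "f \<in> span ((\<lambda>J. wact (chain a J b) v) ` Pow (ivl m n a b))" .
  then show ?thesis
  proof (induction rule: span_induct_alt)
    case base
    show ?case by (intro exI[of _ "\<lambda>_. 0"]) simp
  next
    case (step c g y)
    then obtain J x where J: "J \<in> Pow (ivl m n a b)" "g = wact (chain a J b) v"
      and y: "y = (\<Sum>J\<in>Pow (ivl m n a b). x J *s wact (chain a J b) v)" by auto
    have "c *s g + y = (\<Sum>J'\<in>Pow (ivl m n a b). (if J' = J then c else 0) *s wact (chain a J' b) v)
        + (\<Sum>J'\<in>Pow (ivl m n a b). x J' *s wact (chain a J' b) v)"
      using J by (simp add: y if_distrib[of "\<lambda>c. c *s _"] cong: if_cong)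
    also have "\<dots> = (\<Sum>J'\<in>Pow (ivl m n a b). ((if J' = J then c else 0) + x J') *s wact (chain a J' b) v)"
      by (simp add: scale_left_distrib sum.distrib)
    finally show ?case by (intro exI[of _ "\<lambda>J'. (if J' = J then c else 0) + x J'"])
  qed
qed

end

section \<open>Uniqueness of the coefficients\<close>

text \<open>This class contains the chains and also the pairs of chains that arise when a link is
  removed, yet it is small enough for its members to be told apart by one monomial each.\<close>

definition decreasing_word :: "nat \<Rightarrow> nat \<Rightarrow> (int \<times> int) list \<Rightarrow> bool"
  where "decreasing_word m n w \<longleftrightarrow> lower_word m n w \<and> sorted_wrt (>) (map fst w)"

lemma set_edges_subset: "set (edges L) \<subseteq> set (tl L) \<times> set (butlast L)"
  by (induction L rule: edges.induct) auto

lemma decreasing_edges: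
  assumes "sorted_wrt (<) L" "set L \<subseteq> idx m n"
  shows "decreasing_word m n (edges L)"
  using assms
proof (induction L rule: edges.induct)
  case (1 x y l)
  have "y < z" if "z \<in> set l" for z using 1(2) that by simp
  then have "y < fst p" if "p \<in> set (edges (y # l))" for p
    using set_edges_subset[of "y # l"] that by auto
  then show ?case using 1
    by (auto simp: decreasing_word_def sorted_wrt_append)
qed (simp_all add: decreasing_word_def)

lemma fst_edges: "fst ` set (edges (x # l)) = set l"
  by (induction l arbitrary: x) auto

text \<open>The part of the path strictly before \<open>p\<close>. If \<open>p = a\<close>, the path
  starts at \<open>p\<close> and nothing precedes it.\<close>

definition chain_below :: "int \<Rightarrow> int set \<Rightarrow> int \<Rightarrow> int list"
  where "chain_below a J p = (if p = a then [] else a # sorted_list_of_set (J \<inter> {..<p}))"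

definition chain_above :: "int \<Rightarrow> int set \<Rightarrow> int \<Rightarrow> int list"
  where "chain_above b J q = sorted_list_of_set (J \<inter> {q<..}) @ [b]"

lemma chain_split:
  assumes "J \<subseteq> ivl m n a b" "q \<in> ivl m n a b" "a \<in> idx m n"
  defines "p \<equiv> pred_idx q"
  shows "a # sorted_list_of_set J @ [b] = chain_below a J p
    @ (if p = a \<or> p \<in> J then [p] else []) @ (if q \<in> J then [q] else []) @ chain_above b J q"
proof -
  have fin: "finite J" by (rule finite_subset[OF assms(1) finite_ivl])
  have q: "q \<in> idx m n" "a < q" "q < b" using assms(2) by (auto simp: ivl_def)
  have pq: "p < q" "a \<le> p" using pred_idx_less[of q] pred_idx_mem[OF q(1) assms(3) q(2)]
    by (simp_all add: p_def)
  have Ja: "a < k" "k < b" "k \<in> idx m n" if "k \<in> J" for k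
    using that assms(1) by (auto simp: ivl_def)
  have btw: "k \<le> p \<or> q \<le> k" if "k \<in> J" for k
    using Ja(3)[OF that] q(1) by (auto simp: idx_def p_def pred_idx_def)
  let ?l = "sorted_list_of_set (J \<inter> {..<p}) @ (if p \<in> J then [p] else [])
      @ (if q \<in> J then [q] else []) @ sorted_list_of_set (J \<inter> {q<..})"
  have "sorted_list_of_set J = ?l"
  proof (rule sorted_distinct_set_unique)
    show "sorted ?l" "distinct ?l" using fin pq by (auto simp: sorted_append)
    show "set (sorted_list_of_set J) = set ?l" using fin btw pq by (auto simp: order_le_less)
  qed simp_all
  moreover have "J \<inter> {..<p} = {}" "p \<notin> J" if "p = a"
    using that Ja by fastforce+
  ultimately show ?thesis by (auto simp: chain_below_def chain_above_def)
qed

lemma chain_inj: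
  assumes "finite J" "finite J'" "b \<notin> J" "b \<notin> J'" "chain a J b = chain a J' b"
  shows "J = J'"
proof -
  have "fst ` set (chain a J b) = insert b J" if "finite J" for J
    using that fst_edges[of a "sorted_list_of_set J @ [b]"] by (simp add: chain_def)
  then show ?thesis using assms by (metis insert_ident)
qed

context gl_hw
begin

text \<open>The rows of the word lie in \<open>tl L\<close> and its columns in
  \<open>butlast L\<close>. With \<open>q\<close> not a row and \<open>p\<close> not a column both
  commutator terms vanish at each letter, and only signs accumulate.\<close>

lemma raise_edges:
  assumes "set L \<subseteq> I" "p \<in> I" "q \<in> I" "q \<notin> set (tl L)" "p \<notin> set (butlast L)"
  shows "\<exists>c. c \<noteq> 0 \<and> (\<forall>f. e p q (wact (edges L) f) = c *s wact (edges L) (e p q f))"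
  using assms
proof (induction L rule: edges.induct)
  case (1 x y l)
  then obtain c where c: "c \<noteq> 0"
    "\<And>f. e p q (wact (edges (y # l)) f) = c *s wact (edges (y # l)) (e p q f)"
    by (auto split: if_splits dest: list.set_sel(2))
  have "e p q (e y x f) = sg p q y x *s e y x (e p q f)" for f
    using e_rel[of p q y x f] 1 by auto
  then have "e p q (wact (edges (x # y # l)) f) = (c * sg p q y x) *s wact (edges (x # y # l)) (e p q f)" for f
    using c by (simp add: wact.scale)
  then show ?case using c(1) by (intro exI[of _ "c * sg p q y x"]) simp
qed (auto intro!: exI[of _ 1])

lemma raise_edges_v:
  assumes "set L \<subseteq> I" "p \<in> I" "q \<in> I" "p < q" "q \<notin> set (tl L)" "p \<notin> set (butlast L)"
  shows "e p q (wact (edges L) v) = 0"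
proof -
  obtain c where "\<And>f. e p q (wact (edges L) f) = c *s wact (edges L) (e p q f)"
    using raise_edges[OF assms(1-3,5,6)] by blast
  then show ?thesis using assms by (simp add: raise_v)
qed

text \<open>
  A simple raising operator sends each chain through \<open>p\<close> or \<open>q\<close> to a multiple of one and the same chain
  with the link from \<open>p\<close> to \<open>q\<close> removed.
\<close>

lemma raise_split:
  fixes X Y :: "int list"
  assumes X: "set X \<subseteq> I" "\<And>x. x \<in> set X \<Longrightarrow> x < p" and Y: "set Y \<subseteq> I" "\<And>y. y \<in> set Y \<Longrightarrow> q < y"
    and pq: "p \<in> I" "q \<in> I" "p < q"
  defines "B \<equiv> wact (edges (q # Y) @ edges (X @ [p])) v"
  shows "\<exists>c. e p q (wact (edges (X @ p # q # Y)) v) = c *s B"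
    and "Y \<noteq> [] \<Longrightarrow> \<exists>c. c \<noteq> 0 \<and> e p q (wact (edges (X @ p # Y)) v) = c *s B"
    and "X \<noteq> [] \<Longrightarrow> \<exists>c. e p q (wact (edges (X @ q # Y)) v) = c *s B"
    and "e p q (wact (edges (X @ Y)) v) = 0"
proof -
  define h where "h = wact (edges (X @ [p])) v"
  have n: "p \<notin> set X" "q \<notin> set X" "p \<notin> set Y" "q \<notin> set Y"
    using X(2)[of p] X(2)[of q] Y(2)[of p] Y(2)[of q] pq by auto
  have tl: "set (tl L) \<subseteq> set L" for L :: "int list" by (cases L) auto
  have bl: "set (butlast L) \<subseteq> set L" for L :: "int list" by (auto dest: in_set_butlastD)
  have sub: "set (X @ [p]) \<subseteq> I" "set (q # Y) \<subseteq> I" "set (X @ Y) \<subseteq> I" using X Y pq by auto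
  have h0: "e p q h = 0"
    unfolding h_def
    by (rule raise_edges_v[OF sub(1) pq]) (use n pq tl[of "X @ [p]"] in auto)
  have hU: "set (edges (X @ [p])) \<subseteq> I \<times> I" by (rule set_edges[OF sub(1)])
  have "q \<notin> set (tl (q # Y))" "p \<notin> set (butlast (q # Y))" using n pq bl[of "q # Y"] by auto
  then obtain cW where cW: "\<And>f. e p q (wact (edges (q # Y)) f) = cW *s wact (edges (q # Y)) (e p q f)"
    using raise_edges[OF sub(2) pq(1,2)] by blast
  show "\<exists>c. e p q (wact (edges (X @ p # q # Y)) v) = c *s B"
  proof -
    \<comment> \<open>Here the link from \<open>p\<close> to \<open>q\<close> meets its own raising
      operator. What remains is a Cartan element, hence a scalar, which may be zero.\<close>
    have "e p q (e q p h) = e p p h - sg p q q p *s e q q h"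
      using e_rel[of p q q p h] pq h0 by simp
    also have "\<dots> = ((lam p + of_int (cnt p (edges (X @ [p]))))
        - sg p q q p * (lam q + of_int (cnt q (edges (X @ [p]))))) *s h"
      using weight_wact[OF hU pq(1)] weight_wact[OF hU pq(2)] unfolding h_def
      by (simp add: scale_left_diff_distrib)
    finally obtain d where d: "e p q (e q p h) = d *s h" by blast
    have "edges (X @ p # q # Y) = edges (q # Y) @ (q, p) # edges (X @ [p])"
      using edges_append[of X p "q # Y"] by simp
    then have "e p q (wact (edges (X @ p # q # Y)) v) = cW *s wact (edges (q # Y)) (d *s h)"
      by (simp add: cW d h_def[symmetric])
    then show ?thesis unfolding B_def wact_simps h_def[symmetric] wact.scale scale_scale by blast
  qed
  show "\<exists>c. c \<noteq> 0 \<and> e p q (wact (edges (X @ p # Y)) v) = c *s B" if Ynil: "Y \<noteq> []"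
  proof -
    obtain y Y' where Y': "Y = y # Y'" using Ynil by (cases Y) auto
    have "q \<notin> set (tl Y)" "p \<notin> set (butlast Y)" using n tl[of Y] bl[of Y] by auto
    then obtain c where c: "c \<noteq> 0" "\<And>f. e p q (wact (edges Y) f) = c *s wact (edges Y) (e p q f)"
      using raise_edges[OF Y(1) pq(1,2)] by blast
    have "q < y" "y \<in> I" using Y Y' by auto
    \<comment> \<open>The link leaving \<open>p\<close> is replaced by one leaving \<open>q\<close>,
      up to a sign. This case therefore has a nonzero constant.\<close>
    then have "e p q (e y p h) = (- sg p q y p) *s e y q h"
      using e_rel[of p q y p h] pq h0 by simp
    then have "e p q (wact (edges (X @ p # Y)) v) = (c * - sg p q y p) *s B"
      using c edges_append[of X p Y] by (simp add: Y' B_def h_def[symmetric] wact.scale wact.neg)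
    then show ?thesis using c(1) by (intro exI[of _ "c * - sg p q y p"]) simp
  qed
  show "\<exists>c. e p q (wact (edges (X @ q # Y)) v) = c *s B" if Xnil: "X \<noteq> []"
  proof -
    obtain X' x where X': "X = X' @ [x]" using Xnil by (cases X rule: rev_cases) auto
    have x: "x < p" "x \<in> I" using X X' by auto
    have "e p q (wact (edges X) v) = 0"
      by (rule raise_edges_v[OF X(1) pq]) (use n tl[of X] bl[of X] in auto)
    \<comment> \<open>The link entering \<open>q\<close> is redirected to \<open>p\<close>; the
      other term vanishes because \<open>e p q\<close> annihilates the initial piece.\<close>
    then have "e p q (e q x (wact (edges X) v)) = e p x (wact (edges X) v)"
      using e_rel[of p q q x "wact (edges X) v"] pq x by simp
    moreover have "edges (X @ q # Y) = edges (q # Y) @ (q, x) # edges X"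
      using edges_append[of X q Y] edges_append[of X' x "[q]"] by (simp add: X')
    moreover have "h = e p x (wact (edges X) v)"
      using edges_append[of X' x "[p]"] by (simp add: X' h_def)
    ultimately show ?thesis
      unfolding B_def by (intro exI[of _ cW]) (simp add: cW h_def[symmetric])
  qed
  show "e p q (wact (edges (X @ Y)) v) = 0"
    by (rule raise_edges_v[OF sub(3) pq]) (use n tl[of "X @ Y"] bl[of "X @ Y"] in auto)
qed

text \<open>Both parts can be read off the rows of the word: those above \<open>q\<close> are
  \<open>b\<close> and the elements of \<open>J\<close> beyond \<open>q\<close>, and, unless
  \<open>p = a\<close>, those up to \<open>p\<close> are \<open>p\<close> and the elements of
  \<open>J\<close> before it.\<close>

lemma edges_eq_parts:
  assumes J: "J \<subseteq> ivl m n a b" "J' \<subseteq> ivl m n a b" and q: "q \<in> ivl m n a b" and p: "p < q" "a \<le> p"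
    and eq: "edges (q # chain_above b J q) @ edges (chain_below a J p @ [p])
      = edges (q # chain_above b J' q) @ edges (chain_below a J' p @ [p])"
  shows "J \<inter> {..<p} = J' \<inter> {..<p}" "J \<inter> {q<..} = J' \<inter> {q<..}"
proof -
  define R where "R = (\<lambda>J. fst ` set (edges (q # chain_above b J q) @ edges (chain_below a J p @ [p])))"
  have R: "R J = insert b (J \<inter> {q<..}) \<union> (if p = a then {} else insert p (J \<inter> {..<p}))"
    if "J \<subseteq> ivl m n a b" for J
  proof -
    have "finite J" using that finite_ivl finite_subset by blast
    then show ?thesis
      using fst_edges[of a "sorted_list_of_set (J \<inter> {..<p}) @ [p]"]
      by (auto simp: R_def image_Un fst_edges chain_above_def chain_below_def)
  qed
  have "R J = R J'" unfolding R_def eq ..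
  then have eq': "insert b (J \<inter> {q<..}) \<union> (if p = a then {} else insert p (J \<inter> {..<p}))
    = insert b (J' \<inter> {q<..}) \<union> (if p = a then {} else insert p (J' \<inter> {..<p}))"
    using R J by metis
  have "q < b" "b \<notin> J" "b \<notin> J'" and a: "\<And>k. k \<in> J \<or> k \<in> J' \<Longrightarrow> a < k"
    using q J by (auto simp: ivl_def)
  then have "k \<in> J \<longleftrightarrow> k \<in> J'" if "q < k" for k
    using eq' that p by (cases "k = b") (auto simp: set_eq_iff split: if_splits dest!: spec[of _ k])
  then show "J \<inter> {q<..} = J' \<inter> {q<..}" by auto
  have "k \<in> J \<longleftrightarrow> k \<in> J'" if "k < p" for k
  proof (cases "p = a")
    case True
    then show ?thesis using that a by fastforce
  next
    case False
    then show ?thesis using eq' that p \<open>q < b\<close> by (auto simp: set_eq_iff dest!: spec[of _ k])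
  qed
  then show "J \<inter> {..<p} = J' \<inter> {..<p}" by auto
qed

text \<open>The functional \<open>phi w\<close> singles out the decreasing word \<open>w\<close>.
  For the least gap \<open>q\<close> of \<open>J\<close>, with predecessor \<open>p\<close>, apply
  \<open>e p q\<close> to \<open>f\<close> and read off the word of \<open>J\<close> cut between
  \<open>p\<close> and \<open>q\<close>. It can come only from \<open>J\<close>, with nonzero
  constant, from \<open>J\<close> with \<open>q\<close> added, which has fewer gaps, and from
  \<open>J\<close> with \<open>p\<close> exchanged for \<open>q\<close>, whose first gap is at most
  \<open>p\<close>. This dictates the two measures of the induction.\<close>

proposition chain_coeffs_vanish:
  fixes phi :: "(int \<times> int) list \<Rightarrow> 'v \<Rightarrow> complex"
  assumes phi_add: "\<And>w f g. phi w (f + g) = phi w f + phi w g"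
    and phi_scale: "\<And>w c f. phi w (c *s f) = c * phi w f"
    and phi: "\<And>w w'. decreasing_word m n w \<Longrightarrow> decreasing_word m n w' \<Longrightarrow>
      phi w (wact w' v) \<noteq> 0 \<longleftrightarrow> w = w'"
    and ab: "a \<in> I" "b \<in> I" "a < b"
    and f: "f = (\<Sum>J\<in>Pow (ivl m n a b). x J *s wact (chain a J b) v)"
    and f0: "\<And>q. q \<in> ivl m n a b \<Longrightarrow> e (pred_idx q) q f = 0"
    and full: "x (ivl m n a b) = 0" and J: "J \<subseteq> ivl m n a b"
  shows "x J = 0"
  using J
proof (induction J rule: wf_induct[OF wf_measures[of
      "[\<lambda>J. card (ivl m n a b - J), \<lambda>J. nat (Min (ivl m n a b - J) - a)]"]])
  case (1 J)
  let ?V = "ivl m n a b"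
  note J = 1(2)
  have IH: "x J' = 0" if "J' \<subseteq> ?V" "card (?V - J') < card (?V - J) \<or> card (?V - J') = card (?V - J)
      \<and> nat (Min (?V - J') - a) < nat (Min (?V - J) - a)" for J'
    using 1(1) that by auto
  have phi_sum: "phi w (sum g A) = (\<Sum>i\<in>A. phi w (g i))" for w A and g :: "int set \<Rightarrow> 'v"
  proof -
    have "phi w 0 = 0" using phi_scale[of w 0 0] by simp
    then show ?thesis by (induction A rule: infinite_finite_induct) (simp_all add: phi_add)
  qed
  show ?case
  proof (cases "J = ?V")
    case True
    then show ?thesis using full by simp
  next
    case False
    with J have ne: "?V - J \<noteq> {}" by auto
    define q where "q = Min (?V - J)"
    define p where "p = pred_idx q"
    have q: "q \<in> ?V" "q \<notin> J" using Min_in[of "?V - J"] ne by (auto simp: q_def)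
    have q_min: "k \<in> J" if "k \<in> ?V" "k < q" for k
    proof (rule ccontr)
      assume "k \<notin> J"
      then have "Min (?V - J) \<le> k" using that by (intro Min_le) auto
      then show False using that by (simp add: q_def)
    qed
    have p: "p < q" "a \<le> p" "p \<in> I" "q \<in> I" using q pred_idx_less[of q] pred_idx_mem[of q m n a] ab
      by (auto simp: p_def ivl_def)
    have pJ: "p = a \<or> p \<in> J" using q_min[of p] p q by (cases "p = a") (auto simp: ivl_def)
    let ?X = "\<lambda>J. chain_below a J p" and ?Y = "\<lambda>J. chain_above b J q"
    let ?B = "\<lambda>J. edges (q # ?Y J) @ edges (?X J @ [p])"
    have X: "set (?X J') \<subseteq> I" "\<And>k. k \<in> set (?X J') \<Longrightarrow> k < p"
      and Y: "set (?Y J') \<subseteq> I" "\<And>k. k \<in> set (?Y J') \<Longrightarrow> q < k"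
      and sX: "sorted_wrt (<) (?X J' @ [p])" and sY: "sorted_wrt (<) (q # ?Y J')"
      if "J' \<subseteq> ?V" for J'
    proof -
      have "finite J'" using that finite_ivl finite_subset by blast
      then show "set (?X J') \<subseteq> I" "\<And>k. k \<in> set (?X J') \<Longrightarrow> k < p" "set (?Y J') \<subseteq> I"
        "\<And>k. k \<in> set (?Y J') \<Longrightarrow> q < k"
        "sorted_wrt (<) (?X J' @ [p])" "sorted_wrt (<) (q # ?Y J')"
        using that ab p q strict_sorted_list_of_set
        by (auto simp: chain_below_def chain_above_def ivl_def sorted_wrt_append split: if_splits)
    qed
    have dec: "decreasing_word m n (?B J')" if "J' \<subseteq> ?V" for J'
    proof -
      have "decreasing_word m n (edges (q # ?Y J'))" "decreasing_word m n (edges (?X J' @ [p]))"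
        using X[OF that] Y[OF that] sX[OF that] sY[OF that] p by (auto intro!: decreasing_edges)
      moreover have "k > l" if "k \<in> fst ` set (edges (q # ?Y J'))" "l \<in> fst ` set (edges (?X J' @ [p]))" for k l
      proof -
        have "k > q" using that(1) Y[OF \<open>J' \<subseteq> ?V\<close>] by (simp add: fst_edges)
        moreover have "l \<in> set (?X J' @ [p])"
          using that(2) set_edges_subset[of "?X J' @ [p]"] by (cases "?X J'") auto
        then have "l \<le> p" using X(2)[OF \<open>J' \<subseteq> ?V\<close>] by (auto intro: less_imp_le)
        ultimately show ?thesis using p by simp
      qed
      ultimately show ?thesis
        by (force simp: decreasing_word_def sorted_wrt_append)
    qed
    have zero: "x J' * phi (?B J) (e p q (wact (chain a J' b) v)) = 0"
      if J': "J' \<in> Pow ?V - {J}" for J'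
    proof (rule ccontr)
      assume "x J' * phi (?B J) (e p q (wact (chain a J' b) v)) \<noteq> 0"
      then have nz: "x J' \<noteq> 0" "phi (?B J) (e p q (wact (chain a J' b) v)) \<noteq> 0" by auto
      have JV: "J' \<subseteq> ?V" using J' by auto
      note rs = raise_split[OF X[OF JV] Y[OF JV] p(3,4,1)]
      have ch: "chain a J' b = edges (?X J' @ (if p = a \<or> p \<in> J' then [p] else [])
          @ (if q \<in> J' then [q] else []) @ ?Y J')"
        using chain_split[OF JV q(1) ab(1)] by (simp add: chain_def p_def)
      have "?X J' \<noteq> []" if "p \<noteq> a" using that by (simp add: chain_below_def)
      then have PQ: "p = a \<or> p \<in> J' \<or> q \<in> J'" and
        "\<exists>c. e p q (wact (chain a J' b) v) = c *s wact (?B J') v"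
        using nz(2) rs ch phi_scale[of "?B J" 0 0]
        by (auto simp: chain_above_def split: if_splits)
      then have "phi (?B J) (wact (?B J') v) \<noteq> 0" using nz(2) phi_scale by auto
      then have "?B J = ?B J'" using phi dec J JV by blast
      then have parts: "J \<inter> {..<p} = J' \<inter> {..<p}" "J \<inter> {q<..} = J' \<inter> {q<..}"
        using edges_eq_parts[OF J JV q(1) p(1,2)] by auto
      have btw: "k < p \<or> k = p \<or> k = q \<or> q < k" if "k \<in> ?V" for k
        using that q by (auto simp: ivl_def idx_def p_def pred_idx_def)
      have same: "k \<in> J \<longleftrightarrow> k \<in> J'" if "k \<noteq> p" "k \<noteq> q" for k
        using btw[of k] parts that J JV by blast
      have aJ: "a \<notin> J" "a \<notin> J'" using J JV by (auto simp: ivl_def)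
      show False
      proof (cases "q \<in> J'")
        case True
        show False
        proof (cases "p = a \<or> p \<in> J'")
          case True
          have "k \<in> J' \<longleftrightarrow> k \<in> insert q J" for k
            using \<open>q \<in> J'\<close> \<open>p = a \<or> p \<in> J'\<close> same[of k] pJ aJ by (cases "k = p"; cases "k = q") auto
          then have "J' = insert q J" by blast
          then have "?V - J' \<subset> ?V - J" using q by auto
          then have "card (?V - J') < card (?V - J)" by (intro psubset_card_mono) auto
          then show False using IH[OF JV] nz(1) by simp
        next
          case False
          then have pV: "p \<in> J" "p \<in> ?V" using pJ J by auto
          have "k \<in> J' \<longleftrightarrow> k \<noteq> p \<and> (k = q \<or> k \<in> J)" for k
            using \<open>q \<in> J'\<close> False same[of k] by (cases "k = p"; cases "k = q") auto
          then have "?V - J' = insert p (?V - J - {q})" using pV p q by auto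
          moreover have "p \<notin> ?V - J - {q}" using pV by simp
          ultimately have "card (?V - J') = Suc (card (?V - J - {q}))" by simp
          also have "\<dots> = card (?V - J)" using q by (intro card.remove[symmetric]) auto
          finally have c: "card (?V - J') = card (?V - J)" .
          have "Min (?V - J') \<le> p" using False pV by (intro Min_le) auto
          then have "nat (Min (?V - J') - a) < nat (q - a)" using p by simp
          then show False using IH[OF JV] nz(1) c by (simp add: q_def)
        qed
      next
        case False
        have "k \<in> J' \<longleftrightarrow> k \<in> J" for k
          using PQ False pJ same[of k] q aJ by (cases "k = p"; cases "k = q") auto
        then have "J' = J" by blast
        then show False using J' by simp
      qed
    qed
    have "0 = phi (?B J) (e p q f)"
      using f0[OF q(1)] phi_scale[of _ 0 0] by (simp add: p_def)
    also have "\<dots> = (\<Sum>J'\<in>Pow ?V. x J' * phi (?B J) (e p q (wact (chain a J' b) v)))"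
      unfolding f by (simp add: e.sum e.scale phi_sum phi_scale)
    also have "\<dots> = x J * phi (?B J) (e p q (wact (chain a J b) v))
      + (\<Sum>J'\<in>Pow ?V - {J}. x J' * phi (?B J) (e p q (wact (chain a J' b) v)))"
      by (rule sum.remove) (use J in auto)
    also have "(\<Sum>J'\<in>Pow ?V - {J}. x J' * phi (?B J) (e p q (wact (chain a J' b) v))) = 0"
      by (rule sum.neutral) (use zero in blast)
    finally have "x J * phi (?B J) (e p q (wact (chain a J b) v)) = 0" by simp
    moreover have "phi (?B J) (e p q (wact (chain a J b) v)) \<noteq> 0"
    proof -
      have "chain a J b = edges (?X J @ p # ?Y J)"
        using chain_split[OF J q(1) ab(1)] pJ q by (simp add: chain_def p_def[symmetric])
      then obtain c where "c \<noteq> 0" "e p q (wact (chain a J b) v) = c *s wact (?B J) v"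
        using raise_split(2)[OF X[OF J] Y[OF J] p(3,4,1)] by (auto simp: chain_above_def)
      moreover have "phi (?B J) (wact (?B J) v) \<noteq> 0" using phi dec[OF J] by blast
      ultimately show ?thesis by (simp add: phi_scale)
    qed
    ultimately show ?thesis by simp
  qed
qed

end

section \<open>An oscillator representation of arbitrary highest weight\<close>

definition fscale :: "complex \<Rightarrow> ('a \<Rightarrow> complex) \<Rightarrow> 'a \<Rightarrow> complex"
  where "fscale c f = (\<lambda>x. c * f x)"

lemma fscale_apply [simp]: "fscale c f x = c * f x"
  by (simp add: fscale_def)

interpretation fs: vector_space fscale
  by standard (simp_all add: fun_eq_iff algebra_simps)

lemma sum_fun_apply: "(\<Sum>i\<in>A. f i) x = (\<Sum>i\<in>A. f i x :: complex)"
  by (induction A rule: infinite_finite_induct) simp_all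

text \<open>
  A vector is an arbitrary function on occupation numbers in \<open>\<int>\<close>; no support condition is imposed. The
  weights \<open>up\<close> and \<open>dn\<close> below satisfy \<open>up 0 = 0\<close> and \<open>dn (- 1) = 0\<close>, so that the vacuum is annihilated and
  nonnegative occupations do not interact with negative ones. The sign of an odd variable is the
  Jordan-Wigner sign of the odd variables before it.
\<close>

type_synonym occ = "int \<times> int \<Rightarrow> int"

definition ferm :: "int \<times> int \<Rightarrow> bool"
  where "ferm p \<longleftrightarrow> (fst p < 0) \<noteq> (snd p < 0)"

definition ssign :: "int \<times> int \<Rightarrow> int \<times> int \<Rightarrow> complex"
  where "ssign p q = (if ferm p \<and> ferm q then - 1 else 1)"

lemma ssign_sq [simp]: "ssign p q * ssign p q = 1" "ssign p q * (ssign p q * z) = z"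
  by (simp_all add: ssign_def)

definition before :: "int \<times> int \<Rightarrow> int \<times> int \<Rightarrow> bool"
  where "before q p \<longleftrightarrow> fst q < fst p \<or> fst q = fst p \<and> snd q < snd p"

definition jw_sign :: "nat \<Rightarrow> nat \<Rightarrow> int \<times> int \<Rightarrow> occ \<Rightarrow> complex"
  where "jw_sign m n p x = (if ferm p then
    \<Prod>q\<in>{q \<in> idx m n \<times> idx m n. ferm q \<and> before q p}. if even (x q) then 1 else - 1 else 1)"

text \<open>The value at \<open>x\<close> is read at the shifted occupation, so a state concentrated
  at \<open>y\<close> moves to \<open>y - d\<close> in the coordinate \<open>p\<close>: the shift
  \<open>d = - 1\<close> creates and \<open>d = 1\<close> annihilates.\<close>

definition shift_op :: "nat \<Rightarrow> nat \<Rightarrow> int \<times> int \<Rightarrow> int \<Rightarrow> (int \<Rightarrow> complex) \<Rightarrow> (occ \<Rightarrow> complex) \<Rightarrow> occ \<Rightarrow> complex"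
  where "shift_op m n p d g f = (\<lambda>x. jw_sign m n p x * g (x p) * f (x(p := x p + d)))"

lemma jw_sign_sq: "jw_sign m n p x * jw_sign m n p x = 1"
proof -
  have "(\<Prod>q\<in>A. if even (x q) then 1 else - 1) * (\<Prod>q\<in>A. if even (x q) then 1 else - 1) = (1 :: complex)" for A
    by (subst prod.distrib[symmetric]) (simp add: prod.neutral)
  then show ?thesis by (simp add: jw_sign_def)
qed

lemma jw_sign_nonzero: "jw_sign m n p x \<noteq> 0"
  using jw_sign_sq[of m n p x] by auto

lemma jw_sign_upd:
  assumes "q \<in> idx m n \<times> idx m n" "odd d"
  shows "jw_sign m n p (x(q := x q + d))
    = (if ferm p \<and> ferm q \<and> before q p then - 1 else 1) * jw_sign m n p x"
proof -
  let ?A = "{q \<in> idx m n \<times> idx m n. ferm q \<and> before q p}"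
  let ?g = "\<lambda>x q. if even (x q) then 1 else - 1 :: complex"
  have fin: "finite ?A" by (rule finite_subset[of _ "idx m n \<times> idx m n"]) auto
  show ?thesis
  proof (cases "q \<in> ?A")
    case True
    have "prod (?g (x(q := x q + d))) (?A - {q}) = prod (?g x) (?A - {q})"
      by (rule prod.cong) auto
    moreover have "?g (x(q := x q + d)) q = - ?g x q" using assms by simp
    ultimately have "prod (?g (x(q := x q + d))) ?A = - prod (?g x) ?A"
      using prod.remove[OF fin True, of "?g (x(q := x q + d))"] prod.remove[OF fin True, of "?g x"]
      by simp
    then show ?thesis using True by (simp add: jw_sign_def)
  next
    case False
    have "prod (?g (x(q := x q + d))) ?A = prod (?g x) ?A"
      by (rule prod.cong) (use False in auto)
    then show ?thesis using False assms by (auto simp: jw_sign_def)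
  qed
qed

lemma shift_op_add: "shift_op m n p d g (f + h) = shift_op m n p d g f + shift_op m n p d g h"
  by (simp add: shift_op_def fun_eq_iff algebra_simps)

lemma shift_op_scale: "shift_op m n p d g (fscale c f) = fscale c (shift_op m n p d g f)"
  by (simp add: shift_op_def fun_eq_iff)

text \<open>Of two distinct positions exactly one comes before the other, so for two odd variables
  exactly one of the two Jordan-Wigner signs flips when the order of the operators is
  reversed.\<close>

lemma shift_op_swap:
  assumes "p \<noteq> q" "p \<in> idx m n \<times> idx m n" "q \<in> idx m n \<times> idx m n" "odd d" "odd e"
  shows "shift_op m n p d g (shift_op m n q e h f)
    = fscale (ssign p q) (shift_op m n q e h (shift_op m n p d g f))"
proof
  fix x
  have "before p q \<noteq> before q p" using assms(1) by (auto simp: before_def prod_eq_iff)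
  then show "shift_op m n p d g (shift_op m n q e h f) x
    = fscale (ssign p q) (shift_op m n q e h (shift_op m n p d g f)) x"
    using assms
    by (auto simp: shift_op_def jw_sign_upd ssign_def fun_upd_twist[OF assms(1)] mult_ac)
qed

lemma shift_op_same:
  assumes "p \<in> idx m n \<times> idx m n" "odd d"
  shows "shift_op m n p d g (shift_op m n p e h f)
    = (\<lambda>x. g (x p) * h (x p + d) * f (x(p := x p + d + e)))"
proof
  fix x
  have "\<not> before p p" by (simp add: before_def)
  then have "jw_sign m n p (x(p := x p + d)) = jw_sign m n p x"
    using jw_sign_upd[OF assms, of p x] by simp
  then have "shift_op m n p d g (shift_op m n p e h f) x
    = (jw_sign m n p x * jw_sign m n p x) * (g (x p) * h (x p + d) * f (x(p := x p + d + e)))"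
    by (simp add: shift_op_def mult_ac)
  then show "shift_op m n p d g (shift_op m n p e h f) x = g (x p) * h (x p + d) * f (x(p := x p + d + e))"
    by (simp add: jw_sign_sq)
qed

text \<open>In terms of the coefficients of a polynomial, \<open>up\<close> belongs to
  multiplication by the variable and \<open>dn\<close> to differentiation. An odd variable sees its
  occupation only modulo 2, which makes its square vanish.\<close>

definition up :: "int \<times> int \<Rightarrow> int \<Rightarrow> complex"
  where "up p a = (if ferm p then of_bool (odd a) else of_bool (a \<noteq> 0))"

definition dn :: "int \<times> int \<Rightarrow> int \<Rightarrow> complex"
  where "dn p a = (if ferm p then of_bool (even a) else of_int (a + 1))"

text \<open>For \<open>i < k\<close> the roles of \<open>x\<^sub>i\<^sub>k\<close> and \<open>\<partial>\<^sub>i\<^sub>k\<close> are interchanged: \<open>x\<^sub>i\<^sub>k\<close> annihilates.\<close>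

definition xdir :: "int \<times> int \<Rightarrow> int"
  where "xdir p = (if fst p < snd p then 1 else - 1)"

text \<open>Interchanging an even variable with its derivative reverses their commutator, hence the
  factor -1. The anticommutator of an odd pair is symmetric and keeps the factor 1.\<close>

definition xwt :: "int \<times> int \<Rightarrow> int \<Rightarrow> complex"
  where "xwt p a = (if snd p < fst p then up p a
    else if fst p < snd p then (if ferm p then 1 else - 1) * dn p a else 1)"

text \<open>On the diagonal this differentiates the power \<open>a + 1 + c i\<close> of the
  variable: occupations there are offsets from the complex exponent \<open>c i\<close> of the
  vacuum.\<close>

definition dwt :: "(int \<Rightarrow> complex) \<Rightarrow> int \<times> int \<Rightarrow> int \<Rightarrow> complex"
  where "dwt c p a = (if snd p < fst p then dn p a
    else if fst p < snd p then up p a else of_int (a + 1) + c (fst p))"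

definition xop :: "nat \<Rightarrow> nat \<Rightarrow> int \<times> int \<Rightarrow> (occ \<Rightarrow> complex) \<Rightarrow> occ \<Rightarrow> complex"
  where "xop m n p = shift_op m n p (xdir p) (xwt p)"

definition dop :: "nat \<Rightarrow> nat \<Rightarrow> (int \<Rightarrow> complex) \<Rightarrow> int \<times> int \<Rightarrow> (occ \<Rightarrow> complex) \<Rightarrow> occ \<Rightarrow> complex"
  where "dop m n c p = shift_op m n p (- xdir p) (dwt c p)"

lemma xdir_odd [simp]: "odd (xdir p)"
  by (simp add: xdir_def)

section \<open>Canonical relations and the operators built from them\<close>

context
  fixes m n :: nat and c :: "int \<Rightarrow> complex"
begin

abbreviation "II \<equiv> idx m n \<times> idx m n"

lemma xop_xop:
  assumes "p \<in> II" "q \<in> II"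
  shows "xop m n p (xop m n q f) = fscale (ssign p q) (xop m n q (xop m n p f))"
proof (cases "p = q")
  case False
  then show ?thesis unfolding xop_def by (rule shift_op_swap) (use assms in simp_all)
next
  case True
  show ?thesis
  proof (cases "ferm p")
    case True
    then have "fst p \<noteq> snd p" by (auto simp: ferm_def)
    then have "xwt p a * xwt p (a + xdir p) = 0" for a
      using True by (auto simp: xwt_def xdir_def up_def dn_def)
    then have "xop m n p (xop m n p f) = (\<lambda>_. 0)"
      using assms by (simp add: xop_def shift_op_same fun_eq_iff)
    then show ?thesis using \<open>p = q\<close> by (simp add: fun_eq_iff)
  qed (use True in \<open>simp add: ssign_def fun_eq_iff\<close>)
qed

lemma dop_dop:
  assumes "p \<in> II" "q \<in> II"
  shows "dop m n c p (dop m n c q f) = fscale (ssign p q) (dop m n c q (dop m n c p f))"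
proof (cases "p = q")
  case False
  then show ?thesis unfolding dop_def by (rule shift_op_swap) (use assms in simp_all)
next
  case True
  show ?thesis
  proof (cases "ferm p")
    case True
    then have "fst p \<noteq> snd p" by (auto simp: ferm_def)
    then have "dwt c p a * dwt c p (a - xdir p) = 0" for a
      using True by (auto simp: dwt_def xdir_def up_def dn_def)
    then have "dop m n c p (dop m n c p f) = (\<lambda>_. 0)"
      using assms by (simp add: dop_def shift_op_same fun_eq_iff)
    then show ?thesis using \<open>p = q\<close> by (simp add: fun_eq_iff)
  qed (use True in \<open>simp add: ssign_def fun_eq_iff\<close>)
qed

text \<open>For \<open>p = q\<close> this is a relation between weights alone. It holds at every
  integer occupation, since off the diagonal \<open>up\<close> cuts off an even variable only where
  the factor from \<open>dn\<close> is zero anyway.\<close>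

lemma dop_xop:
  assumes "p \<in> II" "q \<in> II"
  shows "dop m n c p (xop m n q f) = fscale (ssign p q) (xop m n q (dop m n c p f)) + (if p = q then f else 0)"
proof (cases "p = q")
  case False
  have "dop m n c p (xop m n q f) = fscale (ssign p q) (xop m n q (dop m n c p f))"
    unfolding xop_def dop_def by (rule shift_op_swap) (use False assms in simp_all)
  then show ?thesis using False by simp
next
  case True
  have "dwt c p a * xwt p (a - xdir p) - ssign p p * (xwt p a * dwt c p (a + xdir p)) = 1" for a
    by (cases "fst p" "snd p" rule: linorder_cases; cases "ferm p"; cases "even a"; cases "a = - 1")
      (auto simp: dwt_def xwt_def xdir_def up_def dn_def ssign_def ferm_def)
  then have "dwt c p a * xwt p (a - xdir p) = ssign p p * (xwt p a * dwt c p (a + xdir p)) + 1" for a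
    by (simp add: diff_eq_eq add.commute)
  then show ?thesis
    using True assms by (simp add: xop_def dop_def shift_op_same fun_eq_iff algebra_simps)
qed

lemma xop_add: "xop m n p (f + g) = xop m n p f + xop m n p g"
  and dop_add: "dop m n c p (f + g) = dop m n c p f + dop m n c p g"
  and xop_scale: "xop m n p (fscale z f) = fscale z (xop m n p f)"
  and dop_scale: "dop m n c p (fscale z f) = fscale z (dop m n c p f)"
  by (simp_all add: xop_def dop_def shift_op_add shift_op_scale)

lemma linear_xop: "Vector_Spaces.linear fscale fscale (xop m n p)"
  and linear_dop: "Vector_Spaces.linear fscale fscale (dop m n c p)"
  by (simp_all add: Vector_Spaces.linear_iff fs.vector_space_axioms xop_add xop_scale dop_add dop_scale)

interpretation xop: Vector_Spaces.linear fscale fscale "xop m n p" for p by (rule linear_xop)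
interpretation dop: Vector_Spaces.linear fscale fscale "dop m n c p" for p by (rule linear_dop)

definition osc :: "int \<Rightarrow> int \<Rightarrow> (occ \<Rightarrow> complex) \<Rightarrow> occ \<Rightarrow> complex"
  where "osc i j f = (\<Sum>k\<in>idx m n. xop m n (i, k) (dop m n c (j, k) f))"

text \<open>Moving one product of a variable and a derivative past another costs four signs. The
  parities of the summation indices \<open>k\<close> and \<open>l\<close> cancel, and what remains
  is the sign of the two matrix units.\<close>

lemma ssign_prod:
  "ssign (j, k) (a, l) * (ssign (i, k) (a, l) * (ssign (j, k) (b, l) * ssign (b, l) (i, k))) = sg i j a b"
  by (cases "i < 0"; cases "j < 0"; cases "a < 0"; cases "b < 0"; cases "k < 0"; cases "l < 0")
    (simp_all add: ssign_def sg_def ferm_def)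

lemma osc_pair:
  assumes "i \<in> idx m n" "j \<in> idx m n" "a \<in> idx m n" "b \<in> idx m n" "k \<in> idx m n" "l \<in> idx m n"
  shows "xop m n (i, k) (dop m n c (j, k) (xop m n (a, l) (dop m n c (b, l) f)))
    = fscale (sg i j a b) (xop m n (a, l) (dop m n c (b, l) (xop m n (i, k) (dop m n c (j, k) f))))
      + (if k = l then (if j = a then xop m n (i, k) (dop m n c (b, k) f) else 0) else 0)
      - (if k = l then (if i = b then fscale (sg i j a b) (xop m n (a, k) (dop m n c (j, k) f)) else 0) else 0)"
proof -
  let ?X = "xop m n" and ?D = "dop m n c"
  define h where "h = ?D (j, k) f"
  have II: "(i, k) \<in> II" "(j, k) \<in> II" "(a, l) \<in> II" "(b, l) \<in> II" using assms by auto
  have 1: "?D (j, k) (?X (a, l) (?D (b, l) f)) = fscale (ssign (j, k) (a, l)) (?X (a, l) (?D (j, k) (?D (b, l) f)))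
      + (if (j, k) = (a, l) then ?D (b, l) f else 0)"
    by (rule dop_xop[OF II(2,3)])
  have 2: "?X (i, k) (?X (a, l) (?D (j, k) (?D (b, l) f)))
      = fscale (ssign (i, k) (a, l) * ssign (j, k) (b, l)) (?X (a, l) (?X (i, k) (?D (b, l) h)))"
    using xop_xop[OF II(1,3)] dop_dop[OF II(2,4), of f] by (simp add: h_def xop.scale)
  have "?D (b, l) (?X (i, k) h) = fscale (ssign (b, l) (i, k)) (?X (i, k) (?D (b, l) h))
      + (if (b, l) = (i, k) then h else 0)"
    by (rule dop_xop[OF II(4,1)])
  then have "fscale (ssign (b, l) (i, k)) (?D (b, l) (?X (i, k) h) - (if (b, l) = (i, k) then h else 0))
      = ?X (i, k) (?D (b, l) h)"
    by simp
  then have 3: "?X (i, k) (?D (b, l) h)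
      = fscale (ssign (b, l) (i, k)) (?D (b, l) (?X (i, k) h) - (if (b, l) = (i, k) then h else 0))" ..
  have "?X (i, k) (?D (j, k) (?X (a, l) (?D (b, l) f)))
      = fscale (ssign (j, k) (a, l)) (?X (i, k) (?X (a, l) (?D (j, k) (?D (b, l) f))))
      + ?X (i, k) (if (j, k) = (a, l) then ?D (b, l) f else 0)"
    unfolding 1 by (simp add: xop.add xop.scale)
  also have "fscale (ssign (j, k) (a, l)) (?X (i, k) (?X (a, l) (?D (j, k) (?D (b, l) f))))
      = fscale (sg i j a b) (?X (a, l) (?D (b, l) (?X (i, k) h) - (if (b, l) = (i, k) then h else 0)))"
    unfolding 2 3 xop.scale fs.scale_scale ssign_prod[of j k a l i b, symmetric] by (simp only: mult.assoc)
  finally show ?thesis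
    by (auto simp: h_def xop.diff fs.scale_right_diff_distrib)
qed

lemma osc_rel:
  assumes "i \<in> idx m n" "j \<in> idx m n" "a \<in> idx m n" "b \<in> idx m n"
  shows "osc i j (osc a b f) = fscale (sg i j a b) (osc a b (osc i j f))
    + (if j = a then osc i b f else 0) - (if i = b then fscale (sg i j a b) (osc a j f) else 0)"
proof -
  let ?t = "\<lambda>i j a b k l. xop m n (i, k) (dop m n c (j, k) (xop m n (a, l) (dop m n c (b, l) f)))"
  have ex: "osc i j (osc a b f) = (\<Sum>k\<in>idx m n. \<Sum>l\<in>idx m n. ?t i j a b k l)" for i j a b
    by (simp add: osc_def xop.sum dop.sum)
  have "osc i j (osc a b f) = (\<Sum>k\<in>idx m n. \<Sum>l\<in>idx m n. fscale (sg i j a b) (?t a b i j l k)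
      + (if k = l then (if j = a then xop m n (i, k) (dop m n c (b, k) f) else 0) else 0)
      - (if k = l then (if i = b then fscale (sg i j a b) (xop m n (a, k) (dop m n c (j, k) f)) else 0) else 0))"
    unfolding ex by (intro sum.cong refl osc_pair assms)
  also have "\<dots> = (\<Sum>k\<in>idx m n. \<Sum>l\<in>idx m n. fscale (sg i j a b) (?t a b i j l k))
      + (\<Sum>k\<in>idx m n. (if j = a then xop m n (i, k) (dop m n c (b, k) f) else 0))
      - (\<Sum>k\<in>idx m n. (if i = b then fscale (sg i j a b) (xop m n (a, k) (dop m n c (j, k) f)) else 0))"
    by (simp add: sum.distrib sum_subtractf)
  also have "(\<Sum>k\<in>idx m n. \<Sum>l\<in>idx m n. fscale (sg i j a b) (?t a b i j l k))
      = fscale (sg i j a b) (osc a b (osc i j f))"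
    unfolding ex fs.scale_sum_right by (rule sum.swap)
  finally show ?thesis
    by (auto simp: osc_def fs.scale_sum_right)
qed

section \<open>The vacuum and its weight\<close>

definition vac :: "occ \<Rightarrow> complex"
  where "vac x = of_bool (x = (\<lambda>_. 0))"

lemma vac_eq_0: "x p \<noteq> 0 \<Longrightarrow> vac x = 0"
  by (auto simp: vac_def)

text \<open>Annihilation reaches the vacuum only from a reading at occupation -1, and there the
  weight is zero.\<close>

lemma dn_vac: "shift_op m n p 1 g vac = 0" if "g (- 1) = 0"
proof
  fix x
  have "g (x p) * vac (x(p := x p + 1)) = 0"
  proof (cases "x p = - 1")
    case False
    then have "(x(p := x p + 1)) p \<noteq> 0" by simp
    then show ?thesis by (simp only: vac_eq_0 mult_zero_right)
  qed (use that in simp)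
  then show "shift_op m n p 1 g vac x = 0 x"
    by (simp add: shift_op_def mult.assoc)
qed

lemma dop_vac: "k < j \<Longrightarrow> dop m n c (j, k) vac = 0"
  and xop_vac: "i < k \<Longrightarrow> xop m n (i, k) vac = 0"
  by (simp_all add: dop_def xop_def xdir_def dn_vac dwt_def xwt_def dn_def)

text \<open>Each summand vanishes separately: for \<open>k < j\<close> the derivative at
  \<open>(j, k)\<close> kills the vacuum, and otherwise \<open>i < k\<close>, so the variable at
  \<open>(i, k)\<close> does, after it is moved to the right up to sign.\<close>

lemma osc_raise_vac:
  assumes "i \<in> idx m n" "j \<in> idx m n" "i < j"
  shows "osc i j vac = 0"
  unfolding osc_def
proof (rule sum.neutral, rule ballI)
  fix k assume k: "k \<in> idx m n"
  show "xop m n (i, k) (dop m n c (j, k) vac) = 0"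
  proof (cases "k < j")
    case True
    then show ?thesis by (simp add: dop_vac xop.zero)
  next
    case False
    then have "i < k" using assms by simp
    have "dop m n c (j, k) (xop m n (i, k) vac)
        = fscale (ssign (j, k) (i, k)) (xop m n (i, k) (dop m n c (j, k) vac))"
      using dop_xop[of "(j, k)" "(i, k)" vac] assms k by simp
    then show ?thesis using \<open>i < k\<close> by (simp add: xop_vac dop.zero ssign_def split: if_splits)
  qed
qed

text \<open>The summand \<open>k = i\<close> contributes the exponent \<open>c i\<close>, those with
  \<open>k < i\<close> vanish, and those with \<open>i < k\<close> are normal ordering
  constants.\<close>

lemma osc_weight_vac:
  assumes "i \<in> idx m n"
  shows "osc i i vac = fscale (c i + (\<Sum>k | k \<in> idx m n \<and> i < k. if ferm (i, k) then 1 else - 1)) vac"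
proof -
  have v: "g (x p) * vac x = g 0 * vac x" for x p and g :: "int \<Rightarrow> complex"
    by (cases "x p = 0") (simp_all add: vac_eq_0)
  have "xop m n (i, k) (dop m n c (i, k) vac)
      = (if k = i then fscale (c i) vac else 0) + (if i < k then fscale (if ferm (i, k) then 1 else - 1) vac else 0)"
    if "k \<in> idx m n" for k
  proof (cases i k rule: linorder_cases)
    case less
    have "xop m n (i, k) (dop m n c (i, k) vac)
        = (\<lambda>x. (\<lambda>a. xwt (i, k) a * dwt c (i, k) (a + 1)) (x (i, k)) * vac x)"
      using less that assms by (simp add: xop_def dop_def shift_op_same xdir_def)
    also have "\<dots> = fscale (xwt (i, k) 0 * dwt c (i, k) (0 + 1)) vac"
      by (subst v) (simp add: fun_eq_iff)
    finally show ?thesis using less by (simp add: xwt_def dwt_def up_def dn_def)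
  next
    case equal
    have "xop m n (i, k) (dop m n c (i, k) vac)
        = (\<lambda>x. (\<lambda>a. xwt (i, k) a * dwt c (i, k) (a - 1)) (x (i, k)) * vac x)"
      using equal that assms by (simp add: xop_def dop_def shift_op_same xdir_def)
    also have "\<dots> = fscale (xwt (i, k) 0 * dwt c (i, k) (0 - 1)) vac"
      by (subst v) (simp add: fun_eq_iff)
    finally show ?thesis using equal by (simp add: xwt_def dwt_def)
  next
    case greater
    then show ?thesis by (simp add: dop_vac xop.zero)
  qed
  then have "osc i i vac = (\<Sum>k\<in>idx m n. (if k = i then fscale (c i) vac else 0)
      + (if i < k then fscale (if ferm (i, k) then 1 else - 1) vac else 0))"
    unfolding osc_def by (intro sum.cong) auto
  also have "\<dots> = fscale (c i) vac
      + (\<Sum>k | k \<in> idx m n \<and> i < k. fscale (if ferm (i, k) then 1 else - 1) vac)"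
    using assms by (simp add: sum.distrib sum.inter_filter)
  finally show ?thesis by (simp add: fs.scale_left_distrib fs.scale_sum_left)
qed

end

text \<open>The exponent that absorbs the normal ordering constants, so that the vacuum has weight
  \<open>lam\<close> exactly.\<close>

definition osc_shift :: "nat \<Rightarrow> nat \<Rightarrow> weight \<Rightarrow> int \<Rightarrow> complex"
  where "osc_shift m n lam i = lam i - (\<Sum>k | k \<in> idx m n \<and> i < k. if ferm (i, k) then 1 else - 1)"

lemma gl_rep_osc: "gl_rep fscale m n (osc m n c)"
proof unfold_locales
  show "osc m n c i j (f + g) = osc m n c i j f + osc m n c i j g" for i j f g
    by (simp add: osc_def xop_add dop_add sum.distrib)
  show "osc m n c i j (fscale z f) = fscale z (osc m n c i j f)" for i j f z
    by (simp add: osc_def xop_scale dop_scale fs.scale_sum_right)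
qed (rule osc_rel)

lemma gl_hw_osc: "gl_hw fscale m n (osc m n (osc_shift m n lam)) lam vac"
proof -
  interpret gl_rep fscale m n "osc m n (osc_shift m n lam)" by (rule gl_rep_osc)
  show ?thesis
  proof
    show "osc m n (osc_shift m n lam) i i vac = fscale (lam i) vac" if "i \<in> idx m n" for i
      using osc_weight_vac[OF that, of "osc_shift m n lam"] by (simp add: osc_shift_def)
  qed (rule osc_raise_vac)
qed

section \<open>Leading monomials of words\<close>

text \<open>
  The leading monomial of a word: for each letter \<open>(i, j)\<close> the excitation \<open>\<partial>\<^sub>j\<^sub>i\<close> together with the factor
  \<open>x\<^sub>i\<^sub>i\<close> that accompanies it in \<open>E\<^sub>i\<^sub>j\<close>.
\<close>

definition word_occ :: "(int \<times> int) list \<Rightarrow> occ"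
  where "word_occ w p = (\<Sum>(i, j)\<leftarrow>w. of_bool (p = (j, i)) + of_bool (p = (i, i)))"

lemma word_occ_simps [simp]:
  "word_occ [] p = 0"
  "word_occ ((i, j) # w) p = of_bool (p = (j, i)) + of_bool (p = (i, i)) + word_occ w p"
  by (simp_all add: word_occ_def)

lemma word_occ_nonneg: "word_occ w p \<ge> 0"
  by (induction w) auto

lemma word_occ_col: "k \<notin> fst ` set w \<Longrightarrow> word_occ w (j, k) = 0"
  by (induction w) auto

lemma word_occ_lower: "lower_word m n w \<Longrightarrow> k < i \<Longrightarrow> word_occ w (i, k) = 0"
  by (induction w) auto

context
  fixes m n :: nat and c :: "int \<Rightarrow> complex"
begin

interpretation osc: gl_rep fscale m n "osc m n c" by (rule gl_rep_osc)

lemma xop_dop_eval: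
  "\<exists>z. xop m n p (dop m n c q f) x
    = z * f ((x(p := x p + xdir p))(q := (x(p := x p + xdir p)) q - xdir q))"
  by (simp add: xop_def dop_def shift_op_def)

text \<open>For \<open>k < i\<close> the variable at \<open>(i, k)\<close> creates, with weight
  \<open>up (i, k) 0 = 0\<close> when the result is read at a state without that excitation.\<close>

lemma osc_lower_eval:
  assumes "i \<in> idx m n" "\<And>k. k < i \<Longrightarrow> x (i, k) = 0"
  shows "osc m n c i j f x = (\<Sum>k | k \<in> idx m n \<and> i \<le> k. xop m n (i, k) (dop m n c (j, k) f) x)"
proof -
  have "xop m n (i, k) (dop m n c (j, k) f) x = 0" if "k < i" for k
    using that assms by (simp add: xop_def shift_op_def xwt_def up_def)
  then have "i \<le> k" if "xop m n (i, k) (dop m n c (j, k) f) x \<noteq> 0" for k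
    using that by (meson not_le)
  then show ?thesis
    unfolding osc_def sum_fun_apply by (intro sum.mono_neutral_right) auto
qed

text \<open>At such states a letter \<open>(i, j)\<close> touches only positions
  \<open>(i, k)\<close> and \<open>(j, k)\<close> with \<open>j < i \<le> k\<close>. Hence
  \<open>(r, r)\<close> is changed only by letters of row \<open>r\<close>; without them its nonzero
  occupation persists down to the vacuum, where the value is 0.\<close>

lemma wact_missing_row:
  assumes "lower_word m n w" "r \<notin> fst ` set w" "\<And>i k. k < i \<Longrightarrow> x (i, k) = 0" "x (r, r) \<noteq> 0"
  shows "osc.wact w vac x = 0"
  using assms
proof (induction w arbitrary: x)
  case Nil
  then show ?case by (simp add: vac_eq_0)
next
  case (Cons p w)
  obtain i j where p: "p = (i, j)" by (cases p)
  have ij: "i \<in> idx m n" "j < i" "i \<noteq> r" using Cons.prems by (auto simp: p)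
  have "xop m n (i, k) (dop m n c (j, k) (osc.wact w vac)) x = 0" if k: "i \<le> k" for k
  proof -
    let ?x = "(x((i, k) := x (i, k) + xdir (i, k)))((j, k) := (x((i, k) := x (i, k) + xdir (i, k))) (j, k) - xdir (j, k))"
    obtain z where z: "xop m n (i, k) (dop m n c (j, k) (osc.wact w vac)) x = z * osc.wact w vac ?x"
      using xop_dop_eval by blast
    have "osc.wact w vac ?x = 0"
      by (rule Cons.IH) (use Cons.prems k ij in \<open>auto simp: p\<close>)
    with z show ?thesis by simp
  qed
  then have "osc m n c i j (osc.wact w vac) x = 0"
    using osc_lower_eval[OF ij(1), of x] Cons.prems by (simp add: sum.neutral)
  then show ?case by (simp add: p)
qed

text \<open>For \<open>k > i\<close> the derivative at \<open>(j, k)\<close> creates an excitation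
  which \<open>x\<close> lacks, so only the summand \<open>k = i\<close> survives.\<close>

lemma osc_top_eval:
  assumes i: "i \<in> idx m n" "j < i" and x: "\<And>k. k < i \<Longrightarrow> x (i, k) = 0" "\<And>k. i < k \<Longrightarrow> x (j, k) = 0"
  shows "osc m n c i j f x = jw_sign m n (j, i) (x((i, i) := x (i, i) - 1)) * up (j, i) (x (j, i))
    * f (x((i, i) := x (i, i) - 1, (j, i) := x (j, i) - 1))"
proof -
  have "xop m n (i, k) (dop m n c (j, k) f) x = 0" if "i < k" for k
    using that assms by (simp add: xop_def dop_def shift_op_def dwt_def up_def)
  then have "(\<Sum>k | k \<in> idx m n \<and> i \<le> k. xop m n (i, k) (dop m n c (j, k) f) x)
      = (\<Sum>k\<in>{i}. xop m n (i, k) (dop m n c (j, k) f) x)"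
    by (intro sum.mono_neutral_right) (use i in auto)
  moreover have "osc m n c i j f x = (\<Sum>k | k \<in> idx m n \<and> i \<le> k. xop m n (i, k) (dop m n c (j, k) f) x)"
    by (rule osc_lower_eval[OF i(1)]) (rule x(1))
  ultimately have "osc m n c i j f x = (\<Sum>k\<in>{i}. xop m n (i, k) (dop m n c (j, k) f) x)"
    by simp
  also have "\<dots> = jw_sign m n (j, i) (x((i, i) := x (i, i) - 1)) * up (j, i) (x (j, i))
    * f (x((i, i) := x (i, i) - 1, (j, i) := x (j, i) - 1))"
    using i by (simp add: xop_def dop_def shift_op_def dwt_def xwt_def xdir_def jw_sign_def ferm_def)
  finally show ?thesis .
qed

text \<open>Compare the first letters \<open>(i, j)\<close> and \<open>(i', j')\<close>. If
  \<open>i < i'\<close>, the word \<open>w\<close> lacks the row \<open>i'\<close>. Otherwise the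
  first letter of \<open>w\<close> removes an excitation at \<open>(j, i)\<close>, which the
  monomial of \<open>w'\<close> has only if the letters agree; then both words lose their first
  letter.\<close>

proposition wact_word_occ:
  assumes "decreasing_word m n w" "decreasing_word m n w'"
  shows "osc.wact w vac (word_occ w') \<noteq> 0 \<longleftrightarrow> w = w'"
  using assms
proof (induction w arbitrary: w')
  case Nil
  show ?case
  proof (cases w')
    case Nil
    have "word_occ [] = (\<lambda>_. 0)" by (simp add: fun_eq_iff)
    then show ?thesis using Nil by (simp add: vac_def)
  next
    case (Cons p u)
    obtain i j where p: "p = (i, j)" by (cases p)
    have "word_occ w' (i, i) \<noteq> 0" using word_occ_nonneg[of u "(i, i)"] by (auto simp: Cons p)
    then show ?thesis using Cons by (simp add: vac_eq_0)
  qed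
next
  case (Cons p u)
  obtain i j where p: "p = (i, j)" by (cases p)
  have w: "i \<in> idx m n" "j < i" "decreasing_word m n u" "\<And>k l. (k, l) \<in> set u \<Longrightarrow> k < i"
    and lw: "lower_word m n w'" "lower_word m n (p # u)"
    using Cons.prems by (auto simp: decreasing_word_def p)
  have low: "word_occ w' (k, l) = 0" if "l < k" for k l
    using word_occ_lower[OF lw(1) that] .
  show ?case
  proof (cases w')
    case Nil
    have z: "osc m n c i j f (word_occ []) = 0" for f
      by (subst osc_top_eval) (use w in \<open>auto simp: up_def\<close>)
    show ?thesis by (simp only: Nil p osc.wact_simps z list.distinct simp_thms)
  next
    case w': (Cons p' u')
    obtain i' j' where p': "p' = (i', j')" by (cases p')
    have v: "j' < i'" "decreasing_word m n u'" "\<And>k l. (k, l) \<in> set u' \<Longrightarrow> k < i'"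
      using Cons.prems by (auto simp: decreasing_word_def p' w')
    show ?thesis
    proof (cases "i < i'")
      case True
      have "osc.wact (p # u) vac (word_occ w') = 0"
      proof (rule wact_missing_row[OF lw(2), of i'])
        show "i' \<notin> fst ` set (p # u)" using w True by (force simp: p)
        show "word_occ w' (i', i') \<noteq> 0" using word_occ_nonneg[of u' "(i', i')"] by (auto simp: w' p')
      qed (rule low)
      moreover have "p # u \<noteq> w'" using True by (auto simp: w' p p')
      ultimately show ?thesis by blast
    next
      case False
      have z: "word_occ w' (j, k) = 0" if "i < k" for k
        by (rule word_occ_col) (use that False v in \<open>force simp: w' p'\<close>)
      have u0: "word_occ u' (j, i) = 0"
        by (rule word_occ_col) (use False v in force)
      have ev: "osc.wact (p # u) vac (word_occ w')
          = jw_sign m n (j, i) ((word_occ w')((i, i) := word_occ w' (i, i) - 1)) * up (j, i) (word_occ w' (j, i))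
          * osc.wact u vac ((word_occ w')((i, i) := word_occ w' (i, i) - 1, (j, i) := word_occ w' (j, i) - 1))"
        using osc_top_eval[OF w(1,2), of "word_occ w'", OF low z] by (simp add: p)
      show ?thesis
      proof (cases "i = i' \<and> j = j'")
        case True
        have "(word_occ w')((i, i) := word_occ w' (i, i) - 1, (j, i) := word_occ w' (j, i) - 1) = word_occ u'"
          using True w(2) by (auto simp: fun_eq_iff w' p')
        moreover have "up (j, i) (word_occ w' (j, i)) = 1"
          using True w(2) u0 by (simp add: w' p' up_def)
        ultimately have "osc.wact (p # u) vac (word_occ w') \<noteq> 0 \<longleftrightarrow> osc.wact u vac (word_occ u') \<noteq> 0"
          using ev jw_sign_nonzero by simp
        moreover have "p # u = w' \<longleftrightarrow> u = u'" using True by (simp add: p p' w')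
        ultimately show ?thesis using Cons.IH[OF w(3) v(2)] by blast
      next
        case F: False
        then have "word_occ w' (j, i) = 0" using w(2) u0 by (auto simp: w' p')
        then have "osc.wact (p # u) vac (word_occ w') = 0" using ev by (simp only: up_def) simp
        moreover have "p # u \<noteq> w'" using F by (auto simp: p p' w')
        ultimately show ?thesis by blast
      qed
    qed
  qed
qed

end

section \<open>Left ideals of the free algebra\<close>

definition lext :: "(complex \<Rightarrow> 'v \<Rightarrow> 'v) \<Rightarrow> ('x \<Rightarrow> 'v) \<Rightarrow> ('x \<Rightarrow>\<^sub>0 complex) \<Rightarrow> 'v :: ab_group_add"
  where "lext s g p = (\<Sum>x\<in>Poly_Mapping.keys p. s (Poly_Mapping.lookup p x) (g x))"

lemma pm_expand: "p = (\<Sum>x\<in>Poly_Mapping.keys p. pm_scale (Poly_Mapping.lookup p x) (Poly_Mapping.single x 1))"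
  by (rule poly_mapping_eqI)
    (simp add: lookup_sum lookup_pm_scale lookup_single when_def in_keys_iff if_distrib cong: if_cong)

locale complex_vector_space = vector_space scale
  for scale :: "complex \<Rightarrow> 'v :: ab_group_add \<Rightarrow> 'v"
begin

lemma lext_eq_sum:
  assumes "finite A" "Poly_Mapping.keys p \<subseteq> A"
  shows "lext scale g p = (\<Sum>x\<in>A. scale (Poly_Mapping.lookup p x) (g x))"
  unfolding lext_def using assms by (intro sum.mono_neutral_left) (auto simp: in_keys_iff)

lemma linear_lext: "Vector_Spaces.linear pm_scale scale (lext scale g)"
proof -
  have "lext scale g (p + q) = lext scale g p + lext scale g q" for p q
    using Poly_Mapping.keys_add[of p q]
    by (simp add: lext_eq_sum[of "Poly_Mapping.keys p \<union> Poly_Mapping.keys q"] lookup_add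
        scale_left_distrib sum.distrib)
  moreover have "lext scale g (pm_scale c p) = scale c (lext scale g p)" for c p
    by (subst lext_eq_sum[of "Poly_Mapping.keys p"])
      (auto simp: lext_def lookup_pm_scale in_keys_iff scale_sum_right)
  ultimately show ?thesis
    by (simp add: Vector_Spaces.linear_iff pm.vector_space_axioms vector_space_axioms)
qed

lemma lext_single [simp]: "lext scale g (Poly_Mapping.single x c) = scale c (g x)"
  by (simp add: lext_def)

lemma pm_linear_eq:
  assumes "Vector_Spaces.linear pm_scale scale f" "Vector_Spaces.linear pm_scale scale g"
    and "\<And>x. f (Poly_Mapping.single x 1) = g (Poly_Mapping.single x 1)"
  shows "f p = g p"
proof -
  interpret f: Vector_Spaces.linear pm_scale scale f by fact
  interpret g: Vector_Spaces.linear pm_scale scale g by fact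
  show ?thesis
    by (subst (1 2) pm_expand[of p]) (simp add: f.sum g.sum f.scale g.scale assms(3))
qed

end

sublocale gl_rep \<subseteq> complex_vector_space scale ..

interpretation pmc: complex_vector_space pm_scale ..

lemma pm_scale_eq_mult: "pm_scale c p = tens_const c * p"
  unfolding pm_scale_def tens_const_def by (simp add: mult_map_scale_conv_mult zero_list_def)

lemma pm_scale_mult_left: "pm_scale c p * q = pm_scale c (p * q)" for p q :: tens
  by (simp add: pm_scale_eq_mult mult.assoc)

lemma linear_mult_right: "Vector_Spaces.linear pm_scale pm_scale (\<lambda>p :: tens. p * q)"
  by (simp add: Vector_Spaces.linear_iff pm.vector_space_axioms distrib_right pm_scale_mult_left)

lemma tens_const_single: "tens_const c * Poly_Mapping.single w 1 = Poly_Mapping.single w 1 * tens_const c"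
  by (simp add: tens_const_def mult_single plus_list_def)

lemma tens_const_central: "p * tens_const c = tens_const c * p"
proof (rule pmc.pm_linear_eq[of "\<lambda>p. p * tens_const c" "\<lambda>p. tens_const c * p"])
  show "Vector_Spaces.linear pm_scale pm_scale (\<lambda>p. tens_const c * p)"
    by (simp add: Vector_Spaces.linear_iff pm.vector_space_axioms algebra_simps
        pm.scale_left_commute flip: pm_scale_eq_mult)
qed (simp_all add: linear_mult_right tens_const_single)

lemma pm_scale_mult_right: "p * pm_scale c q = pm_scale c (p * q)" for p q :: tens
  by (simp add: pm_scale_eq_mult tens_const_central flip: mult.assoc)

lemma linear_mult_left: "Vector_Spaces.linear pm_scale pm_scale (\<lambda>q :: tens. p * q)"
  by (simp add: Vector_Spaces.linear_iff pm.vector_space_axioms distrib_left pm_scale_mult_right)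

lemma single_mult_single:
  "Poly_Mapping.single u 1 * Poly_Mapping.single w 1 = (Poly_Mapping.single (u @ w) 1 :: tens)"
  by (simp add: mult_single plus_list_def)

lemma tens_const_1 [simp]: "tens_const 1 = 1" "tens_const 0 = 0"
  by (simp_all add: tens_const_def single_one[symmetric] zero_list_def del: single_one)

lemma linear_diff_eq:
  assumes "Vector_Spaces.linear s s' f"
  shows "f (x - y) = f x - f y" "f (x + y) = f x + f y" "f 0 = 0" "f (s c x) = s' c (f x)" "f (- x) = - f x"
proof -
  interpret Vector_Spaces.linear s s' f by fact
  show "f (x - y) = f x - f y" "f (x + y) = f x + f y" "f 0 = 0" "f (s c x) = s' c (f x)" "f (- x) = - f x"
    by (simp_all add: diff add zero scale neg)
qed

definition basic_rel :: "int \<Rightarrow> int \<Rightarrow> int \<Rightarrow> int \<Rightarrow> tens"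
  where "basic_rel i j k l = E i j * E k l - pm_scale (sg i j k l) (E k l * E i j)
    - (if j = k then E i l else 0) + (if i = l then pm_scale (sg i j k l) (E k j) else 0)"

definition hw_rel :: "weight \<Rightarrow> int \<Rightarrow> int \<Rightarrow> tens"
  where "hw_rel lam i j = E i j - tens_const (if i = j then lam i else 0)"

definition rel_gens :: "nat \<Rightarrow> nat \<Rightarrow> tens set"
  where "rel_gens m n = {a * basic_rel i j k l * b | a b i j k l.
    i \<in> idx m n \<and> j \<in> idx m n \<and> k \<in> idx m n \<and> l \<in> idx m n}"

definition hw_gens :: "nat \<Rightarrow> nat \<Rightarrow> weight \<Rightarrow> tens set"
  where "hw_gens m n lam = {a * hw_rel lam i j | a i j. i \<in> idx m n \<and> j \<in> idx m n \<and> i \<le> j}"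

text \<open>A left ideal: the \<open>gl\<close> relations enter with multiples on both sides, the
  relations of the highest weight vector with left multiples only. After restriction to letters in
  the index set its quotient is the Verma module.\<close>

definition verma_ideal :: "nat \<Rightarrow> nat \<Rightarrow> weight \<Rightarrow> tens set"
  where "verma_ideal m n lam = pm.span (rel_gens m n \<union> hw_gens m n lam)"

lemma span_mult_left:
  assumes "\<And>a x. x \<in> S \<Longrightarrow> a * x \<in> S" "p \<in> pm.span S"
  shows "(q :: tens) * p \<in> pm.span S"
proof -
  have "q * p \<in> (\<lambda>p. q * p) ` pm.span S" using assms by blast
  also have "\<dots> = pm.span ((\<lambda>p. q * p) ` S)"
    using module_hom.span_image[OF Vector_Spaces.linear.axioms(3)[OF linear_mult_left]] by simp
  also have "\<dots> \<subseteq> pm.span S" by (rule pm.span_mono) (use assms(1) in auto)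
  finally show ?thesis .
qed

lemma rel_gens_mult: "x \<in> rel_gens m n \<Longrightarrow> a * x \<in> rel_gens m n" "x \<in> rel_gens m n \<Longrightarrow> x * a \<in> rel_gens m n"
  unfolding rel_gens_def by (auto simp: mult.assoc) (metis mult.assoc)+

lemma span_rel_gens_mult_right:
  assumes "p \<in> pm.span (rel_gens m n)"
  shows "p * q \<in> pm.span (rel_gens m n)"
proof -
  have "p * q \<in> (\<lambda>p. p * q) ` pm.span (rel_gens m n)" using assms by blast
  also have "\<dots> = pm.span ((\<lambda>p. p * q) ` rel_gens m n)"
    using module_hom.span_image[OF Vector_Spaces.linear.axioms(3)[OF linear_mult_right]] by simp
  also have "\<dots> \<subseteq> pm.span (rel_gens m n)" by (rule pm.span_mono) (use rel_gens_mult in auto)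
  finally show ?thesis .
qed

lemma verma_ideal_mult: "p \<in> verma_ideal m n lam \<Longrightarrow> q * p \<in> verma_ideal m n lam"
  unfolding verma_ideal_def
proof (rule span_mult_left)
  fix a x assume "x \<in> rel_gens m n \<union> hw_gens m n lam"
  then show "a * x \<in> rel_gens m n \<union> hw_gens m n lam"
    using rel_gens_mult(1)[of x m n a] unfolding hw_gens_def by (auto simp flip: mult.assoc)
qed

lemma span_rel_gens_subset: "pm.span (rel_gens m n) \<subseteq> verma_ideal m n lam"
  unfolding verma_ideal_def by (rule pm.span_mono) auto

lemma basic_rel_in_ideal:
  assumes "i \<in> idx m n" "j \<in> idx m n" "k \<in> idx m n" "l \<in> idx m n"
  shows "basic_rel i j k l * b \<in> verma_ideal m n lam"
proof -
  have "1 * basic_rel i j k l * b \<in> rel_gens m n" unfolding rel_gens_def using assms by blast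
  then show ?thesis unfolding verma_ideal_def by (intro pm.span_base) simp
qed

lemma hw_rel_in_ideal:
  assumes "i \<in> idx m n" "j \<in> idx m n" "i \<le> j"
  shows "hw_rel lam i j \<in> verma_ideal m n lam"
proof -
  have "1 * hw_rel lam i j \<in> hw_gens m n lam" unfolding hw_gens_def using assms by blast
  then show ?thesis unfolding verma_ideal_def by (intro pm.span_base) simp
qed

context gl_rep
begin

definition act :: "tens \<Rightarrow> 'v \<Rightarrow> 'v"
  where "act p f = lext scale (\<lambda>w. wact w f) p"

lemma linear_act: "Vector_Spaces.linear pm_scale scale (\<lambda>p. act p f)"
  unfolding act_def by (rule linear_lext)

lemma act_single: "act (Poly_Mapping.single w 1) f = wact w f"
  by (simp add: act_def)

lemma linear_act_right: "Vector_Spaces.linear scale scale (act p)"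
proof -
  have "act p (f + g) = act p f + act p g" "act p (c *s f) = c *s act p f" for c f g
    by (simp_all add: act_def lext_def wact.add wact.scale scale_right_distrib sum.distrib
        scale_sum_right mult.commute)
  then show ?thesis by (simp add: Vector_Spaces.linear_iff vector_space_axioms)
qed

lemma act_mult: "act (p * q) f = act p (act q f)"
proof (rule pm_linear_eq[of "\<lambda>p. act (p * q) f" "\<lambda>p. act p (act q f)"])
  show "Vector_Spaces.linear pm_scale (*s) (\<lambda>p. act (p * q) f)"
    using module_hom_compose[OF linear_mult_right[THEN Vector_Spaces.linear.axioms(3)]
        linear_act[THEN Vector_Spaces.linear.axioms(3)]]
    by (simp add: o_def module_hom_eq_linear)
  show "act (Poly_Mapping.single u 1 * q) f = act (Poly_Mapping.single u 1) (act q f)" for u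
  proof (rule pm_linear_eq[of "\<lambda>q. act (Poly_Mapping.single u 1 * q) f"
        "\<lambda>q. act (Poly_Mapping.single u 1) (act q f)"])
    show "Vector_Spaces.linear pm_scale (*s) (\<lambda>q. act (Poly_Mapping.single u 1 * q) f)"
      using module_hom_compose[OF linear_mult_left[THEN Vector_Spaces.linear.axioms(3)]
          linear_act[THEN Vector_Spaces.linear.axioms(3)]]
      by (simp add: o_def module_hom_eq_linear)
    show "Vector_Spaces.linear pm_scale (*s) (\<lambda>q. act (Poly_Mapping.single u 1) (act q f))"
      using module_hom_compose[OF linear_act[THEN Vector_Spaces.linear.axioms(3)]
          linear_act_right[THEN Vector_Spaces.linear.axioms(3)]]
      by (simp add: o_def module_hom_eq_linear)
  qed (simp add: single_mult_single act_single)
qed (rule linear_act)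

lemma act_E: "act (E i j) f = e i j f"
  by (simp add: E_def act_single)

lemmas act_linear = linear_diff_eq[OF linear_act]

lemma act_basic_rel:
  assumes "i \<in> I" "j \<in> I" "k \<in> I" "l \<in> I"
  shows "act (basic_rel i j k l) f = 0"
  using e_rel[OF assms, of f]
  by (simp add: basic_rel_def act_linear act_mult act_E split: if_splits)

end

context gl_hw
begin

text \<open>The universal property of the Verma module: \<open>p \<mapsto> act p v\<close> factors
  through the quotient for every highest weight module of weight \<open>lam\<close>.\<close>

lemma act_verma_ideal:
  assumes "p \<in> verma_ideal m n lam"
  shows "act p v = 0"
proof -
  have "verma_ideal m n lam \<subseteq> {p. act p v = 0}"
    unfolding verma_ideal_def
  proof (rule pm.span_minimal)
    show "pm.subspace {p. act p v = 0}"
      by (simp add: pm.subspace_def act_linear)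
    have "act (hw_rel lam i j) v = 0" if "i \<in> I" "j \<in> I" "i \<le> j" for i j
    proof -
      have "act (tens_const c) v = c *s v" for c by (simp add: tens_const_def act_def)
      then show ?thesis using that raise_v[of i j] weight_v[of i]
        by (auto simp: hw_rel_def act_linear act_E)
    qed
    then show "rel_gens m n \<union> hw_gens m n lam \<subseteq> {p. act p v = 0}"
      by (auto simp: rel_gens_def hw_gens_def act_mult act_basic_rel linear_diff_eq(3)[OF linear_act_right])
  qed
  then show ?thesis using assms by auto
qed

end

text \<open>Extend a basis of \<open>K\<close> to a basis of the whole space; \<open>f\<close> kills
  the former and fixes the added vectors.\<close>

lemma subspace_projection:
  assumes "pm.subspace K"
  shows "\<exists>f. Vector_Spaces.linear pm_scale pm_scale f \<and> (\<forall>p. f p = 0 \<longleftrightarrow> p \<in> K)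
    \<and> (\<forall>p. f p - p \<in> K)"
proof -
  interpret pp: vector_space_pair pm_scale pm_scale by unfold_locales
  obtain B where B: "B \<subseteq> K" "pm.independent B" "K \<subseteq> pm.span B" using pm.basis_exists by metis
  define C where "C = pm.extend_basis B"
  define f where "f = pp.construct C (\<lambda>b. if b \<in> B then 0 else b)"
  have C: "pm.independent C" "B \<subseteq> C" "pm.span C = UNIV"
    using pm.independent_extend_basis[OF B(2)] pm.extend_basis_superset[OF B(2)]
      pm.span_extend_basis[OF B(2)] by (auto simp: C_def)
  have lin: "Vector_Spaces.linear pm_scale pm_scale f"
    unfolding f_def by (rule pp.linear_construct[OF C(1)])
  have fC: "f b = (if b \<in> B then 0 else b)" if "b \<in> C" for b
    unfolding f_def using pp.construct_basis[OF C(1) that] .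
  have sub: "pm.subspace {p. f p - p \<in> K}"
    unfolding pm.subspace_def
  proof (intro conjI allI impI ballI)
    show "0 \<in> {p. f p - p \<in> K}"
      using pm.subspace_0[OF assms] by (simp add: linear_diff_eq[OF lin])
    fix x y assume "x \<in> {p. f p - p \<in> K}" "y \<in> {p. f p - p \<in> K}"
    then have "(f x - x) + (f y - y) \<in> K" using pm.subspace_add[OF assms] by simp
    then show "x + y \<in> {p. f p - p \<in> K}" by (simp add: linear_diff_eq[OF lin] algebra_simps)
  next
    fix c x assume "x \<in> {p. f p - p \<in> K}"
    then have "pm_scale c (f x - x) \<in> K" using pm.subspace_scale[OF assms] by simp
    then show "pm_scale c x \<in> {p. f p - p \<in> K}"
      by (simp add: linear_diff_eq[OF lin] pm.scale_right_diff_distrib)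
  qed
  have "pm.span C \<subseteq> {p. f p - p \<in> K}"
    by (rule pm.span_minimal[OF _ sub])
      (use fC B pm.subspace_neg[OF assms] pm.subspace_0[OF assms] in auto)
  then have 1: "f p - p \<in> K" for p using C by auto
  have "pm.span B \<subseteq> {p. f p = 0}"
  proof (rule pm.span_minimal)
    show "pm.subspace {p. f p = 0}" by (simp add: pm.subspace_def linear_diff_eq[OF lin])
  qed (use fC C in auto)
  then have "p \<in> K \<Longrightarrow> f p = 0" for p using B by auto
  moreover have "f p = 0 \<Longrightarrow> p \<in> K" for p
    using 1[of p] pm.subspace_neg[OF assms, of "- p"] by simp
  ultimately show ?thesis using 1 lin by blast
qed

text \<open>
  A linear projection with kernel \<open>verma_ideal\<close> realises the Verma module on its range, so that
  congruences become equations in a type.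
\<close>

definition nf :: "nat \<Rightarrow> nat \<Rightarrow> weight \<Rightarrow> tens \<Rightarrow> tens"
  where "nf m n lam = (SOME f. Vector_Spaces.linear pm_scale pm_scale f
    \<and> (\<forall>p. f p = 0 \<longleftrightarrow> p \<in> verma_ideal m n lam) \<and> (\<forall>p. f p - p \<in> verma_ideal m n lam))"

lemma subspace_verma_ideal: "pm.subspace (verma_ideal m n lam)"
  by (simp add: verma_ideal_def)

lemma nf:
  shows linear_nf: "Vector_Spaces.linear pm_scale pm_scale (nf m n lam)"
    and nf_eq_0_iff: "nf m n lam p = 0 \<longleftrightarrow> p \<in> verma_ideal m n lam"
    and nf_diff_mem: "nf m n lam p - p \<in> verma_ideal m n lam"
  using someI_ex[OF subspace_projection[OF subspace_verma_ideal[of m n lam]]]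
  unfolding nf_def[symmetric] by blast+

lemmas nf_linear = linear_diff_eq[OF linear_nf]

lemma nf_eq_iff: "nf m n lam p = nf m n lam q \<longleftrightarrow> p - q \<in> verma_ideal m n lam"
  using nf_eq_0_iff[of m n lam "p - q"] by (simp add: nf_linear)

lemma nf_mult_nf: "nf m n lam (p * nf m n lam q) = nf m n lam (p * q)"
  unfolding nf_eq_iff right_diff_distrib[symmetric] by (rule verma_ideal_mult) (rule nf_diff_mem)

definition nf_e :: "nat \<Rightarrow> nat \<Rightarrow> weight \<Rightarrow> int \<Rightarrow> int \<Rightarrow> tens \<Rightarrow> tens"
  where "nf_e m n lam i j f = nf m n lam (E i j * f)"

lemma nf_basic_rel:
  assumes "i \<in> idx m n" "j \<in> idx m n" "k \<in> idx m n" "l \<in> idx m n"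
  shows "nf_e m n lam i j (nf_e m n lam k l f) = pm_scale (sg i j k l) (nf_e m n lam k l (nf_e m n lam i j f))
    + (if j = k then nf_e m n lam i l f else 0) - (if i = l then pm_scale (sg i j k l) (nf_e m n lam k j f) else 0)"
proof -
  have "nf_e m n lam i j (nf_e m n lam k l f) - (pm_scale (sg i j k l) (nf_e m n lam k l (nf_e m n lam i j f))
      + (if j = k then nf_e m n lam i l f else 0) - (if i = l then pm_scale (sg i j k l) (nf_e m n lam k j f) else 0))
    = nf m n lam (basic_rel i j k l * f)"
    by (simp add: nf_e_def nf_mult_nf basic_rel_def distrib_right left_diff_distrib nf_linear
        pm_scale_mult_left mult.assoc)
  also have "\<dots> = 0"
    unfolding nf_eq_0_iff by (rule basic_rel_in_ideal[OF assms])
  finally show ?thesis by (simp only: right_minus_eq)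
qed

lemma gl_hw_nf: "gl_hw pm_scale m n (nf_e m n lam) lam (nf m n lam 1)"
proof unfold_locales
  show "nf_e m n lam i j (f + g) = nf_e m n lam i j f + nf_e m n lam i j g" for i j f g
    by (simp add: nf_e_def distrib_left nf_linear)
  show "nf_e m n lam i j (pm_scale c f) = pm_scale c (nf_e m n lam i j f)" for i j c f
    by (simp add: nf_e_def pm_scale_mult_right nf_linear)
  have hw: "nf_e m n lam i j (nf m n lam 1) = nf m n lam (tens_const (if i = j then lam i else 0))"
    if "i \<in> idx m n" "j \<in> idx m n" "i \<le> j" for i j
    using hw_rel_in_ideal[OF that, of lam] by (simp add: nf_e_def nf_mult_nf nf_eq_iff hw_rel_def)
  show "nf_e m n lam i j (nf m n lam 1) = 0" if "i \<in> idx m n" "j \<in> idx m n" "i < j" for i j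
    using hw[of i j] that by (simp add: nf_linear)
  show "nf_e m n lam i i (nf m n lam 1) = pm_scale (lam i) (nf m n lam 1)" if "i \<in> idx m n" for i
  proof -
    have "tens_const (lam i) = pm_scale (lam i) 1" by (simp add: pm_scale_eq_mult)
    then show ?thesis using hw[of i i] that by (simp add: nf_linear)
  qed
qed (rule nf_basic_rel)

section \<open>The enveloping algebra\<close>

definition munit :: "int \<Rightarrow> int \<Rightarrow> mat"
  where "munit i j = (\<lambda>a b. of_bool (a = i \<and> b = j))"

lemma emb_eq: "emb m n x = (\<Sum>i\<in>idx m n. \<Sum>j\<in>idx m n. pm_scale (x i j) (E i j))"
  by (simp add: emb_def pm_scale_eq_mult)

abbreviation idx2 :: "nat \<Rightarrow> nat \<Rightarrow> (int \<times> int) set"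
  where "idx2 m n \<equiv> idx m n \<times> idx m n"

lemma emb_pairs: "emb m n x = (\<Sum>p\<in>idx2 m n. pm_scale (x (fst p) (snd p)) (E (fst p) (snd p)))"
  by (simp add: emb_eq sum.cartesian_product split_beta)

lemma sum_of_bool:
  assumes "finite A"
  shows "(\<Sum>a\<in>A. pm_scale (of_bool (a = i \<and> P)) (g a)) = (if i \<in> A \<and> P then g i else 0)"
  using assms by (cases P) (simp_all add: of_bool_def if_distrib[of "\<lambda>c. pm_scale c _"] cong: if_cong)

lemma emb_munit:
  assumes "i \<in> idx m n" "j \<in> idx m n"
  shows "emb m n (munit i j) = E i j"
proof -
  have "emb m n (munit i j) = (\<Sum>a\<in>idx m n. \<Sum>b\<in>idx m n. pm_scale (of_bool (b = j \<and> a = i)) (E a b))"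
    by (simp add: emb_eq munit_def conj_commute)
  also have "\<dots> = (\<Sum>a\<in>idx m n. if a = i then E a j else 0)"
    using assms by (simp add: sum_of_bool)
  also have "\<dots> = E i j" using assms by simp
  finally show ?thesis .
qed

lemma sg_parity: "sg i j k l = (- 1) ^ (((idx_parity i + idx_parity j) mod 2) * ((idx_parity k + idx_parity l) mod 2))"
  by (simp add: sg_def idx_parity_def)

definition sum2 :: "nat \<Rightarrow> nat \<Rightarrow> mat \<Rightarrow> mat \<Rightarrow> (int \<times> int \<Rightarrow> int \<times> int \<Rightarrow> tens) \<Rightarrow> tens"
  where "sum2 m n x y g = (\<Sum>p\<in>idx2 m n. \<Sum>q\<in>idx2 m n.
    pm_scale (x (fst p) (snd p) * y (fst q) (snd q)) (g p q))"

lemma sum2_swap: "sum2 m n y x g = sum2 m n x y (\<lambda>p q. g q p)"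
  unfolding sum2_def by (subst sum.swap) (simp only: mult.commute)

lemma sum2_diff: "sum2 m n x y (\<lambda>p q. g p q - h p q) = sum2 m n x y g - sum2 m n x y h"
  and sum2_add: "sum2 m n x y (\<lambda>p q. g p q + h p q) = sum2 m n x y g + sum2 m n x y h"
  by (simp_all add: sum2_def pm.scale_right_diff_distrib pm.scale_right_distrib sum_subtractf sum.distrib)

lemma sum2_scale: "sum2 m n x y (\<lambda>p q. pm_scale c (g p q)) = pm_scale c (sum2 m n x y g)"
  by (simp add: sum2_def pm.scale_sum_right mult.commute)

lemma emb_mult: "emb m n x * emb m n y
    = sum2 m n x y (\<lambda>p q. E (fst p) (snd p) * E (fst q) (snd q))"
  unfolding emb_pairs sum_product sum2_def
  by (simp only: pm_scale_mult_left pm_scale_mult_right pm.scale_scale mult.commute[of "y _ _" "x _ _"])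

lemma emb_mat_mult: "emb m n (mat_mult m n x y)
    = sum2 m n x y (\<lambda>p q. if snd p = fst q then E (fst p) (snd q) else 0)"
proof -
  let ?I = "idx m n"
  have pairs: "(\<Sum>p\<in>idx2 m n. F p) = (\<Sum>i\<in>?I. \<Sum>j\<in>?I. F (i, j))" for F :: "int \<times> int \<Rightarrow> tens"
    by (simp add: sum.cartesian_product split_beta)
  have "sum2 m n x y (\<lambda>p q. if snd p = fst q then E (fst p) (snd q) else 0)
      = (\<Sum>i\<in>?I. \<Sum>j\<in>?I. \<Sum>k\<in>?I. \<Sum>l\<in>?I. pm_scale (x i j * y k l) (if j = k then E i l else 0))"
    by (simp only: sum2_def pairs fst_conv snd_conv)
  also have "\<dots> = (\<Sum>i\<in>?I. \<Sum>j\<in>?I. \<Sum>l\<in>?I. pm_scale (x i j * y j l) (E i l))"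
  proof (rule sum.cong[OF refl], rule sum.cong[OF refl])
    fix i j assume "j \<in> ?I"
    have "(\<Sum>k\<in>?I. \<Sum>l\<in>?I. pm_scale (x i j * y k l) (if j = k then E i l else 0))
        = (\<Sum>l\<in>?I. \<Sum>k\<in>?I. if k = j then pm_scale (x i j * y k l) (E i l) else 0)"
      by (subst sum.swap) (intro sum.cong refl, simp)
    then show "(\<Sum>k\<in>?I. \<Sum>l\<in>?I. pm_scale (x i j * y k l) (if j = k then E i l else 0))
        = (\<Sum>l\<in>?I. pm_scale (x i j * y j l) (E i l))"
      using \<open>j \<in> ?I\<close> by simp
  qed
  also have "\<dots> = (\<Sum>i\<in>?I. \<Sum>l\<in>?I. \<Sum>j\<in>?I. pm_scale (x i j * y j l) (E i l))"
    by (rule sum.cong[OF refl], rule sum.swap)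
  also have "\<dots> = emb m n (mat_mult m n x y)"
    by (simp add: emb_eq mat_mult_def pm.scale_sum_left)
  finally show ?thesis ..
qed

lemma emb_diff_scale: "emb m n (\<lambda>i j. x i j - c * y i j) = emb m n x - pm_scale c (emb m n y)"
  by (simp add: emb_eq pm.scale_left_diff_distrib sum_subtractf pm.scale_sum_right)

text \<open>Both sides are bilinear in the entries. Wherever a product of entries is nonzero,
  homogeneity gives the two matrix units the parities \<open>p\<close> and \<open>q\<close>, so
  their sign is the constant \<open>(- 1) ^ (p * q)\<close>.\<close>

lemma emb_bracket:
  assumes "x \<in> gl_part m n p" "y \<in> gl_part m n q"
  shows "emb m n x * emb m n y - tens_const ((- 1) ^ (p * q)) * (emb m n y * emb m n x)
      - emb m n (superbracket m n p q x y)
    = sum2 m n x y (\<lambda>p q. basic_rel (fst p) (snd p) (fst q) (snd q))"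
proof -
  define s where "s = ((- 1) ^ (p * q) :: complex)"
  have "sum2 m n x y (\<lambda>p q. basic_rel (fst p) (snd p) (fst q) (snd q))
    = sum2 m n x y (\<lambda>p q. E (fst p) (snd p) * E (fst q) (snd q) - pm_scale s (E (fst q) (snd q) * E (fst p) (snd p))
    - (if snd p = fst q then E (fst p) (snd q) else 0) + pm_scale s (if snd q = fst p then E (fst q) (snd p) else 0))"
    unfolding sum2_def
  proof (intro sum.cong refl)
    fix a b :: "int \<times> int"
    have "sg (fst a) (snd a) (fst b) (snd b) = s" if "x (fst a) (snd a) * y (fst b) (snd b) \<noteq> 0"
      using that assms by (simp add: sg_parity gl_part_def s_def)
    then show "pm_scale (x (fst a) (snd a) * y (fst b) (snd b)) (basic_rel (fst a) (snd a) (fst b) (snd b))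
      = pm_scale (x (fst a) (snd a) * y (fst b) (snd b)) (E (fst a) (snd a) * E (fst b) (snd b)
        - pm_scale s (E (fst b) (snd b) * E (fst a) (snd a))
        - (if snd a = fst b then E (fst a) (snd b) else 0) + pm_scale s (if snd b = fst a then E (fst b) (snd a) else 0))"
      by (cases "x (fst a) (snd a) * y (fst b) (snd b) = 0") (auto simp: basic_rel_def)
  qed
  also have "\<dots> = emb m n x * emb m n y - pm_scale s (emb m n y * emb m n x)
      - (emb m n (mat_mult m n x y) - pm_scale s (emb m n (mat_mult m n y x)))"
    unfolding emb_mult emb_mat_mult sum2_add sum2_diff sum2_scale sum2_swap[of m n y x] by simp
  finally show ?thesis
    by (simp add: superbracket_def emb_diff_scale pm_scale_eq_mult s_def)
qed

lemma munit_gl_part: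
  assumes "i \<in> idx m n" "j \<in> idx m n"
  shows "munit i j \<in> gl_part m n ((idx_parity i + idx_parity j) mod 2)"
  using assms by (auto simp: gl_part_def gl_def munit_def)

lemma sum2_munit:
  assumes "i \<in> idx m n" "j \<in> idx m n" "k \<in> idx m n" "l \<in> idx m n"
  shows "sum2 m n (munit i j) (munit k l) g = g (i, j) (k, l)"
proof -
  have "sum2 m n (munit i j) (munit k l) g
    = (\<Sum>p\<in>idx2 m n. if p = (i, j) then (\<Sum>q\<in>idx2 m n. if q = (k, l) then g p q else 0) else 0)"
    unfolding sum2_def by (intro sum.cong refl) (auto simp: munit_def prod_eq_iff intro!: sum.cong sum.neutral)
  also have "\<dots> = g (i, j) (k, l)" using assms by simp
  finally show ?thesis .
qed

lemma basic_rel_env_rels: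
  assumes "i \<in> idx m n" "j \<in> idx m n" "k \<in> idx m n" "l \<in> idx m n"
  shows "basic_rel i j k l \<in> env_rels m n"
proof -
  let ?p = "(idx_parity i + idx_parity j) mod 2" and ?q = "(idx_parity k + idx_parity l) mod 2"
  have "basic_rel i j k l = emb m n (munit i j) * emb m n (munit k l)
      - tens_const ((- 1) ^ (?p * ?q)) * (emb m n (munit k l) * emb m n (munit i j))
      - emb m n (superbracket m n ?p ?q (munit i j) (munit k l))"
    using emb_bracket[OF munit_gl_part munit_gl_part] sum2_munit assms by simp
  moreover have "?p \<in> {0, 1}" "?q \<in> {0, 1}" by auto
  ultimately show ?thesis
    unfolding env_rels_def mem_Collect_eq using munit_gl_part assms
    by (intro exI[of _ ?p] exI[of _ ?q] exI[of _ "munit i j"] exI[of _ "munit k l"] conjI)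
qed

lemma env_rels_span: "env_rels m n \<subseteq> pm.span (rel_gens m n)"
proof
  fix r assume "r \<in> env_rels m n"
  then obtain x y where r: "r = sum2 m n x y (\<lambda>p q. basic_rel (fst p) (snd p) (fst q) (snd q))"
    unfolding env_rels_def using emb_bracket by blast
  have gen: "basic_rel (fst p) (snd p) (fst q) (snd q) \<in> rel_gens m n"
    if "p \<in> idx2 m n" "q \<in> idx2 m n" for p q
  proof -
    have "a * basic_rel i j k l * b \<in> rel_gens m n"
      if "i \<in> idx m n" "j \<in> idx m n" "k \<in> idx m n" "l \<in> idx m n" for a b i j k l
      unfolding rel_gens_def using that by blast
    from this[of "fst p" "snd p" "fst q" "snd q" 1 1] show ?thesis using that by auto
  qed
  show "r \<in> pm.span (rel_gens m n)"
    unfolding r sum2_def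
    by (rule pm.span_sum, rule pm.span_sum, rule pm.span_scale, rule pm.span_base, rule gen)
qed

section \<open>The relation ideal inside the tensor algebra\<close>

definition good_word :: "nat \<Rightarrow> nat \<Rightarrow> (int \<times> int) list \<Rightarrow> bool"
  where "good_word m n w \<longleftrightarrow> set w \<subseteq> idx2 m n"

definition tcar :: "nat \<Rightarrow> nat \<Rightarrow> tens set"
  where "tcar m n = carrier (tensor_alg m n)"

lemma tcar_iff: "p \<in> tcar m n \<longleftrightarrow> (\<forall>w\<in>Poly_Mapping.keys p. good_word m n w)"
  by (simp add: tcar_def tensor_alg_def good_word_def)

lemma tensor_alg_ops [simp]:
  "x \<otimes>\<^bsub>tensor_alg m n\<^esub> y = x * y" "x \<oplus>\<^bsub>tensor_alg m n\<^esub> y = x + y"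
  "\<one>\<^bsub>tensor_alg m n\<^esub> = 1" "\<zero>\<^bsub>tensor_alg m n\<^esub> = 0"
  "carrier (tensor_alg m n) = tcar m n"
  by (simp_all add: tensor_alg_def tcar_def)

lemma tcar_subspace: "pm.subspace (tcar m n)"
proof -
  have "x + y \<in> tcar m n" if "x \<in> tcar m n" "y \<in> tcar m n" for x y
    using that Poly_Mapping.keys_add[of x y] by (auto simp: tcar_iff)
  moreover have "pm_scale c x \<in> tcar m n" if "x \<in> tcar m n" for c x
    using that by (auto simp: tcar_iff in_keys_iff lookup_pm_scale)
  moreover have "0 \<in> tcar m n" by (simp add: tcar_iff)
  ultimately show ?thesis unfolding pm.subspace_def by blast
qed

lemma tcar_mult: "x \<in> tcar m n \<Longrightarrow> y \<in> tcar m n \<Longrightarrow> x * y \<in> tcar m n"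
  using monoid.m_closed[OF ring.is_monoid[OF ring_tensor_alg[of m n]], of x y] by simp

lemmas tcar_closed = pm.subspace_add[OF tcar_subspace] pm.subspace_diff[OF tcar_subspace]
  pm.subspace_scale[OF tcar_subspace] pm.subspace_0[OF tcar_subspace] pm.subspace_neg[OF tcar_subspace]
  pm.subspace_sum[OF tcar_subspace] tcar_mult

lemma tcar_single: "good_word m n w \<Longrightarrow> Poly_Mapping.single w c \<in> tcar m n"
  by (auto simp: tcar_iff)

lemma tcar_const [simp]: "tens_const c \<in> tcar m n"
  unfolding tens_const_def by (rule tcar_single) (simp add: good_word_def)

lemma tcar_1 [simp]: "1 \<in> tcar m n"
  using tcar_const[of 1] by simp

lemma tcar_E: "i \<in> idx m n \<Longrightarrow> j \<in> idx m n \<Longrightarrow> E i j \<in> tcar m n"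
  unfolding E_def by (rule tcar_single) (simp add: good_word_def)

lemma tcar_emb [simp]: "emb m n x \<in> tcar m n"
  unfolding emb_eq by (intro tcar_closed tcar_E)

lemma env_rels_tcar: "env_rels m n \<subseteq> tcar m n"
  unfolding env_rels_def by (auto intro!: tcar_closed)

lemma ideal_env_ideal: "ideal (env_ideal m n) (tensor_alg m n)"
  unfolding env_ideal_def
  by (rule ring.genideal_ideal[OF ring_tensor_alg]) (simp add: env_rels_tcar)

lemma env_ideal_tcar: "env_ideal m n \<subseteq> tcar m n"
  using ideal.Icarr[OF ideal_env_ideal] by auto

lemma env_rels_env_ideal: "env_rels m n \<subseteq> env_ideal m n"
  unfolding env_ideal_def
  by (rule ring.genideal_self[OF ring_tensor_alg]) (simp add: env_rels_tcar)

lemma env_ideal_mult: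
  "x \<in> env_ideal m n \<Longrightarrow> a \<in> tcar m n \<Longrightarrow> a * x \<in> env_ideal m n"
  "x \<in> env_ideal m n \<Longrightarrow> a \<in> tcar m n \<Longrightarrow> x * a \<in> env_ideal m n"
  using ideal.I_l_closed[OF ideal_env_ideal, of x m n a] ideal.I_r_closed[OF ideal_env_ideal, of x m n a]
  by simp_all

lemma env_ideal_subspace: "pm.subspace (env_ideal m n)"
proof -
  interpret ideal "env_ideal m n" "tensor_alg m n" by (rule ideal_env_ideal)
  show ?thesis
    using additive_subgroup.zero_closed[OF is_additive_subgroup]
      additive_subgroup.a_closed[OF is_additive_subgroup] env_ideal_mult(1)[of _ m n "tens_const c" for c]
    by (simp add: pm.subspace_def pm_scale_eq_mult)
qed

text \<open>The span also admits multipliers with letters outside the index set, but its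
  intersection with \<open>tensor_alg\<close> is an ideal there and contains the relations.\<close>

lemma env_ideal_span: "env_ideal m n \<subseteq> pm.span (rel_gens m n)"
proof -
  let ?J = "{p \<in> tcar m n. p \<in> pm.span (rel_gens m n)}"
  have "ideal ?J (tensor_alg m n)"
  proof (rule idealI[OF ring_tensor_alg])
    interpret ring "tensor_alg m n" by (rule ring_tensor_alg)
    show "subgroup ?J (add_monoid (tensor_alg m n))"
    proof (rule add.subgroupI)
      show "?J \<noteq> {}" using pm.span_zero tcar_closed(4) by blast
      fix a assume a: "a \<in> ?J"
      have "\<ominus>\<^bsub>tensor_alg m n\<^esub> a = - a"
        by (rule minus_equality) (use a tcar_closed in auto)
      then show "\<ominus>\<^bsub>tensor_alg m n\<^esub> a \<in> ?J" using a by (auto intro: pm.span_neg tcar_closed)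
    qed (auto intro: pm.span_add tcar_closed)
  next
    fix a x assume "a \<in> ?J" "x \<in> carrier (tensor_alg m n)"
    then show "x \<otimes>\<^bsub>tensor_alg m n\<^esub> a \<in> ?J" "a \<otimes>\<^bsub>tensor_alg m n\<^esub> x \<in> ?J"
      by (auto intro: tcar_mult span_mult_left[OF rel_gens_mult(1)] span_rel_gens_mult_right)
  qed
  then have "env_ideal m n \<subseteq> ?J"
    unfolding env_ideal_def
    by (rule ring.genideal_minimal[OF ring_tensor_alg])
      (use env_rels_tcar[of m n] env_rels_span[of m n] in blast)
  then show ?thesis by auto
qed

lemma env_ideal_verma: "env_ideal m n \<subseteq> verma_ideal m n lam"
  using env_ideal_span span_rel_gens_subset by blast

lemma env_class_eq_set: "env_class m n p = {h + p | h. h \<in> env_ideal m n}"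
  by (auto simp: env_class_def a_r_coset_def')

lemma env_class_self: "p \<in> env_class m n p"
  unfolding env_class_eq_set using pm.subspace_0[OF env_ideal_subspace] by force

lemma env_class_eq_iff: "env_class m n p = env_class m n q \<longleftrightarrow> p - q \<in> env_ideal m n"
proof
  assume "env_class m n p = env_class m n q"
  then have "p \<in> env_class m n q" using env_class_self by metis
  then show "p - q \<in> env_ideal m n" by (auto simp: env_class_eq_set)
next
  assume d: "p - q \<in> env_ideal m n"
  have "h + p \<in> env_class m n q" if "h \<in> env_ideal m n" for h
    unfolding env_class_eq_set using pm.subspace_add[OF env_ideal_subspace that d]
    by (intro CollectI exI[of _ "h + (p - q)"]) simp
  moreover have "h + q \<in> env_class m n p" if "h \<in> env_ideal m n" for h
    unfolding env_class_eq_set using pm.subspace_diff[OF env_ideal_subspace that d]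
    by (intro CollectI exI[of _ "h - (p - q)"]) simp
  ultimately show "env_class m n p = env_class m n q"
    by (auto simp: env_class_eq_set[of m n p] env_class_eq_set[of m n q])
qed

lemma env_ops:
  assumes "p \<in> tcar m n" "q \<in> tcar m n"
  shows env_mult: "env_class m n p \<otimes>\<^bsub>env m n\<^esub> env_class m n q = env_class m n (p * q)"
    and env_add: "env_class m n p \<oplus>\<^bsub>env m n\<^esub> env_class m n q = env_class m n (p + q)"
  using ideal.rcoset_mult_add[OF ideal_env_ideal, of p m n q] ideal.a_rcos_sum[OF ideal_env_ideal, of p m n q] assms
  by (simp_all add: env_def FactRing_def env_class_def)

lemma env_one: "\<one>\<^bsub>env m n\<^esub> = env_class m n 1"
  by (simp add: env_def FactRing_def env_class_def)

lemma carrier_env: "carrier (env m n) = env_class m n ` tcar m n"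
  by (auto simp: env_def FactRing_def env_class_def A_RCOSETS_def')

lemma env_class_carrier [simp]: "p \<in> tcar m n \<Longrightarrow> env_class m n p \<in> carrier (env m n)"
  by (simp add: carrier_env)

section \<open>The Verma module as a quotient of the free algebra\<close>

text \<open>
  \<open>verma_ideal\<close> is a left ideal of the free algebra on all pairs of integers. The algebra endomorphism
  that discards words with letters outside the index set brings it back to \<open>tensor_alg\<close>.
\<close>

definition keep_good :: "nat \<Rightarrow> nat \<Rightarrow> tens \<Rightarrow> tens"
  where "keep_good m n = lext pm_scale (\<lambda>w. if good_word m n w then Poly_Mapping.single w 1 else 0)"

lemma linear_keep_good: "Vector_Spaces.linear pm_scale pm_scale (keep_good m n)"
  unfolding keep_good_def by (rule pmc.linear_lext)

lemmas keep_good_linear = linear_diff_eq[OF linear_keep_good]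

lemma linear_comp:
  assumes "Vector_Spaces.linear s1 s2 f" "Vector_Spaces.linear s2 s3 g"
  shows "Vector_Spaces.linear s1 s3 (\<lambda>x. g (f x))"
  using module_hom_compose[OF assms[THEN Vector_Spaces.linear.axioms(3)]] by (simp add: o_def module_hom_eq_linear)

lemma keep_good_mult: "keep_good m n (p * q) = keep_good m n p * keep_good m n q"
proof (rule pmc.pm_linear_eq[of "\<lambda>p. keep_good m n (p * q)" "\<lambda>p. keep_good m n p * keep_good m n q"])
  fix u :: "(int \<times> int) list"
  show "keep_good m n (Poly_Mapping.single u 1 * q) = keep_good m n (Poly_Mapping.single u 1) * keep_good m n q"
  proof (rule pmc.pm_linear_eq[of "\<lambda>q. keep_good m n (Poly_Mapping.single u 1 * q)"
        "\<lambda>q. keep_good m n (Poly_Mapping.single u 1) * keep_good m n q"])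
    show "Vector_Spaces.linear pm_scale pm_scale (\<lambda>q. keep_good m n (Poly_Mapping.single u 1 * q))"
      by (rule linear_comp[OF linear_mult_left linear_keep_good])
    show "Vector_Spaces.linear pm_scale pm_scale (\<lambda>q. keep_good m n (Poly_Mapping.single u 1) * keep_good m n q)"
      by (rule linear_comp[OF linear_keep_good linear_mult_left])
  qed (auto simp: single_mult_single keep_good_def good_word_def)
qed (rule linear_comp[OF linear_mult_right linear_keep_good] linear_comp[OF linear_keep_good linear_mult_right])+

lemma keep_good_tcar: "keep_good m n p \<in> tcar m n"
  unfolding keep_good_def lext_def by (intro tcar_closed) (auto intro: tcar_single tcar_closed)

lemma keep_good_id: "p \<in> tcar m n \<Longrightarrow> keep_good m n p = p"
  by (subst (2) pm_expand) (auto simp: keep_good_def lext_def tcar_iff intro!: sum.cong)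

section \<open>Comparison of the tensor product with the free algebra\<close>

definition verma_rel :: "nat \<Rightarrow> nat \<Rightarrow> weight \<Rightarrow> pre_tensor set"
  where "verma_rel m n lam = pm.span (ind_rels m n (borel m n) (weight_eval m n lam))"

lemma env_const_mult:
  assumes "a \<in> tcar m n"
  shows "env_const m n c \<otimes>\<^bsub>env m n\<^esub> env_class m n a = env_class m n (pm_scale c a)"
  using assms by (simp add: env_const_def env_mult pm_scale_eq_mult)

lemma env_mat_mult:
  assumes "a \<in> tcar m n"
  shows "env_class m n a \<otimes>\<^bsub>env m n\<^esub> env_mat m n x = env_class m n (a * emb m n x)"
  using assms by (simp add: env_mat_def env_mult)

lemma verma_rel_gens:
  assumes "a \<in> tcar m n"
  shows "b \<in> tcar m n \<Longrightarrow> pt (env_class m n (a + b)) z - pt (env_class m n a) z - pt (env_class m n b) z \<in> verma_rel m n lam"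
    and "pt (env_class m n a) (y + z) - pt (env_class m n a) y - pt (env_class m n a) z \<in> verma_rel m n lam"
    and "pt (env_class m n (pm_scale c a)) z - pm_scale c (pt (env_class m n a) z) \<in> verma_rel m n lam"
    and "pt (env_class m n a) (c * z) - pm_scale c (pt (env_class m n a) z) \<in> verma_rel m n lam"
    and "x \<in> borel m n \<Longrightarrow> pt (env_class m n (a * emb m n x)) z
      - pt (env_class m n a) (weight_eval m n lam x * z) \<in> verma_rel m n lam"
proof -
  let ?u = "env_class m n a"
  have u: "?u \<in> carrier (env m n)" using assms by simp
  show "pt (env_class m n (a + b)) z - pt ?u z - pt (env_class m n b) z \<in> verma_rel m n lam"
    if "b \<in> tcar m n"
    unfolding verma_rel_def ind_rels_def Let_def env_add[OF assms that, symmetric]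
    by (rule pm.span_base, rule UnI1, rule UnI1, rule UnI1, rule UnI1, insert u env_class_carrier[OF that], blast)
  show "pt ?u (y + z) - pt ?u y - pt ?u z \<in> verma_rel m n lam"
    unfolding verma_rel_def ind_rels_def Let_def
    by (rule pm.span_base, rule UnI1, rule UnI1, rule UnI1, rule UnI2, insert u, blast)
  show "pt (env_class m n (pm_scale c a)) z - pm_scale c (pt ?u z) \<in> verma_rel m n lam"
    unfolding verma_rel_def ind_rels_def Let_def env_const_mult[OF assms, symmetric]
    by (rule pm.span_base, rule UnI1, rule UnI1, rule UnI2, insert u, blast)
  show "pt ?u (c * z) - pm_scale c (pt ?u z) \<in> verma_rel m n lam"
    unfolding verma_rel_def ind_rels_def Let_def
    by (rule pm.span_base, rule UnI1, rule UnI2, insert u, blast)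
  show "pt (env_class m n (a * emb m n x)) z - pt ?u (weight_eval m n lam x * z) \<in> verma_rel m n lam"
    if "x \<in> borel m n"
    unfolding verma_rel_def ind_rels_def Let_def env_mat_mult[OF assms, symmetric]
    by (rule pm.span_base, rule UnI2, insert u that, blast)
qed

text \<open>The induction principle for the tensor relations, with classes in the enveloping algebra
  replaced by representatives in the free algebra.\<close>

lemma verma_rel_minimal:
  assumes "pm.subspace S"
    and "\<And>a b z. a \<in> tcar m n \<Longrightarrow> b \<in> tcar m n \<Longrightarrow>
      pt (env_class m n (a + b)) z - pt (env_class m n a) z - pt (env_class m n b) z \<in> S"
    and "\<And>a y z. a \<in> tcar m n \<Longrightarrow>
      pt (env_class m n a) (y + z) - pt (env_class m n a) y - pt (env_class m n a) z \<in> S"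
    and "\<And>a c z. a \<in> tcar m n \<Longrightarrow>
      pt (env_class m n (pm_scale c a)) z - pm_scale c (pt (env_class m n a) z) \<in> S"
    and "\<And>a c z. a \<in> tcar m n \<Longrightarrow>
      pt (env_class m n a) (c * z) - pm_scale c (pt (env_class m n a) z) \<in> S"
    and "\<And>a x z. a \<in> tcar m n \<Longrightarrow> x \<in> borel m n \<Longrightarrow>
      pt (env_class m n (a * emb m n x)) z - pt (env_class m n a) (weight_eval m n lam x * z) \<in> S"
  shows "verma_rel m n lam \<subseteq> S"
  unfolding verma_rel_def
proof (rule pm.span_minimal[OF _ assms(1)])
  show "ind_rels m n (borel m n) (weight_eval m n lam) \<subseteq> S"
    unfolding ind_rels_def Let_def carrier_env
    by (intro Un_least; clarify)
      (simp_all only: env_add env_const_mult env_mat_mult assms(2-6))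
qed

lemma subspace_verma_rel: "pm.subspace (verma_rel m n lam)"
  by (simp add: verma_rel_def)

text \<open>The pure tensor of the class of \<open>p\<close> with 1. As \<open>pt\<close> yields
  formal generators, \<open>tau\<close> is linear only modulo \<open>verma_rel\<close>.\<close>

definition tau :: "nat \<Rightarrow> nat \<Rightarrow> tens \<Rightarrow> pre_tensor"
  where "tau m n p = pt (env_class m n p) 1"

lemma tau_scale:
  "p \<in> tcar m n \<Longrightarrow> tau m n (pm_scale c p) - pm_scale c (tau m n p) \<in> verma_rel m n lam"
  unfolding tau_def by (rule verma_rel_gens(3))

lemma tau_add:
  "p \<in> tcar m n \<Longrightarrow> q \<in> tcar m n \<Longrightarrow> tau m n (p + q) - (tau m n p + tau m n q) \<in> verma_rel m n lam"
  using verma_rel_gens(1)[of p m n q 1 lam] by (simp add: tau_def diff_diff_add)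

lemma tau_diff:
  assumes "p \<in> tcar m n" "q \<in> tcar m n"
  shows "tau m n (p - q) - (tau m n p - tau m n q) \<in> verma_rel m n lam"
proof -
  have "- (tau m n ((p - q) + q) - (tau m n (p - q) + tau m n q)) \<in> verma_rel m n lam"
    by (intro pm.subspace_neg[OF subspace_verma_rel] tau_add tcar_closed assms)
  then show ?thesis by (simp add: algebra_simps)
qed

lemma tau_env_ideal:
  assumes "p \<in> env_ideal m n"
  shows "tau m n p \<in> verma_rel m n lam"
proof -
  have "env_class m n p = env_class m n 0"
    using assms by (simp only: env_class_eq_iff diff_zero)
  then have "tau m n p = tau m n 0"
    by (simp only: tau_def)
  moreover have "- (tau m n (0 + 0) - (tau m n 0 + tau m n 0)) \<in> verma_rel m n lam"
    by (intro pm.subspace_neg[OF subspace_verma_rel] tau_add tcar_closed)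
  ultimately show ?thesis by simp
qed

lemma munit_borel:
  assumes "i \<in> idx m n" "j \<in> idx m n" "i \<le> j"
  shows "munit i j \<in> borel m n"
proof (cases "i = j")
  case True
  then have "munit i j \<in> cartan m n" "(\<lambda>_ _. 0) \<in> n_plus m n"
    using assms by (auto simp: cartan_def n_plus_def gl_def munit_def)
  then show ?thesis unfolding borel_def by force
next
  case False
  then have "munit i j \<in> n_plus m n" "(\<lambda>_ _. 0) \<in> cartan m n"
    using assms by (auto simp: cartan_def n_plus_def gl_def munit_def)
  then show ?thesis unfolding borel_def by force
qed

lemma weight_eval_munit:
  assumes "i \<in> idx m n"
  shows "weight_eval m n lam (munit i j) = (if i = j then lam i else 0)"
proof -
  have "weight_eval m n lam (munit i j) = (\<Sum>k\<in>idx m n. if k = i then (if i = j then lam i else 0) else 0)"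
    unfolding weight_eval_def by (rule sum.cong) (auto simp: munit_def)
  then show ?thesis using assms by simp
qed

text \<open>The relations of the free algebra quotient hold in the tensor product. Multipliers in a
  generator may contain foreign letters; \<open>keep_good\<close> removes these and leaves the
  relation in the middle unchanged.\<close>

lemma tau_verma_ideal:
  assumes "p \<in> verma_ideal m n lam" "p \<in> tcar m n"
  shows "tau m n p \<in> verma_rel m n lam"
proof -
  let ?N = "verma_rel m n lam"
  note N = pm.subspace_add[OF subspace_verma_rel] pm.subspace_scale[OF subspace_verma_rel]
    pm.subspace_diff[OF subspace_verma_rel]
  let ?S = "{p. tau m n (keep_good m n p) \<in> ?N}"
  have "pm.subspace ?S"
    unfolding pm.subspace_def mem_Collect_eq keep_good_linear
  proof (intro conjI ballI allI)
    show "tau m n 0 \<in> ?N" using tau_env_ideal pm.subspace_0[OF env_ideal_subspace] .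
  next
    fix x y assume "x \<in> ?S" "y \<in> ?S"
    then have "(tau m n (keep_good m n x + keep_good m n y) - (tau m n (keep_good m n x) + tau m n (keep_good m n y)))
        + (tau m n (keep_good m n x) + tau m n (keep_good m n y)) \<in> ?N"
      by (intro N tau_add keep_good_tcar) auto
    then show "tau m n (keep_good m n x + keep_good m n y) \<in> ?N" by simp
  next
    fix c x assume "x \<in> ?S"
    then have "(tau m n (pm_scale c (keep_good m n x)) - pm_scale c (tau m n (keep_good m n x)))
        + pm_scale c (tau m n (keep_good m n x)) \<in> ?N"
      by (intro N tau_scale keep_good_tcar) auto
    then show "tau m n (pm_scale c (keep_good m n x)) \<in> ?N" by simp
  qed
  moreover have "rel_gens m n \<union> hw_gens m n lam \<subseteq> ?S"
  proof
    fix x assume "x \<in> rel_gens m n \<union> hw_gens m n lam"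
    then show "x \<in> ?S"
    proof
      assume "x \<in> rel_gens m n"
      then obtain a i j k l b where x: "x = a * basic_rel i j k l * b"
        "i \<in> idx m n" "j \<in> idx m n" "k \<in> idx m n" "l \<in> idx m n"
        unfolding rel_gens_def by blast
      have r: "basic_rel i j k l \<in> env_ideal m n"
        using basic_rel_env_rels[OF x(2-5)] env_rels_env_ideal by blast
      have "keep_good m n x = keep_good m n a * basic_rel i j k l * keep_good m n b"
        using keep_good_id[of "basic_rel i j k l" m n] r env_ideal_tcar[of m n]
        by (auto simp: x keep_good_mult)
      also have "\<dots> \<in> env_ideal m n"
        by (intro env_ideal_mult keep_good_tcar r)
      finally show ?thesis using tau_env_ideal by simp
    next
      assume "x \<in> hw_gens m n lam"
      then obtain a i j where x: "x = a * hw_rel lam i j" "i \<in> idx m n" "j \<in> idx m n" "i \<le> j"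
        unfolding hw_gens_def by blast
      define a' where "a' = keep_good m n a"
      define c where "c = (if i = j then lam i else 0)"
      have a': "a' \<in> tcar m n" "a' * E i j \<in> tcar m n" "pm_scale c a' \<in> tcar m n"
        using keep_good_tcar tcar_E x by (auto simp: a'_def intro!: tcar_closed)
      have "hw_rel lam i j \<in> tcar m n"
        using tcar_E x by (auto simp: hw_rel_def intro!: tcar_closed)
      then have "keep_good m n x = a' * hw_rel lam i j"
        by (simp add: x keep_good_mult keep_good_id a'_def)
      also have "\<dots> = a' * E i j - pm_scale c a'"
        by (simp add: hw_rel_def right_diff_distrib tens_const_central pm_scale_eq_mult c_def)
      finally have k: "keep_good m n x = a' * E i j - pm_scale c a'" .
      have 1: "tau m n (a' * E i j) - pt (env_class m n a') (c * 1) \<in> ?N"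
        using verma_rel_gens(5)[OF a'(1) munit_borel[OF x(2-4)], of 1 lam] x
        by (simp add: emb_munit weight_eval_munit tau_def c_def)
      have 2: "pt (env_class m n a') (c * 1) - pm_scale c (tau m n a') \<in> ?N"
        unfolding tau_def by (rule verma_rel_gens(4)[OF a'(1)])
      \<comment> \<open>A telescoping sum: linearity of \<open>tau\<close>, the relation that moves
        \<open>E i j\<close> across the tensor sign, and the passage of the scalar \<open>c\<close>
        through either factor. Everything but its first term cancels.\<close>
      have "(tau m n (a' * E i j - pm_scale c a') - (tau m n (a' * E i j) - tau m n (pm_scale c a')))
          + (tau m n (a' * E i j) - pt (env_class m n a') (c * 1))
          + (pt (env_class m n a') (c * 1) - pm_scale c (tau m n a'))
          - (tau m n (pm_scale c a') - pm_scale c (tau m n a')) \<in> ?N"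
        by (rule N(3)[OF N(1)[OF N(1)[OF tau_diff[OF a'(2,3)] 1] 2] tau_scale[OF a'(1)]])
      then show ?thesis by (simp add: k)
    qed
  qed
  ultimately have "verma_ideal m n lam \<subseteq> ?S"
    unfolding verma_ideal_def by (rule pm.span_minimal[rotated])
  then show ?thesis using assms by (auto simp: keep_good_id)
qed

definition repr :: "tens set \<Rightarrow> tens"
  where "repr u = (SOME p. p \<in> u)"

text \<open>The map back from formal tensors to normal forms, sending the pair \<open>(u, z)\<close>
  to \<open>z\<close> times the normal form of a representative of \<open>u\<close>.\<close>

definition pre_nf :: "nat \<Rightarrow> nat \<Rightarrow> weight \<Rightarrow> pre_tensor \<Rightarrow> tens"
  where "pre_nf m n lam = lext pm_scale (\<lambda>(u, z). pm_scale z (nf m n lam (repr u)))"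

lemma linear_pre_nf: "Vector_Spaces.linear pm_scale pm_scale (pre_nf m n lam)"
  unfolding pre_nf_def by (rule pmc.linear_lext)

lemmas pre_nf_linear = linear_diff_eq[OF linear_pre_nf]

lemma pre_nf_pt: "pre_nf m n lam (pt (env_class m n a) z) = pm_scale z (nf m n lam a)"
proof -
  have "repr (env_class m n a) \<in> env_class m n a"
    unfolding repr_def by (rule someI) (rule env_class_self)
  then have "repr (env_class m n a) - a \<in> verma_ideal m n lam"
    using env_ideal_verma[of m n lam] by (auto simp: env_class_eq_set)
  then have "nf m n lam (repr (env_class m n a)) = nf m n lam a" by (simp add: nf_eq_iff)
  then show ?thesis by (simp add: pre_nf_def pt_def)
qed

lemma nf_mult_E:
  assumes "i \<in> idx m n" "j \<in> idx m n" "i \<le> j"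
  shows "nf m n lam (a * E i j) = pm_scale (if i = j then lam i else 0) (nf m n lam a)"
proof -
  have "a * hw_rel lam i j \<in> verma_ideal m n lam"
    by (rule verma_ideal_mult) (rule hw_rel_in_ideal[OF assms])
  then have "nf m n lam (a * E i j) = nf m n lam (pm_scale (if i = j then lam i else 0) a)"
    by (simp add: nf_eq_iff hw_rel_def right_diff_distrib tens_const_central pm_scale_eq_mult)
  then show ?thesis by (simp only: nf_linear)
qed

lemma nf_sum: "nf m n lam (sum f A) = (\<Sum>i\<in>A. nf m n lam (f i))"
  using module_hom.sum[OF Vector_Spaces.linear.axioms(3)[OF linear_nf]] .

lemma nf_mult_emb: "nf m n lam (a * emb m n x)
    = (\<Sum>i\<in>idx m n. \<Sum>j\<in>idx m n. pm_scale (x i j) (nf m n lam (a * E i j)))"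
  by (simp add: emb_eq sum_distrib_left nf_sum pm_scale_mult_right nf_linear)

lemma nf_mult_borel:
  assumes "x \<in> borel m n"
  shows "nf m n lam (a * emb m n x) = pm_scale (weight_eval m n lam x) (nf m n lam a)"
proof -
  have up: "x i j = 0" if "\<not> i \<le> j" for i j
  proof -
    obtain h y where x: "x = (\<lambda>i j. h i j + y i j)" "h \<in> cartan m n" "y \<in> n_plus m n"
      using assms unfolding borel_def by blast
    have "h i j = 0" using x(2) that unfolding cartan_def by force
    moreover have "y i j = 0" using x(3) that unfolding n_plus_def by force
    ultimately show ?thesis by (simp add: x(1))
  qed
  have "nf m n lam (a * emb m n x)
      = (\<Sum>i\<in>idx m n. \<Sum>j\<in>idx m n. if j = i then pm_scale (x i i * lam i) (nf m n lam a) else 0)"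
    unfolding nf_mult_emb
  proof (rule sum.cong[OF refl], rule sum.cong[OF refl])
    fix i j assume "i \<in> idx m n" "j \<in> idx m n"
    then show "pm_scale (x i j) (nf m n lam (a * E i j)) = (if j = i then pm_scale (x i i * lam i) (nf m n lam a) else 0)"
      using up[of i j] nf_mult_E[of i m n j lam a] by (cases "i \<le> j") auto
  qed
  also have "\<dots> = (\<Sum>i\<in>idx m n. pm_scale (x i i * lam i) (nf m n lam a))" by simp
  finally show ?thesis by (simp add: weight_eval_def pm.scale_sum_left mult.commute)
qed

lemma pre_nf_verma_rel:
  assumes "P \<in> verma_rel m n lam"
  shows "pre_nf m n lam P = 0"
proof -
  have "verma_rel m n lam \<subseteq> {P. pre_nf m n lam P = 0}"
  proof (rule verma_rel_minimal)
    show "pm.subspace {P. pre_nf m n lam P = 0}"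
      by (simp add: pm.subspace_def pre_nf_linear)
  qed (simp_all add: pre_nf_linear pre_nf_pt nf_linear nf_mult_borel pm.scale_left_distrib
      pm.scale_right_distrib mult.commute)
  then show ?thesis using assms by blast
qed

lemma subspace_pre_ind: "pm.subspace (pre_ind m n)"
proof -
  have "x + y \<in> pre_ind m n" if "x \<in> pre_ind m n" "y \<in> pre_ind m n" for x y
    using that Poly_Mapping.keys_add[of x y] by (auto simp: pre_ind_def)
  moreover have "pm_scale c x \<in> pre_ind m n" if "x \<in> pre_ind m n" for c x
    using that by (auto simp: pre_ind_def in_keys_iff lookup_pm_scale)
  moreover have "0 \<in> pre_ind m n" by (simp add: pre_ind_def)
  ultimately show ?thesis unfolding pm.subspace_def by blast
qed

lemma pt_pre_ind: "u \<in> carrier (env m n) \<Longrightarrow> pt u z \<in> pre_ind m n"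
  by (simp add: pre_ind_def pt_def)

lemma tau_pre_ind: "p \<in> tcar m n \<Longrightarrow> tau m n p \<in> pre_ind m n"
  unfolding tau_def by (rule pt_pre_ind) simp

text \<open>Every formal tensor is congruent to a single pure tensor with second factor 1: scalars
  move to the left factor and sums are collected there.\<close>

lemma pre_ind_tau:
  assumes "P \<in> pre_ind m n"
  shows "\<exists>p\<in>tcar m n. P - tau m n p \<in> verma_rel m n lam"
proof -
  let ?N = "verma_rel m n lam"
  let ?S = "{P. \<exists>p\<in>tcar m n. P - tau m n p \<in> ?N}"
  note N = pm.subspace_add[OF subspace_verma_rel] pm.subspace_scale[OF subspace_verma_rel]
    pm.subspace_diff[OF subspace_verma_rel]
  have S: "pm.subspace ?S"
    unfolding pm.subspace_def
  proof (intro conjI ballI allI)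
    have "0 - tau m n 0 \<in> ?N"
      using pm.subspace_neg[OF subspace_verma_rel tau_env_ideal[OF pm.subspace_0[OF env_ideal_subspace]]]
      by simp
    then show "0 \<in> ?S" using tcar_closed(4) by blast
  next
    fix x y assume "x \<in> ?S" "y \<in> ?S"
    then obtain p q where pq: "p \<in> tcar m n" "q \<in> tcar m n" "x - tau m n p \<in> ?N" "y - tau m n q \<in> ?N"
      by auto
    have "(x - tau m n p) + (y - tau m n q) - (tau m n (p + q) - (tau m n p + tau m n q)) \<in> ?N"
      by (rule N(3)[OF N(1)[OF pq(3,4)] tau_add[OF pq(1,2)]])
    then have "(x + y) - tau m n (p + q) \<in> ?N" by (simp add: algebra_simps)
    then show "x + y \<in> ?S" using pq tcar_closed(1) by blast
  next
    fix c x assume "x \<in> ?S"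
    then obtain p where p: "p \<in> tcar m n" "x - tau m n p \<in> ?N" by auto
    have "pm_scale c (x - tau m n p) - (tau m n (pm_scale c p) - pm_scale c (tau m n p)) \<in> ?N"
      by (rule N(3)[OF N(2)[OF p(2)] tau_scale[OF p(1)]])
    then have "pm_scale c x - tau m n (pm_scale c p) \<in> ?N" by (simp add: pm.scale_right_diff_distrib)
    then show "pm_scale c x \<in> ?S" using p tcar_closed(3) by blast
  qed
  have "Poly_Mapping.single (u, z) 1 \<in> ?S" if u: "u \<in> carrier (env m n)" for u z
  proof -
    obtain a where a: "a \<in> tcar m n" "u = env_class m n a" using u by (auto simp: carrier_env)
    have "(pt u (z * 1) - pm_scale z (pt u 1)) - (tau m n (pm_scale z a) - pm_scale z (tau m n a)) \<in> ?N"
      unfolding a(2) by (rule N(3)[OF verma_rel_gens(4)[OF a(1)] tau_scale[OF a(1)]])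
    then have "pt u z - tau m n (pm_scale z a) \<in> ?N" by (simp add: a tau_def)
    then show ?thesis using a tcar_closed(3) unfolding pt_def by blast
  qed
  then have "Poly_Mapping.single x 1 \<in> ?S" if "x \<in> Poly_Mapping.keys P" for x
    using that assms by (cases x) (auto simp: pre_ind_def)
  then have "(\<Sum>x\<in>Poly_Mapping.keys P. pm_scale (Poly_Mapping.lookup P x) (Poly_Mapping.single x 1)) \<in> ?S"
    by (intro pm.subspace_sum[OF S] pm.subspace_scale[OF S])
  then show ?thesis unfolding pm_expand[symmetric] by blast
qed

lemma pre_act_lext: "pre_act m n u = lext pm_scale (\<lambda>(v, z). pt (u \<otimes>\<^bsub>env m n\<^esub> v) z)"
  by (simp add: pre_act_def lext_def fun_eq_iff split_beta)

lemma linear_pre_act: "Vector_Spaces.linear pm_scale pm_scale (pre_act m n u)"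
  unfolding pre_act_lext by (rule pmc.linear_lext)

lemmas pre_act_linear = linear_diff_eq[OF linear_pre_act]

lemma pre_act_pt: "a \<in> tcar m n \<Longrightarrow> b \<in> tcar m n \<Longrightarrow>
    pre_act m n (env_class m n a) (pt (env_class m n b) z) = pt (env_class m n (a * b)) z"
  by (simp add: pre_act_lext pt_def env_mult)

lemma pre_act_pre_ind:
  assumes "a \<in> tcar m n" "P \<in> pre_ind m n"
  shows "pre_act m n (env_class m n a) P \<in> pre_ind m n"
  unfolding pre_act_def
proof (intro pm.subspace_sum[OF subspace_pre_ind])
  fix x assume "x \<in> Poly_Mapping.keys P"
  then obtain b z where "x = (env_class m n b, z)" "b \<in> tcar m n"
    using assms(2) by (cases x) (auto simp: pre_ind_def carrier_env)
  then show "(case x of (v, z) \<Rightarrow> pm_scale (Poly_Mapping.lookup P (v, z))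
      (pt (env_class m n a \<otimes>\<^bsub>env m n\<^esub> v) z)) \<in> pre_ind m n"
    using assms(1) by (auto simp: env_mult intro!: pm.subspace_scale[OF subspace_pre_ind] pt_pre_ind env_class_carrier tcar_mult)
qed

lemma pre_act_verma_rel:
  assumes "a \<in> tcar m n" "P \<in> verma_rel m n lam"
  shows "pre_act m n (env_class m n a) P \<in> verma_rel m n lam"
proof -
  have "verma_rel m n lam \<subseteq> {P. pre_act m n (env_class m n a) P \<in> verma_rel m n lam}" (is "_ \<subseteq> ?S")
  proof (rule verma_rel_minimal)
    show "pm.subspace ?S"
      using subspace_verma_rel unfolding pm.subspace_def mem_Collect_eq pre_act_linear by blast
  qed (simp_all add: pre_act_linear pre_act_pt assms tcar_closed distrib_left pm_scale_mult_right
      verma_rel_gens flip: mult.assoc)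
  then show ?thesis using assms by blast
qed

text \<open>The vector obtained by applying \<open>p\<close> to the highest weight vector.\<close>

definition mk :: "nat \<Rightarrow> nat \<Rightarrow> weight \<Rightarrow> tens \<Rightarrow> pre_tensor set"
  where "mk m n lam p = ind_equiv m n (borel m n) (weight_eval m n lam) `` {tau m n p}"

context
  fixes m n :: nat and lam :: weight
begin

private abbreviation "cls P \<equiv> ind_equiv m n (borel m n) (weight_eval m n lam) `` {P}"

lemma cls_eq: "P \<in> pre_ind m n \<Longrightarrow> cls P = {Q \<in> pre_ind m n. P - Q \<in> verma_rel m n lam}"
  by (auto simp: ind_equiv_def verma_rel_def)

lemma cls_eq_iff:
  assumes "P \<in> pre_ind m n" "Q \<in> pre_ind m n"
  shows "cls P = cls Q \<longleftrightarrow> P - Q \<in> verma_rel m n lam"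
proof
  assume "cls P = cls Q"
  moreover have "Q \<in> cls Q" using assms pm.subspace_0[OF subspace_verma_rel] by (simp add: cls_eq)
  ultimately have "Q \<in> cls P" by blast
  then show "P - Q \<in> verma_rel m n lam" using cls_eq[OF assms(1)] by blast
next
  assume d: "P - Q \<in> verma_rel m n lam"
  have "P - R \<in> verma_rel m n lam \<longleftrightarrow> Q - R \<in> verma_rel m n lam" for R
    using pm.subspace_add[OF subspace_verma_rel d, of "Q - R"]
      pm.subspace_diff[OF subspace_verma_rel _ d, of "P - R"] by auto
  then show "cls P = cls Q" using assms by (simp add: cls_eq)
qed

lemma carrier_verma: "carrier (verma m n lam) = mk m n lam ` tcar m n"
proof -
  have "cls P \<in> mk m n lam ` tcar m n" if P: "P \<in> pre_ind m n" for P
  proof -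
    obtain p where "p \<in> tcar m n" "P - tau m n p \<in> verma_rel m n lam"
      using pre_ind_tau[OF P, of lam] by auto
    then show ?thesis using cls_eq_iff[OF P tau_pre_ind] by (auto simp: mk_def)
  qed
  moreover have "mk m n lam p \<in> (\<lambda>P. cls P) ` pre_ind m n" if "p \<in> tcar m n" for p
    unfolding mk_def by (rule imageI) (rule tau_pre_ind[OF that])
  moreover have "carrier (verma m n lam) = (\<lambda>P. cls P) ` pre_ind m n"
    by (auto simp: verma_def induced_def Let_def quotient_def)
  ultimately show ?thesis by (auto del: imageE intro!: equalityI elim!: imageE)
qed

lemma mk_carrier [simp]: "p \<in> tcar m n \<Longrightarrow> mk m n lam p \<in> carrier (verma m n lam)"
  by (simp add: carrier_verma)

text \<open>The bridge between the two realisations: \<open>pre_nf\<close> is well defined on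
  classes, and conversely \<open>tau\<close> maps the left ideal into the tensor relations.\<close>

lemma mk_eq_iff:
  assumes "p \<in> tcar m n" "q \<in> tcar m n"
  shows "mk m n lam p = mk m n lam q \<longleftrightarrow> nf m n lam p = nf m n lam q"
proof -
  let ?N = "verma_rel m n lam"
  have eq: "mk m n lam p = mk m n lam q \<longleftrightarrow> tau m n p - tau m n q \<in> ?N"
    unfolding mk_def using assms by (intro cls_eq_iff tau_pre_ind)
  show ?thesis
    unfolding eq
  proof
    assume "tau m n p - tau m n q \<in> ?N"
    then have "pre_nf m n lam (tau m n p - tau m n q) = 0" by (rule pre_nf_verma_rel)
    then show "nf m n lam p = nf m n lam q" by (simp add: pre_nf_linear tau_def pre_nf_pt)
  next
    assume "nf m n lam p = nf m n lam q"
    then have "tau m n (p - q) \<in> ?N"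
      unfolding nf_eq_iff by (intro tau_verma_ideal tcar_closed assms)
    then have "tau m n (p - q) - (tau m n (p - q) - (tau m n p - tau m n q)) \<in> ?N"
      by (intro pm.subspace_diff[OF subspace_verma_rel] tau_diff assms)
    then show "tau m n p - tau m n q \<in> ?N" by simp
  qed
qed

lemma mk_add:
  assumes "p \<in> tcar m n" "q \<in> tcar m n"
  shows "mk m n lam p \<oplus>\<^bsub>verma m n lam\<^esub> mk m n lam q = mk m n lam (p + q)"
proof -
  have *: "cls (P + Q) = mk m n lam (p + q)" if "P \<in> mk m n lam p" "Q \<in> mk m n lam q" for P Q
  proof -
    have PQ: "P \<in> pre_ind m n" "tau m n p - P \<in> verma_rel m n lam"
      "Q \<in> pre_ind m n" "tau m n q - Q \<in> verma_rel m n lam"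
      using that assms tau_pre_ind by (auto simp: mk_def cls_eq)
    then have "(tau m n (p + q) - (tau m n p + tau m n q)) + (tau m n p - P) + (tau m n q - Q) \<in> verma_rel m n lam"
      by (intro pm.subspace_add[OF subspace_verma_rel] tau_add assms)
    then have "tau m n (p + q) - (P + Q) \<in> verma_rel m n lam" by (simp add: algebra_simps)
    then have "cls (tau m n (p + q)) = cls (P + Q)"
      using PQ assms by (subst cls_eq_iff) (auto intro!: tau_pre_ind tcar_closed pm.subspace_add[OF subspace_pre_ind])
    then show ?thesis by (simp add: mk_def)
  qed
  \<comment> \<open>The unions in the module operations run over constant families; nonempty index
    sets make them equal to the common value.\<close>
  have ne: "tau m n r \<in> mk m n lam r" if "r \<in> tcar m n" for r
    using that tau_pre_ind[OF that] pm.subspace_0[OF subspace_verma_rel] by (simp add: mk_def cls_eq)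
  have "mk m n lam p \<oplus>\<^bsub>verma m n lam\<^esub> mk m n lam q = (\<Union>P\<in>mk m n lam p. \<Union>Q\<in>mk m n lam q. cls (P + Q))"
    by (simp add: verma_def induced_def Let_def)
  also have "\<dots> = (\<Union>P\<in>mk m n lam p. \<Union>Q\<in>mk m n lam q. mk m n lam (p + q))"
    using * by simp
  also have "\<dots> = mk m n lam (p + q)" using ne assms by blast
  finally show ?thesis .
qed

lemma mk_smult:
  assumes "a \<in> tcar m n" "p \<in> tcar m n"
  shows "env_class m n a \<odot>\<^bsub>verma m n lam\<^esub> mk m n lam p = mk m n lam (a * p)"
proof -
  have *: "cls (pre_act m n (env_class m n a) P) = mk m n lam (a * p)" if "P \<in> mk m n lam p" for P
  proof -
    have P: "P \<in> pre_ind m n" "tau m n p - P \<in> verma_rel m n lam"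
      using that assms tau_pre_ind by (auto simp: mk_def cls_eq)
    then have "pre_act m n (env_class m n a) (tau m n p - P) \<in> verma_rel m n lam"
      using pre_act_verma_rel assms by blast
    then have "tau m n (a * p) - pre_act m n (env_class m n a) P \<in> verma_rel m n lam"
      using assms by (simp add: pre_act_linear tau_def pre_act_pt)
    then have "cls (tau m n (a * p)) = cls (pre_act m n (env_class m n a) P)"
      using P assms by (subst cls_eq_iff) (auto intro!: tau_pre_ind tcar_closed pre_act_pre_ind)
    then show ?thesis by (simp add: mk_def)
  qed
  have "tau m n p \<in> mk m n lam p"
    using tau_pre_ind[OF assms(2)] pm.subspace_0[OF subspace_verma_rel] by (simp add: mk_def cls_eq)
  then have "(\<Union>P\<in>mk m n lam p. cls (pre_act m n (env_class m n a) P)) = mk m n lam (a * p)"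
    using * by blast
  then show ?thesis by (simp add: verma_def induced_def Let_def)
qed

lemma mk_zero: "\<zero>\<^bsub>verma m n lam\<^esub> = mk m n lam 0"
proof -
  have "tau m n 0 \<in> verma_rel m n lam"
    by (rule tau_env_ideal) (rule pm.subspace_0[OF env_ideal_subspace])
  then have "cls (tau m n 0) = cls 0"
    by (subst cls_eq_iff) (auto intro!: tau_pre_ind tcar_closed pm.subspace_0[OF subspace_pre_ind])
  then show ?thesis by (simp add: verma_def induced_def Let_def mk_def)
qed

lemma mk_hw: "verma_hw m n lam = mk m n lam 1"
  by (simp add: verma_hw_def mk_def tau_def env_one)

end

section \<open>Primitive vectors and homomorphisms\<close>

lemma nf_emb_mult: "nf m n lam (emb m n x * p)
    = (\<Sum>i\<in>idx m n. \<Sum>j\<in>idx m n. pm_scale (x i j) (nf_e m n lam i j (nf m n lam p)))"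
  by (simp add: emb_eq sum_distrib_right nf_sum pm_scale_mult_left nf_linear nf_e_def nf_mult_nf)

lemma nf_const_mult: "nf m n lam (tens_const c * p) = pm_scale c (nf m n lam p)"
  by (simp only: pm_scale_eq_mult[symmetric] nf_linear)

definition primitive :: "nat \<Rightarrow> nat \<Rightarrow> weight \<Rightarrow> weight \<Rightarrow> tens \<Rightarrow> bool"
  where "primitive m n lam mu p \<longleftrightarrow> p \<in> tcar m n
    \<and> (\<forall>i\<in>idx m n. \<forall>j\<in>idx m n. i < j \<longrightarrow> nf_e m n lam i j (nf m n lam p) = 0)
    \<and> (\<forall>i\<in>idx m n. nf_e m n lam i i (nf m n lam p) = pm_scale (mu i) (nf m n lam p))"

lemma raised_to_zero_iff:
  assumes "p \<in> tcar m n"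
  shows "(\<forall>x\<in>n_plus m n. env_mat m n x \<odot>\<^bsub>verma m n lam\<^esub> mk m n lam p = \<zero>\<^bsub>verma m n lam\<^esub>)
    \<longleftrightarrow> (\<forall>i\<in>idx m n. \<forall>j\<in>idx m n. i < j \<longrightarrow> nf_e m n lam i j (nf m n lam p) = 0)"
proof -
  have eq: "env_mat m n x \<odot>\<^bsub>verma m n lam\<^esub> mk m n lam p = \<zero>\<^bsub>verma m n lam\<^esub> \<longleftrightarrow> nf m n lam (emb m n x * p) = 0" for x
    using assms by (simp add: env_mat_def mk_smult mk_zero mk_eq_iff tcar_closed nf_linear)
  show ?thesis
    unfolding eq
  proof (intro iffI ballI impI)
    fix i j assume *: "\<forall>x\<in>n_plus m n. nf m n lam (emb m n x * p) = 0" "i \<in> idx m n" "j \<in> idx m n" "i < j"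
    then have "munit i j \<in> n_plus m n" by (auto simp: n_plus_def gl_def munit_def)
    then show "nf_e m n lam i j (nf m n lam p) = 0"
      using * emb_munit[of i m n j] by (auto simp: nf_e_def nf_mult_nf)
  next
    fix x assume *: "\<forall>i\<in>idx m n. \<forall>j\<in>idx m n. i < j \<longrightarrow> nf_e m n lam i j (nf m n lam p) = 0" "x \<in> n_plus m n"
    show "nf m n lam (emb m n x * p) = 0"
      unfolding nf_emb_mult
    proof (rule sum.neutral, rule ballI, rule sum.neutral, rule ballI)
      fix i j assume "i \<in> idx m n" "j \<in> idx m n"
      then show "pm_scale (x i j) (nf_e m n lam i j (nf m n lam p)) = 0"
        using * by (cases "i < j") (auto simp: n_plus_def)
    qed
  qed
qed

lemma has_weight_iff:
  assumes "p \<in> tcar m n"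
  shows "has_weight m n (verma m n lam) mu (mk m n lam p)
    \<longleftrightarrow> (\<forall>i\<in>idx m n. nf_e m n lam i i (nf m n lam p) = pm_scale (mu i) (nf m n lam p))"
proof -
  have eq: "env_mat m n h \<odot>\<^bsub>verma m n lam\<^esub> mk m n lam p
      = env_const m n (weight_eval m n mu h) \<odot>\<^bsub>verma m n lam\<^esub> mk m n lam p
    \<longleftrightarrow> nf m n lam (emb m n h * p) = pm_scale (weight_eval m n mu h) (nf m n lam p)" for h
    using assms by (simp add: env_mat_def env_const_def mk_smult mk_eq_iff tcar_closed nf_const_mult)
  have "(\<forall>h\<in>cartan m n. nf m n lam (emb m n h * p) = pm_scale (weight_eval m n mu h) (nf m n lam p))
    \<longleftrightarrow> (\<forall>i\<in>idx m n. nf_e m n lam i i (nf m n lam p) = pm_scale (mu i) (nf m n lam p))"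
  proof (intro iffI ballI)
    fix i assume *: "\<forall>h\<in>cartan m n. nf m n lam (emb m n h * p) = pm_scale (weight_eval m n mu h) (nf m n lam p)"
      and i: "i \<in> idx m n"
    then have "munit i i \<in> cartan m n" by (auto simp: cartan_def gl_def munit_def)
    then show "nf_e m n lam i i (nf m n lam p) = pm_scale (mu i) (nf m n lam p)"
      using * i emb_munit[of i m n i] weight_eval_munit[of i m n mu i] by (auto simp: nf_e_def nf_mult_nf)
  next
    fix h assume *: "\<forall>i\<in>idx m n. nf_e m n lam i i (nf m n lam p) = pm_scale (mu i) (nf m n lam p)"
      and h: "h \<in> cartan m n"
    have "nf m n lam (emb m n h * p)
      = (\<Sum>i\<in>idx m n. \<Sum>j\<in>idx m n. if j = i then pm_scale (h i i * mu i) (nf m n lam p) else 0)"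
      unfolding nf_emb_mult
    proof (rule sum.cong[OF refl], rule sum.cong[OF refl])
      fix i j assume "i \<in> idx m n" "j \<in> idx m n"
      then show "pm_scale (h i j) (nf_e m n lam i j (nf m n lam p))
          = (if j = i then pm_scale (h i i * mu i) (nf m n lam p) else 0)"
        using * h by (cases "j = i") (auto simp: cartan_def)
    qed
    also have "\<dots> = (\<Sum>i\<in>idx m n. pm_scale (h i i * mu i) (nf m n lam p))" by simp
    finally show "nf m n lam (emb m n h * p) = pm_scale (weight_eval m n mu h) (nf m n lam p)"
      by (simp add: weight_eval_def pm.scale_sum_left mult.commute)
  qed
  then show ?thesis unfolding has_weight_def eq using assms by simp
qed

lemma singular_weight_iff:
  assumes "p \<in> tcar m n"
  shows "singular m n (verma m n lam) (mk m n lam p) \<and> has_weight m n (verma m n lam) mu (mk m n lam p)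
    \<longleftrightarrow> nf m n lam p \<noteq> 0 \<and> primitive m n lam mu p"
  unfolding singular_def raised_to_zero_iff[OF assms] has_weight_iff[OF assms] primitive_def
  using assms by (auto simp: mk_zero mk_eq_iff tcar_closed nf_linear)

text \<open>This makes right multiplication by \<open>q\<close> well defined as a map from the Verma
  module of weight \<open>mu\<close> to that of weight \<open>lam\<close>.\<close>

lemma verma_ideal_primitive:
  assumes q: "primitive m n lam mu q" and p: "p \<in> verma_ideal m n mu"
  shows "p * q \<in> verma_ideal m n lam"
proof -
  have "verma_ideal m n mu \<subseteq> {p. p * q \<in> verma_ideal m n lam}"
    unfolding verma_ideal_def[of m n mu]
  proof (rule pm.span_minimal)
    show "pm.subspace {p. p * q \<in> verma_ideal m n lam}"
      using subspace_verma_ideal[of m n lam]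
      by (simp add: pm.subspace_def distrib_right pm_scale_mult_left)
    have "a * basic_rel i j k l * b * q \<in> verma_ideal m n lam"
      if "i \<in> idx m n" "j \<in> idx m n" "k \<in> idx m n" "l \<in> idx m n" for a b i j k l
      unfolding mult.assoc by (intro verma_ideal_mult basic_rel_in_ideal that)
    moreover have "a * hw_rel mu i j * q \<in> verma_ideal m n lam"
      if "i \<in> idx m n" "j \<in> idx m n" "i \<le> j" for a i j
    proof -
      have "nf_e m n lam i j (nf m n lam q) = pm_scale (if i = j then mu i else 0) (nf m n lam q)"
        using q that by (auto simp: primitive_def)
      then have "nf m n lam (hw_rel mu i j * q) = 0"
        by (simp add: hw_rel_def left_diff_distrib nf_linear nf_e_def nf_mult_nf flip: pm_scale_eq_mult)
      then show ?thesis unfolding mult.assoc nf_eq_0_iff by (rule verma_ideal_mult)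
    qed
    ultimately show "rel_gens m n \<union> hw_gens m n mu \<subseteq> {p. p * q \<in> verma_ideal m n lam}"
      by (auto simp: rel_gens_def hw_gens_def)
  qed
  then show ?thesis using p by auto
qed

lemma primitive_scale:
  assumes "primitive m n lam mu q"
  shows "primitive m n lam mu (pm_scale c q)"
  using assms
  by (auto simp: primitive_def nf_linear nf_e_def nf_mult_nf pm_scale_mult_right tcar_closed mult.commute)

text \<open>A homomorphism is determined by the image of the highest weight vector, which is
  primitive and so lies on the line through \<open>q\<close>. Conversely each multiple of
  \<open>q\<close> defines a homomorphism by right multiplication.\<close>

lemma Hom_g_bij:
  assumes q0: "primitive m n lam mu q" "nf m n lam q \<noteq> 0"
    and uniq: "\<And>p. primitive m n lam mu p \<Longrightarrow> \<exists>c. nf m n lam p = pm_scale c (nf m n lam q)"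
  defines "M \<equiv> verma m n lam" and "M' \<equiv> verma m n mu"
  shows "\<exists>\<Phi> :: complex \<Rightarrow> pre_tensor set \<Rightarrow> pre_tensor set.
    bij_betw \<Phi> UNIV (Hom_g m n M' M)
    \<and> (\<forall>c d. \<forall>x\<in>carrier M'. \<Phi> (c + d) x = \<Phi> c x \<oplus>\<^bsub>M\<^esub> \<Phi> d x)
    \<and> (\<forall>c d. \<forall>x\<in>carrier M'. \<Phi> (c * d) x = env_const m n c \<odot>\<^bsub>M\<^esub> \<Phi> d x)"
proof -
  \<comment> \<open>The argument of the homomorphism is a class, so a representative is chosen; the
    value does not depend on it, by \<open>verma_ideal_primitive\<close>.\<close>
  define pick where "pick = (\<lambda>X. SOME p. p \<in> tcar m n \<and> mk m n mu p = X)"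
  define \<Phi> where "\<Phi> = (\<lambda>c. \<lambda>X\<in>carrier M'. mk m n lam (pick X * pm_scale c q))"
  have q: "q \<in> tcar m n" using q0 by (simp add: primitive_def)
  have \<Phi>: "\<Phi> c (mk m n mu p) = mk m n lam (p * pm_scale c q)" if p: "p \<in> tcar m n" for c p
  proof -
    let ?p = "pick (mk m n mu p)"
    have pp: "?p \<in> tcar m n \<and> mk m n mu ?p = mk m n mu p"
      unfolding pick_def by (rule someI[of _ p]) (simp add: p)
    then have "nf m n mu ?p = nf m n mu p" using mk_eq_iff p by blast
    then have "?p - p \<in> verma_ideal m n mu" by (simp only: nf_eq_iff)
    then have "(?p - p) * pm_scale c q \<in> verma_ideal m n lam"
      by (rule verma_ideal_primitive[OF primitive_scale[OF q0(1)]])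
    then have "mk m n lam (?p * pm_scale c q) = mk m n lam (p * pm_scale c q)"
      using p pp q by (simp add: mk_eq_iff nf_eq_iff tcar_closed left_diff_distrib)
    then show ?thesis using p by (simp add: \<Phi>_def M'_def)
  qed
  have hom: "\<Phi> c \<in> Hom_g m n M' M" for c
    unfolding Hom_g_def
  proof (intro CollectI conjI ballI)
    show "\<Phi> c \<in> carrier M' \<rightarrow>\<^sub>E carrier M"
    proof (rule PiE_I)
      fix X assume "X \<in> carrier M'"
      then obtain p where p: "p \<in> tcar m n" "X = mk m n mu p" by (auto simp: M'_def carrier_verma)
      show "\<Phi> c X \<in> carrier M"
        unfolding p(2) \<Phi>[OF p(1)] M_def by (intro mk_carrier tcar_closed p q)
    qed (simp add: \<Phi>_def)
  next
    fix X Y assume "X \<in> carrier M'" "Y \<in> carrier M'"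
    then obtain p r where p: "p \<in> tcar m n" "X = mk m n mu p" "r \<in> tcar m n" "Y = mk m n mu r"
      by (auto simp: M'_def carrier_verma)
    then show "\<Phi> c (X \<oplus>\<^bsub>M'\<^esub> Y) = \<Phi> c X \<oplus>\<^bsub>M\<^esub> \<Phi> c Y"
      using q by (simp add: M_def M'_def mk_add \<Phi> tcar_closed distrib_right)
  next
    fix u X assume "u \<in> carrier (env m n)" "X \<in> carrier M'"
    then obtain a p where p: "a \<in> tcar m n" "u = env_class m n a" "p \<in> tcar m n" "X = mk m n mu p"
      by (auto simp: M'_def carrier_verma carrier_env)
    then show "\<Phi> c (u \<odot>\<^bsub>M'\<^esub> X) = u \<odot>\<^bsub>M\<^esub> \<Phi> c X"
      using q by (simp add: M_def M'_def mk_smult \<Phi> tcar_closed mult.assoc)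
  qed
  have "inj \<Phi>"
  proof
    fix c d assume "\<Phi> c = \<Phi> d"
    then have "mk m n lam (1 * pm_scale c q) = mk m n lam (1 * pm_scale d q)"
      by (simp only: \<Phi>[OF tcar_1, symmetric])
    then show "c = d" using q q0(2) by (simp add: mk_eq_iff tcar_closed nf_linear)
  qed
  moreover have "f \<in> range \<Phi>" if f: "f \<in> Hom_g m n M' M" for f
  proof -
    have fc: "f X \<in> carrier M" if "X \<in> carrier M'" for X using f that by (auto simp: Hom_g_def)
    obtain r where r: "r \<in> tcar m n" "f (mk m n mu 1) = mk m n lam r"
      using fc[of "mk m n mu 1"] by (auto simp: M_def M'_def carrier_verma)
    have fp: "f (mk m n mu p) = mk m n lam (p * r)" if p: "p \<in> tcar m n" for p
    proof -
      have "f (env_class m n p \<odot>\<^bsub>M'\<^esub> mk m n mu 1) = env_class m n p \<odot>\<^bsub>M\<^esub> f (mk m n mu 1)"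
        using f p by (auto simp: Hom_g_def M'_def)
      then show ?thesis using p r by (simp add: M_def M'_def mk_smult)
    qed
    have hw: "nf m n lam (E i j * r) = pm_scale (if i = j then mu i else 0) (nf m n lam r)"
      if ij: "i \<in> idx m n" "j \<in> idx m n" "i \<le> j" for i j
    proof -
      let ?c = "if i = j then mu i else 0"
      have "mk m n mu (E i j) = mk m n mu (tens_const ?c)"
        using hw_rel_in_ideal[OF ij, of mu] ij by (simp add: mk_eq_iff tcar_E nf_eq_iff hw_rel_def)
      then have "mk m n lam (E i j * r) = mk m n lam (tens_const ?c * r)"
        using ij fp[of "E i j"] fp[of "tens_const ?c"] by (simp add: tcar_E)
      then have "nf m n lam (E i j * r) = nf m n lam (pm_scale ?c r)"
        unfolding pm_scale_eq_mult using ij r by (subst (asm) mk_eq_iff) (auto intro!: tcar_closed tcar_E)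
      then show ?thesis by (simp only: nf_linear)
    qed
    have "primitive m n lam mu r"
      unfolding primitive_def nf_e_def nf_mult_nf using r hw by auto
    then obtain c where c: "nf m n lam r = pm_scale c (nf m n lam q)" using uniq by blast
    have "f = \<Phi> c"
    proof
      fix X
      show "f X = \<Phi> c X"
      proof (cases "X \<in> carrier M'")
        case True
        then obtain p where p: "p \<in> tcar m n" "X = mk m n mu p" by (auto simp: M'_def carrier_verma)
        have "nf m n lam (p * r) = nf m n lam (p * pm_scale c q)"
          using nf_mult_nf[of m n lam p r] nf_mult_nf[of m n lam p "pm_scale c q"] c by (simp add: nf_linear)
        then show ?thesis
          unfolding p(2) fp[OF p(1)] \<Phi>[OF p(1)] using p(1) r(1) q by (simp only: mk_eq_iff tcar_closed)
      next
        case False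
        have "f \<in> carrier M' \<rightarrow>\<^sub>E carrier M" using f unfolding Hom_g_def by blast
        then have "f X = undefined" using False by (rule PiE_arb)
        then show ?thesis using False by (simp add: \<Phi>_def)
      qed
    qed
    then show ?thesis by blast
  qed
  ultimately have "bij_betw \<Phi> UNIV (Hom_g m n M' M)"
    using hom by (auto simp: bij_betw_def)
  moreover have "\<Phi> (c + d) X = \<Phi> c X \<oplus>\<^bsub>M\<^esub> \<Phi> d X" "\<Phi> (c * d) X = env_const m n c \<odot>\<^bsub>M\<^esub> \<Phi> d X"
    if X: "X \<in> carrier M'" for c d X
  proof -
    obtain p where p: "p \<in> tcar m n" "X = mk m n mu p" using X by (auto simp: M'_def carrier_verma)
    show "\<Phi> (c + d) X = \<Phi> c X \<oplus>\<^bsub>M\<^esub> \<Phi> d X"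
      using p q by (simp add: \<Phi> M_def mk_add tcar_closed distrib_left pm.scale_left_distrib)
    have "p * pm_scale (c * d) q = tens_const c * (p * pm_scale d q)"
      by (simp add: pm_scale_mult_right flip: pm_scale_eq_mult)
    then show "\<Phi> (c * d) X = env_const m n c \<odot>\<^bsub>M\<^esub> \<Phi> d X"
      using p q by (simp add: \<Phi> M_def env_const_def mk_smult tcar_closed)
  qed
  ultimately show ?thesis by blast
qed

section \<open>The singular vector\<close>

lemma E_set_chain: "E_set s t J = Poly_Mapping.single (chain (- int s) J (int t)) 1"
proof -
  \<comment> \<open>With \<open>L = js @ [t]\<close> and \<open>x\<close> the start, the list of
    columns in \<open>E_set\<close> is \<open>butlast (x # L)\<close>; this form admits induction on
    \<open>L\<close>.\<close>
  have "prod_list (rev (map2 E L (butlast (x # L)))) = Poly_Mapping.single (edges (x # L)) 1" for x L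
  proof (induction L arbitrary: x)
    case Nil
    show ?case by (simp add: single_one[symmetric] zero_list_def del: single_one)
  next
    case (Cons y l)
    then show ?case by (simp add: E_def single_mult_single)
  qed
  from this[of "sorted_list_of_set J @ [int t]" "- int s"] show ?thesis
    by (simp add: E_set_def chain_def Let_def butlast_append)
qed

lemma nf_single:
  "gl_rep.wact (nf_e m n lam) w (nf m n lam 1) = nf m n lam (Poly_Mapping.single w 1)"
proof -
  interpret gl_hw pm_scale m n "nf_e m n lam" lam "nf m n lam 1" by (rule gl_hw_nf)
  show ?thesis
  proof (induction w)
    case Nil
    show ?case by (simp add: single_one[symmetric] zero_list_def del: single_one)
  next
    case (Cons p w)
    obtain i j where p: "p = (i, j)" by (cases p)
    have "wact (p # w) (nf m n lam 1) = nf_e m n lam i j (nf m n lam (Poly_Mapping.single w 1))"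
      by (simp add: p Cons)
    also have "\<dots> = nf m n lam (Poly_Mapping.single (p # w) 1)"
      by (simp add: nf_e_def nf_mult_nf E_def single_mult_single p)
    finally show ?case .
  qed
qed

text \<open>Apply an element of the free algebra to the oscillator vacuum and read the coefficient
  at the monomial of \<open>w\<close>. Since the left ideal acts on the vacuum by zero, taking
  normal forms does not change the value.\<close>

definition coord :: "nat \<Rightarrow> nat \<Rightarrow> weight \<Rightarrow> (int \<times> int) list \<Rightarrow> tens \<Rightarrow> complex"
  where "coord m n lam w f = gl_rep.act fscale (osc m n (osc_shift m n lam)) f vac (word_occ w)"

lemma coord:
  shows coord_add: "coord m n lam w (f + g) = coord m n lam w f + coord m n lam w g"
    and coord_scale: "coord m n lam w (pm_scale c f) = c * coord m n lam w f"
    and coord_wact: "decreasing_word m n w \<Longrightarrow> decreasing_word m n w' \<Longrightarrow>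
      coord m n lam w (gl_rep.wact (nf_e m n lam) w' (nf m n lam 1)) \<noteq> 0 \<longleftrightarrow> w = w'"
proof -
  let ?o = "osc m n (osc_shift m n lam)"
  interpret gl_hw fscale m n ?o lam vac by (rule gl_hw_osc)
  show "coord m n lam w (f + g) = coord m n lam w f + coord m n lam w g"
    "coord m n lam w (pm_scale c f) = c * coord m n lam w f"
    by (simp_all add: coord_def act_linear)
  have "act (nf m n lam p - p) vac = 0" for p
    by (rule act_verma_ideal) (rule nf_diff_mem)
  then have "act (nf m n lam p) vac = act p vac" for p by (simp add: act_linear)
  then have "coord m n lam w (gl_rep.wact (nf_e m n lam) w' (nf m n lam 1)) = wact w' vac (word_occ w)"
    by (simp add: coord_def nf_single act_single)
  then show "coord m n lam w (gl_rep.wact (nf_e m n lam) w' (nf m n lam 1)) \<noteq> 0 \<longleftrightarrow> w = w'"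
    if "decreasing_word m n w" "decreasing_word m n w'"
    using wact_word_occ[OF that(2,1), of "osc_shift m n lam"] by auto
qed

lemma decreasing_chain:
  assumes "a \<in> idx m n" "b \<in> idx m n" "a < b" "J \<subseteq> ivl m n a b"
  shows "decreasing_word m n (chain a J b)"
proof -
  have "finite J" by (rule finite_subset[OF assms(4) finite_ivl])
  then show ?thesis
    unfolding chain_def using assms strict_sorted_list_of_set[of J]
    by (intro decreasing_edges) (auto simp: ivl_def sorted_wrt_append)
qed

text \<open>The full subset has the empty product 1 as its coefficient in \<open>S\<close>. Hence
  \<open>S\<close> is nonzero even if all other coefficients vanish, and subtracting a suitable
  multiple of \<open>S\<close> from any primitive vector cancels its full coefficient, so that
  \<open>chain_coeffs_vanish\<close> applies.\<close>

lemma sing_unique: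
  assumes ab: "a \<in> idx m n" "a < 0" "b \<in> idx m n" "a < b" and cf: "cf lam a b = 0"
  defines "S \<equiv> gl_hw.sing pm_scale m n (nf_e m n lam) lam (nf m n lam 1) a b"
    and "mu \<equiv> \<lambda>i. lam i + of_bool (i = b) - of_bool (i = a)"
  shows "S \<noteq> 0"
    and "\<And>i j. i \<in> idx m n \<Longrightarrow> j \<in> idx m n \<Longrightarrow> i < j \<Longrightarrow> nf_e m n lam i j S = 0"
    and "\<And>i. i \<in> idx m n \<Longrightarrow> nf_e m n lam i i S = pm_scale (mu i) S"
    and "primitive m n lam mu p \<Longrightarrow> \<exists>c. nf m n lam p = pm_scale c S"
proof -
  interpret gl_hw pm_scale m n "nf_e m n lam" lam "nf m n lam 1" by (rule gl_hw_nf)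
  let ?V = "ivl m n a b" and ?v = "nf m n lam 1"
  let ?d = "\<lambda>J. \<Prod>k\<in>?V - J. cf lam a k"
  have S: "S = (\<Sum>J\<in>Pow ?V. pm_scale (?d J) (wact (chain a J b) ?v))"
    using ab by (simp add: S_def sing_def)
  have coord_sum: "coord m n lam w (sum g A) = (\<Sum>x\<in>A. coord m n lam w (g x))" for w A and g :: "int set \<Rightarrow> tens"
  proof -
    have "coord m n lam w 0 = 0" using coord_scale[of m n lam w 0 0] by simp
    then show ?thesis by (induction A rule: infinite_finite_induct) (simp_all add: coord_add)
  qed
  have raise_S: "nf_e m n lam (pred_idx q) q S = 0" if "q \<in> idx m n" "pred_idx q \<in> idx m n" for q
    unfolding S_def using raise_sing[OF ab(1,2,3) less_imp_le[OF ab(4)] that] cf by (auto split: if_splits)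
  show "nf_e m n lam i j S = 0" if "i \<in> idx m n" "j \<in> idx m n" "i < j" for i j
    by (rule raise_all[OF raise_S that])
  show "nf_e m n lam i i S = pm_scale (mu i) S" if "i \<in> idx m n" for i
    using weight_sing[OF ab(1,3) that] by (simp add: S_def mu_def eq_commute)
  show "S \<noteq> 0"
  proof
    assume "S = 0"
    let ?c = "\<lambda>J. coord m n lam (chain a ?V b) (wact (chain a J b) ?v)"
    \<comment> \<open>A chain determines its subset, so the functional of the full chain vanishes on
      all the others.\<close>
    have z: "?c J = 0" if "J \<in> Pow ?V - {?V}" for J
    proof -
      have "finite J" "b \<notin> J" "b \<notin> ?V" using that finite_subset[OF _ finite_ivl] by (auto simp: ivl_def)
      then have "chain a ?V b \<noteq> chain a J b" using that chain_inj[of ?V J b a] by auto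
      then show ?thesis
        using coord_wact[OF decreasing_chain[OF ab(1,3,4)] decreasing_chain[OF ab(1,3,4)], of ?V J lam] that
        by auto
    qed
    have "0 = coord m n lam (chain a ?V b) S" using \<open>S = 0\<close> coord_scale[of m n lam _ 0 0] by simp
    also have "\<dots> = (\<Sum>J\<in>Pow ?V. ?d J * ?c J)" by (simp add: S coord_sum coord_scale)
    also have "\<dots> = ?d ?V * ?c ?V + (\<Sum>J\<in>Pow ?V - {?V}. ?d J * ?c J)"
      by (rule sum.remove) auto
    also have "(\<Sum>J\<in>Pow ?V - {?V}. ?d J * ?c J) = 0"
      by (rule sum.neutral) (use z in auto)
    finally have "?c ?V = 0" by simp
    then show False
      using coord_wact[OF decreasing_chain[OF ab(1,3,4)] decreasing_chain[OF ab(1,3,4)], of ?V ?V lam] by auto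
  qed
  show "\<exists>c. nf m n lam p = pm_scale c S" if p: "primitive m n lam mu p"
  proof -
    let ?f = "nf m n lam p"
    have "?f = (\<Sum>w\<in>Poly_Mapping.keys p. pm_scale (Poly_Mapping.lookup p w) (wact w ?v))"
      by (subst pm_expand[of p]) (simp add: nf_sum nf_linear nf_single)
    moreover have "wact w ?v \<in> lower_span" if "w \<in> Poly_Mapping.keys p" for w
      using p that by (intro wact_in_lower_span) (auto simp: primitive_def tcar_iff good_word_def)
    ultimately have "?f \<in> lower_span"
      unfolding lower_span_def by (auto intro!: pm.span_sum pm.span_scale)
    then obtain x where x: "?f = (\<Sum>J\<in>Pow ?V. pm_scale (x J) (wact (chain a J b) ?v))"
      using weight_space_chains[OF _ ab(1,3,4), of ?f] p by (auto simp: primitive_def mu_def)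
    define g where "g = ?f - pm_scale (x ?V) S"
    have g: "g = (\<Sum>J\<in>Pow ?V. pm_scale (x J - x ?V * ?d J) (wact (chain a J b) ?v))"
      unfolding g_def S x by (simp add: pm.scale_sum_right pm.scale_left_diff_distrib sum_subtractf)
    have q: "pred_idx q \<in> idx m n" "q \<in> idx m n" "pred_idx q < q" if "q \<in> ?V" for q
      using that pred_idx_mem[of q m n a] ab pred_idx_less[of q] by (auto simp: ivl_def)
    have "nf_e m n lam (pred_idx q) q g = 0" if "q \<in> ?V" for q
      using q[OF that] p raise_S by (simp add: g_def e.diff e.scale primitive_def)
    then have cz: "x J - x ?V * ?d J = 0" if "J \<subseteq> ?V" for J
      using chain_coeffs_vanish[of "coord m n lam" a b g "\<lambda>J. x J - x ?V * ?d J" J]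
        coord_add coord_scale coord_wact ab g that by (simp add: nf_single)
    have "g = 0"
      unfolding g by (rule sum.neutral, rule ballI) (simp only: cz Pow_iff pm.scale_zero_left)
    then show ?thesis by (intro exI[of _ "x ?V"]) (simp add: g_def)
  qed
qed

theorem theorem1:
  fixes m n s t :: nat and lam beta :: weight
  assumes "1 \<le> m" and "1 \<le> n"
    and "1 \<le> s" and "s \<le> m" and "1 \<le> t" and "t \<le> n"
    and "beta = weight_diff (delta s) (eps t)"
    and "atypical m n beta lam"
  defines "M \<equiv> verma m n lam"
    and "M' \<equiv> verma m n (weight_diff lam beta)"
    and "v \<equiv> S_elem m n s t lam \<odot>\<^bsub>verma m n lam\<^esub> verma_hw m n lam"
  shows "singular m n M v \<and> has_weight m n M (weight_diff lam beta) v
    \<and> (\<forall>w. singular m n M w \<and> has_weight m n M (weight_diff lam beta) w \<longrightarrow>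
          (\<exists>c. c \<noteq> 0 \<and> w = env_const m n c \<odot>\<^bsub>M\<^esub> v))
    \<and> (\<exists>\<Phi> :: complex \<Rightarrow> pre_tensor set \<Rightarrow> pre_tensor set.
          bij_betw \<Phi> UNIV (Hom_g m n M' M)
          \<and> (\<forall>c d. \<forall>x\<in>carrier M'. \<Phi> (c + d) x = \<Phi> c x \<oplus>\<^bsub>M\<^esub> \<Phi> d x)
          \<and> (\<forall>c d. \<forall>x\<in>carrier M'. \<Phi> (c * d) x = env_const m n c \<odot>\<^bsub>M\<^esub> \<Phi> d x))"
proof -
  define a b where "a = - int s" and "b = int t"
  have ab: "a \<in> idx m n" "a < 0" "b \<in> idx m n" "a < b" "0 < b"
    using assms by (auto simp: a_def b_def idx_def)
  have at: "lam a + lam b + of_nat s - of_nat t = 0"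
    using atypical_iff[of s m t n lam] assms by (simp add: a_def b_def)
  \<comment> \<open>For the positive index \<open>b\<close> this value is -(a_s + b_t + s - t), the
    negative of the atypicality expression.\<close>
  have cf: "cf lam a b = 0"
    using at ab by (simp add: cf_def) (simp add: a_def b_def algebra_simps)
  have btw: "between m n s t = ivl m n a b"
    by (simp add: between_def ivl_def a_def b_def)
  have cc: "c_coeff s t lam k = cf lam a k" if "k \<in> ivl m n a b" for k
  proof -
    \<comment> \<open>Substituting this for b_t turns the given constants with positive index into
      those that depend only on the start.\<close>
    have "lam b = of_nat t - of_nat s - lam a" using at by (simp add: algebra_simps eq_diff_eq)
    then show ?thesis by (simp add: c_coeff_def cf_def a_def b_def algebra_simps)
  qed
  interpret gl_hw pm_scale m n "nf_e m n lam" lam "nf m n lam 1" by (rule gl_hw_nf)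
  let ?S = "\<Sum>J\<in>Pow (between m n s t). tens_const (d_coeff m n s t lam J) * E_set s t J"
  have S: "?S \<in> tcar m n"
    unfolding btw E_set_chain
  proof (intro tcar_closed tcar_const tcar_single)
    fix J assume "J \<in> Pow (ivl m n a b)"
    then show "good_word m n (chain (- int s) J (int t))"
      unfolding good_word_def a_def[symmetric] b_def[symmetric]
      by (intro set_chain ab) (auto simp: ivl_def)
  qed
  have nfS: "nf m n lam ?S = sing a b"
  proof -
    have "nf m n lam ?S = (\<Sum>J\<in>Pow (ivl m n a b). pm_scale (d_coeff m n s t lam J) (wact (chain a J b) (nf m n lam 1)))"
      unfolding btw nf_sum E_set_chain
      by (simp add: nf_single nf_linear a_def b_def flip: pm_scale_eq_mult)
    also have "\<dots> = sing a b"
      using ab cc by (auto simp: sing_def d_coeff_def btw intro!: sum.cong arg_cong2[of _ _ _ _ pm_scale] prod.cong)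
    finally show ?thesis .
  qed
  define mu where "mu = weight_diff lam beta"
  have mu: "mu = (\<lambda>i. lam i + of_bool (i = b) - of_bool (i = a))"
    using assms by (simp add: mu_def weight_diff_def delta_def eps_def a_def b_def fun_eq_iff)
  note su = sing_unique[OF ab(1-4) cf, folded mu]
  have prim: "primitive m n lam mu ?S" and nz: "nf m n lam ?S \<noteq> 0"
    unfolding primitive_def nfS using S su(1-3) by (simp_all add: mu)
  have uniq: "\<exists>c. nf m n lam p = pm_scale c (nf m n lam ?S)" if "primitive m n lam mu p" for p
    unfolding nfS by (rule su(4)[OF that])
  have v: "v = mk m n lam ?S"
    using S by (simp add: v_def S_elem_def mk_hw mk_smult)
  have "\<exists>c. c \<noteq> 0 \<and> w = env_const m n c \<odot>\<^bsub>M\<^esub> v" if w: "singular m n M w" "has_weight m n M mu w" for w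
  proof -
    obtain p where p: "p \<in> tcar m n" "w = mk m n lam p"
      using w by (auto simp: singular_def M_def carrier_verma)
    then have "nf m n lam p \<noteq> 0" "primitive m n lam mu p"
      using w singular_weight_iff[OF p(1), of lam mu] by (auto simp: M_def)
    then obtain c where c: "nf m n lam p = pm_scale c (nf m n lam ?S)" "c \<noteq> 0"
      using uniq by fastforce
    then have "nf m n lam p = nf m n lam (tens_const c * ?S)"
      by (simp only: nf_const_mult)
    then have "w = env_const m n c \<odot>\<^bsub>M\<^esub> v"
      using p S by (simp add: v M_def env_const_def mk_smult mk_eq_iff tcar_closed)
    then show ?thesis using c by blast
  qed
  moreover have "singular m n M v \<and> has_weight m n M mu v"
    unfolding v M_def singular_weight_iff[OF S] using prim nz by blast
  ultimately show ?thesis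
    using Hom_g_bij[OF prim nz uniq] unfolding M_def M'_def mu_def[symmetric] by blast
qed

end
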